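(* Let $T>0$, let $P,Q,R,R_1$ be continuous paths of real $n\times n$ matrices on $[0,T]$ with $P(t),R(t),R_1(t)$ symmetric and $P(t)$ invertible for all $t\in[0,T]$, and let $\Lambda_0,\Lambda_1$ be Lagrangian subspaces of $(\mathbb R^{2n},\omega_0)$ with Lagrangian frames $Z_0,Z_1$ respectively. Consider the Sturm-Liouville system $$-(P\dot y+Qy)^{\cdot}+Q^T\dot y+(R+\lambda R_1)y=0,\qquad z(0)\in\Lambda_0,\quad z(T)\in\Lambda_1,$$ where $z=(x,y)^T$ with $x=P\dot y+Qy$. Assume that the operator $A$ (defined in the context) is nondegenerate, that is, $0$ is not an eigenvalue of this system. Let $\lambda_j$ denote the eigenvalues of the system. Then $$\prod_{j}(1-\lambda_j^{-1})=\det(\gamma_1(T)Z_0,Z_1)\cdot\det(\gamma_0(T)Z_0,Z_1)^{-1},$$ where the infinite product on the left is taken over the eigenvalues $\lambda_j$ counted with multiplicity, and $\gamma_1,\gamma_0$ are the fundamental solutions $\gamma_\lambda$ (defined in the context) for $\lambda=1$ and $\lambda=0$.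
   Context: $\omega_0$ is the standard symplectic form on $\mathbb R^{2n}$ and $J=\begin{pmatrix}0_n&-I_n\\ I_n&0_n\end{pmatrix}$. A Lagrangian frame of a Lagrangian subspace $\Lambda$ is a linear map $Z:\mathbb R^n\to\mathbb R^{2n}$ (a $2n\times n$ matrix) whose image is $\Lambda$. For $2n\times n$ matrices $U,V$, $(U,V)$ denotes the $2n\times 2n$ matrix obtained by placing them side by side. For $\lambda\in\mathbb C$ put $$B_\lambda(t)=\begin{pmatrix}P^{-1}(t)&-P^{-1}(t)Q(t)\\ -Q(t)^TP^{-1}(t)&Q(t)^TP^{-1}(t)Q(t)-R(t)-\lambda R_1(t)\end{pmatrix},$$ and let $\gamma_\lambda(t)$ be the fundamental solution: $\dot\gamma_\lambda(t)=JB_\lambda(t)\gamma_\lambda(t)$, $\gamma_\lambda(0)=I_{2n}$. $A=-\frac{d}{dt}\left(P\frac{d}{dt}+Q\right)+Q^T\frac{d}{dt}+R$ is the self-adjoint operator on $L^2([0,T],\mathbb R^n)$ with domain $$D(\Lambda_0,\Lambda_1)=\{y\in W^{2,2}([0,T],\mathbb R^n):\ z(0)\in\Lambda_0,\ z(T)\in\Lambda_1\},\qquad z=(P\dot y+Qy,\,y)^T.$$ When $A$ is nondegenerate, $A^{-1}$ is a trace class operator. Eigenvalues of the system are the numbers $\lambda\in\mathbb C$ for which the boundary value problem has a nontrivial solution (with the spaces and the subspaces $\Lambda_0,\Lambda_1$ complexified when $\lambda$ is not real). $R_1A^{-1}$ denotes $A^{-1}$ followed by multiplication by $R_1$; $\lambda$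 is a nonzero eigenvalue of the system if and only if $-1/\lambda$ is an eigenvalue of $R_1A^{-1}$. The multiplicity of an eigenvalue $\lambda_j$ means the algebraic multiplicity of $-1/\lambda_j$ as an eigenvalue of $R_1A^{-1}$.
   Formalization: Since P and Q are only continuous, the domain of A is taken as those y for which y and x = Py' + Qy both lie in W^{1,2} and the boundary conditions hold, instead of y in W^{2,2}; the two domains agree when P and Q are C^1. *)

theory Defs
  imports "HOL-Analysis.Analysis"
begin

text \<open>
  Phase space vectors are indexed by \<open>'n + 'n\<close>: the \<open>Inl\<close> block is the momentum part \<open>x\<close>,
  the \<open>Inr\<close> block is the position part \<open>y\<close> of \<open>z = (x, y)\<close>.
\<close>

definition vjoin :: "'a ^ 'n \<Rightarrow> 'a ^ 'n \<Rightarrow> 'a ^ ('n + 'n)" where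
  "vjoin x y = (\<chi> i. case i of Inl k \<Rightarrow> x $ k | Inr k \<Rightarrow> y $ k)"

definition side_by_side :: "'a ^ 'n ^ 'm \<Rightarrow> 'a ^ 'n ^ 'm \<Rightarrow> 'a ^ ('n + 'n) ^ 'm" where
  "side_by_side U V = (\<chi> i. vjoin (U $ i) (V $ i))"

definition block_matrix ::
  "'a ^ 'n ^ 'n \<Rightarrow> 'a ^ 'n ^ 'n \<Rightarrow> 'a ^ 'n ^ 'n \<Rightarrow> 'a ^ 'n ^ 'n \<Rightarrow> 'a ^ ('n + 'n) ^ ('n + 'n)" where
  "block_matrix M11 M12 M21 M22 = vjoin (side_by_side M11 M12) (side_by_side M21 M22)"

abbreviation cmat :: "real ^ 'n ^ 'm \<Rightarrow> complex ^ 'n ^ 'm" where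
  "cmat \<equiv> map_matrix complex_of_real"

definition sympl_J :: "'a::ring_1 ^ ('n::finite + 'n) ^ ('n + 'n)" where
  "sympl_J = block_matrix 0 (- mat 1) (mat 1) 0"

definition omega0 :: "real ^ ('n::finite + 'n) \<Rightarrow> real ^ ('n + 'n) \<Rightarrow> real" where
  "omega0 u v = (sympl_J *v u) \<bullet> v"

definition lagrangian :: "(real ^ ('n::finite + 'n)) set \<Rightarrow> bool" where
  "lagrangian L \<longleftrightarrow>
     subspace L \<and> dim L = CARD('n) \<and> (\<forall>u\<in>L. \<forall>v\<in>L. omega0 u v = 0)"

definition lagrangian_frame :: "real ^ 'n ^ ('n + 'n) \<Rightarrow> (real ^ ('n + 'n)) set \<Rightarrow> bool" where
  "lagrangian_frame Z L \<longleftrightarrow> range (\<lambda>u. Z *v u) = L"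

text \<open>The complexification of a real subspace, inside the complex coordinate space.\<close>

definition complexification :: "(real ^ 'm) set \<Rightarrow> (complex ^ 'm) set" where
  "complexification L = {z. (\<chi> i. Re (z $ i)) \<in> L \<and> (\<chi> i. Im (z $ i)) \<in> L}"


subsection \<open>The Hamiltonian system\<close>

definition B_matrix ::
  "(real \<Rightarrow> real ^ 'n ^ 'n) \<Rightarrow> (real \<Rightarrow> real ^ 'n ^ 'n) \<Rightarrow> (real \<Rightarrow> real ^ 'n ^ 'n) \<Rightarrow>
   (real \<Rightarrow> real ^ 'n ^ 'n) \<Rightarrow> complex \<Rightarrow> real \<Rightarrow> complex ^ ('n + 'n) ^ ('n + 'n)" where
  "B_matrix P Q R R1 l t =
     (let Pi = matrix_inv (P t); Qt = transpose (Q t) in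
      block_matrix
        (cmat Pi)              (- cmat (Pi ** Q t))
        (- cmat (Qt ** Pi))    (cmat (Qt ** Pi ** Q t) - cmat (R t) - mat l ** cmat (R1 t)))"

definition fundamental_solution ::
  "real \<Rightarrow> (real \<Rightarrow> complex ^ 'm ^ 'm) \<Rightarrow> (real \<Rightarrow> complex ^ 'm ^ 'm) \<Rightarrow> bool" where
  "fundamental_solution T H \<gamma> \<longleftrightarrow> \<gamma> 0 = mat 1 \<and>
     (\<forall>t\<in>{0..T}. (\<gamma> has_vector_derivative H t ** \<gamma> t) (at t within {0..T}))"


subsection \<open>Eigenvalues of the boundary value problem\<close>

definition SL_eigenvalue ::
  "real \<Rightarrow> (real \<Rightarrow> real ^ 'n ^ 'n) \<Rightarrow> (real \<Rightarrow> real ^ 'n ^ 'n) \<Rightarrow> (real \<Rightarrow> real ^ 'n ^ 'n) \<Rightarrow>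
   (real \<Rightarrow> real ^ 'n ^ 'n) \<Rightarrow> (real ^ ('n + 'n)) set \<Rightarrow> (real ^ ('n + 'n)) set \<Rightarrow>
   complex \<Rightarrow> bool" where
  "SL_eigenvalue T P Q R R1 L0 L1 l \<longleftrightarrow>
     (\<exists>y y' x x' :: real \<Rightarrow> complex ^ 'n.
        (\<forall>t\<in>{0..T}.
           (y has_vector_derivative y' t) (at t within {0..T}) \<and>
           x t = cmat (P t) *v y' t + cmat (Q t) *v y t \<and>
           (x has_vector_derivative x' t) (at t within {0..T}) \<and>
           - x' t + cmat (transpose (Q t)) *v y' t
             + (cmat (R t) + mat l ** cmat (R1 t)) *v y t = 0) \<and>
        vjoin (x 0) (y 0) \<in> complexification L0 \<and>
        vjoin (x T) (y T) \<in> complexification L1 \<and>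
        (\<exists>t\<in>{0..T}. y t \<noteq> 0))"


subsection \<open>The operators $A$ and $R_1 A^{-1}$\<close>

text \<open>
  Elements of $L^2([0,T], \mathbb{C}^n)$ are represented by functions, equality being equality
  almost everywhere on $[0,T]$.  Linear operators on this space are represented by their graphs.
\<close>

definition L2 :: "real \<Rightarrow> (real \<Rightarrow> complex ^ 'n) set" where
  "L2 T = {f. f \<in> borel_measurable (lebesgue_on {0..T}) \<and>
              integrable (lebesgue_on {0..T}) (\<lambda>t. (norm (f t))\<^sup>2)}"

definition L2_eq :: "real \<Rightarrow> (real \<Rightarrow> complex ^ 'n) \<Rightarrow> (real \<Rightarrow> complex ^ 'n) \<Rightarrow> bool" where
  "L2_eq T f g \<longleftrightarrow> (AE t in lebesgue_on {0..T}. f t = g t)"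

text \<open>
  \<open>W12 T y v\<close>: \<open>y\<close> is (the continuous representative of) an element of $W^{1,2}([0,T])$ and
  \<open>v\<close> is its derivative, i.e. \<open>y\<close> is absolutely continuous with derivative \<open>v\<close> in $L^2$.
\<close>

definition W12 :: "real \<Rightarrow> (real \<Rightarrow> complex ^ 'n) \<Rightarrow> (real \<Rightarrow> complex ^ 'n) \<Rightarrow> bool" where
  "W12 T y v \<longleftrightarrow> v \<in> L2 T \<and> (\<forall>t\<in>{0..T}. (v has_integral (y t - y 0)) {0..t})"

text \<open>
  \<open>SL_operator \<dots> y f\<close>: \<open>y\<close> lies in the domain of $A$ and $A y = f$.  As $P$ and $Q$ are only
  continuous, $A$ is taken on its natural (quasi-derivative) domain: \<open>y\<close> and
  \<open>x = P y' + Q y\<close> both belong to $W^{1,2}$.  This is the domain on which $A$ is self-adjoint;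
  for $C^1$ coefficients $P$, $Q$ it consists exactly of the $W^{2,2}$ functions
  satisfying the boundary conditions.
\<close>

definition SL_operator ::
  "real \<Rightarrow> (real \<Rightarrow> real ^ 'n ^ 'n) \<Rightarrow> (real \<Rightarrow> real ^ 'n ^ 'n) \<Rightarrow> (real \<Rightarrow> real ^ 'n ^ 'n) \<Rightarrow>
   (real ^ ('n + 'n)) set \<Rightarrow> (real ^ ('n + 'n)) set \<Rightarrow>
   (real \<Rightarrow> complex ^ 'n) \<Rightarrow> (real \<Rightarrow> complex ^ 'n) \<Rightarrow> bool" where
  "SL_operator T P Q R L0 L1 y f \<longleftrightarrow>
     f \<in> L2 T \<and>
     (\<exists>y' x x'.
        W12 T y y' \<and> W12 T x x' \<and>
        L2_eq T x (\<lambda>t. cmat (P t) *v y' t + cmat (Q t) *v y t) \<and>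
        L2_eq T f (\<lambda>t. - x' t + cmat (transpose (Q t)) *v y' t + cmat (R t) *v y t) \<and>
        vjoin (x 0) (y 0) \<in> complexification L0 \<and>
        vjoin (x T) (y T) \<in> complexification L1)"

definition R1_A_inv ::
  "real \<Rightarrow> (real \<Rightarrow> real ^ 'n ^ 'n) \<Rightarrow> (real \<Rightarrow> real ^ 'n ^ 'n) \<Rightarrow> (real \<Rightarrow> real ^ 'n ^ 'n) \<Rightarrow>
   (real \<Rightarrow> real ^ 'n ^ 'n) \<Rightarrow> (real ^ ('n + 'n)) set \<Rightarrow> (real ^ ('n + 'n)) set \<Rightarrow>
   (real \<Rightarrow> complex ^ 'n) \<Rightarrow> (real \<Rightarrow> complex ^ 'n) \<Rightarrow> bool" where
  "R1_A_inv T P Q R R1 L0 L1 f g \<longleftrightarrow>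
     g \<in> L2 T \<and> (\<exists>y. SL_operator T P Q R L0 L1 y f \<and> L2_eq T g (\<lambda>t. cmat (R1 t) *v y t))"


subsection \<open>Algebraic multiplicity\<close>

text \<open>The kernel of $(K - \mu)^k$ in $L^2([0,T], \mathbb{C}^n)$ for an operator with graph \<open>K\<close>.\<close>

primrec ker_power ::
  "real \<Rightarrow> ((real \<Rightarrow> complex ^ 'n) \<Rightarrow> (real \<Rightarrow> complex ^ 'n) \<Rightarrow> bool) \<Rightarrow> complex \<Rightarrow> nat \<Rightarrow>
   (real \<Rightarrow> complex ^ 'n) set" where
  "ker_power T K \<mu> 0 = {f \<in> L2 T. L2_eq T f (\<lambda>t. 0)}"
| "ker_power T K \<mu> (Suc k) =
     {f \<in> L2 T. \<exists>g. K f g \<and> (\<lambda>t. g t - \<mu> *s f t) \<in> ker_power T K \<mu> k}"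

text \<open>
  \<open>L2_has_dim T G d\<close>: modulo equality almost everywhere, the complex vector space \<open>G\<close> has a
  basis with \<open>d\<close> elements.  In particular \<open>G\<close> is finite-dimensional.
\<close>

definition L2_has_dim :: "real \<Rightarrow> (real \<Rightarrow> complex ^ 'n) set \<Rightarrow> nat \<Rightarrow> bool" where
  "L2_has_dim T G d \<longleftrightarrow>
     (\<exists>b :: nat \<Rightarrow> real \<Rightarrow> complex ^ 'n. (\<forall>i<d. b i \<in> G) \<and>
        (\<forall>g\<in>G. \<exists>!c :: nat \<Rightarrow> complex.
           (\<forall>i\<ge>d. c i = 0) \<and> L2_eq T g (\<lambda>t. \<Sum>i<d. c i *s b i t)))"

definition has_alg_multiplicity ::
  "real \<Rightarrow> ((real \<Rightarrow> complex ^ 'n) \<Rightarrow> (real \<Rightarrow> complex ^ 'n) \<Rightarrow> bool) \<Rightarrow> complex \<Rightarrow> nat \<Rightarrow> bool" where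
  "has_alg_multiplicity T K \<mu> m \<longleftrightarrow> L2_has_dim T (\<Union>k. ker_power T K \<mu> k) m"

text \<open>
  The family \<open>\<lambda>\<^sub>j\<close>, \<open>j \<in> I\<close>, lists the eigenvalues of the system, each one as often as its
  multiplicity.  The index set \<open>I\<close> may be finite, infinite or empty.
\<close>

definition eigenvalue_list ::
  "real \<Rightarrow> (real \<Rightarrow> real ^ 'n ^ 'n) \<Rightarrow> (real \<Rightarrow> real ^ 'n ^ 'n) \<Rightarrow> (real \<Rightarrow> real ^ 'n ^ 'n) \<Rightarrow>
   (real \<Rightarrow> real ^ 'n ^ 'n) \<Rightarrow> (real ^ ('n + 'n)) set \<Rightarrow> (real ^ ('n + 'n)) set \<Rightarrow>
   nat set \<Rightarrow> (nat \<Rightarrow> complex) \<Rightarrow> bool" where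
  "eigenvalue_list T P Q R R1 L0 L1 I l \<longleftrightarrow>
     (\<forall>j\<in>I. SL_eigenvalue T P Q R R1 L0 L1 (l j)) \<and>
     (\<forall>\<mu>. SL_eigenvalue T P Q R R1 L0 L1 \<mu> \<longrightarrow>
        finite {j\<in>I. l j = \<mu>} \<and>
        has_alg_multiplicity T (R1_A_inv T P Q R R1 L0 L1) (- 1 / \<mu>) (card {j\<in>I. l j = \<mu>}))"

end

theory Submission
  imports Defs "HOL-Complex_Analysis.Complex_Analysis"
begin

text \<open>
  Let \<open>D \<lambda> = det (\<gamma>\<^sub>\<lambda>(T) Z\<^sub>0, Z\<^sub>1)\<close>.  A solution of the system with \<open>z(0)\<close> in \<open>\<Lambda>\<^sub>0\<close> is
  \<open>z(t) = \<gamma>\<^sub>\<lambda>(t) Z\<^sub>0 u\<close>, and \<open>z(T)\<close> lies in \<open>\<Lambda>\<^sub>1\<close> exactly when \<open>\<gamma>\<^sub>\<lambda>(T) Z\<^sub>0 u + Z\<^sub>1 w = 0\<close> for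
  some \<open>w\<close>; so the eigenvalues are the zeros of \<open>D\<close>, and \<open>D 0 \<noteq> 0\<close> by nondegeneracy.  The theorem is the
  value at \<open>1\<close> of the factorization \<open>D \<lambda> / D 0 = \<Prod>(1 - \<lambda>/\<lambda>\<^sub>j)\<close>.  Two things have to be shown: that this
  factorization has no exponential factor, and that the order of a zero of \<open>D\<close> is the algebraic
  multiplicity of the eigenvalue.

  \<^bold>\<open>The factorization.\<close>  \<open>D\<close> is entire, because \<open>\<gamma>\<^sub>\<lambda>(T)\<close> is a convergent power series around
  every \<open>\<lambda>\<close> (\<open>gamma_has_fps_expansion\<close>).  In the Hamiltonian system the parameter enters only through the term
  \<open>\<lambda> R\<^sub>1 y\<close> of the equation for \<open>x\<close>.  Weighting \<open>y\<close> with \<open>\<surd>\<bar>\<lambda>\<bar>\<close> balances the two equations, and Gronwall's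
  argument gives \<open>\<bar>\<gamma>\<^sub>\<lambda>(T)\<bar> \<le> exp (C (1 + \<surd>\<bar>\<lambda>\<bar>))\<close> (\<open>gamma_growth\<close>).  So \<open>D\<close> has order at most one half, and
  by Hadamard's argument it is the product over its zeros (\<open>has_prod_zeros\<close>): the zeros are sparse
  enough for \<open>\<Sum>1/\<bar>\<lambda>\<^sub>j\<bar>\<close> to converge, and by the Borel-Caratheodory inequality the quotient of \<open>D\<close> by
  the finite product over the zeros in a disc of radius \<open>r\<close> tends to \<open>D 0\<close> as \<open>r\<close> grows.

  \<^bold>\<open>The multiplicity.\<close>  Put \<open>K = R\<^sub>1 A\<inverse>\<close> and \<open>\<mu> = -1/\<lambda>\<^sub>0\<close>.  A vector \<open>f\<close> lies in the generalized eigenspace of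
  \<open>K\<close> at \<open>\<mu>\<close> iff it is the first member \<open>\<phi>\<^sub>0\<close> of a finite chain with \<open>(1 + \<lambda>\<^sub>0 K) \<phi>\<^sub>i = - K \<phi>\<^bsub>i+1\<^esub>\<close>.  In terms
  of \<open>y\<^sub>i = A\<inverse> \<phi>\<^sub>i\<close> such a chain is a sequence of solutions of the differentiated systems
  \<open>z\<^sub>i' = J B z\<^sub>i + H z\<^bsub>i+1\<^esub>\<close>, where \<open>J B\<close> is taken at \<open>\<lambda>\<^sub>0\<close> and \<open>H\<close> is its derivative in \<open>\<lambda>\<close>.
  Solving these with the Taylor coefficients of \<open>\<gamma>\<close> at \<open>\<lambda>\<^sub>0\<close> turns the boundary conditions into
  \<open>M q = 0\<close>.  Here \<open>q\<close> is the sequence of boundary data \<open>(u, w)\<close>, seen as the coefficients of a principal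
  part in \<open>\<epsilon> = \<lambda> - \<lambda>\<^sub>0\<close>, \<open>M\<close> is the Taylor series of the matrix \<open>(\<gamma>\<^sub>\<lambda>(T) Z\<^sub>0, Z\<^sub>1)\<close>, and products are
  taken modulo regular terms.  The dimension of the space of such
  principal parts is the order of vanishing of \<open>det M\<close> (\<open>shift_kernel_basis\<close>), that is, of \<open>D\<close> at \<open>\<lambda>\<^sub>0\<close>.
\<close>

no_notation fps_nth (infixl "$" 75)

section \<open>Entire functions of order at most one half\<close>

lemma entire_divide_zero:
  fixes f :: "complex \<Rightarrow> complex"
  assumes "f holomorphic_on UNIV" "f a = 0" "a \<noteq> 0"
  obtains g where "g holomorphic_on UNIV" "\<And>z. f z = g z * (1 - z / a)"
proof
  let ?h = "\<lambda>z. if z = a then deriv f a else (f z - f a) / (z - a)"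
  have "?h holomorphic_on UNIV"
    using pole_lemma[OF assms(1), of a] by simp
  then show "(\<lambda>z. - a * ?h z) holomorphic_on UNIV"
    by (intro holomorphic_intros)
  show "f z = - a * ?h z * (1 - z / a)" for z
    using assms by (auto simp: field_simps)
qed

text \<open>
  Each factor that vanishes at \<open>a\<close> contributes one to the order.  The order of the cofactor \<open>g\<close> at \<open>a\<close>
  therefore shows whether \<open>F\<close> already contains all zeros at \<open>a\<close>.
\<close>
lemma zorder_mult_linear_factors:
  fixes f g :: "complex \<Rightarrow> complex"
  assumes g: "g holomorphic_on UNIV" "g 0 \<noteq> 0" and F: "finite F" "\<And>j. j \<in> F \<Longrightarrow> l j \<noteq> 0"
    and f: "\<And>z. f z = g z * (\<Prod>j\<in>F. 1 - z / l j)"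
  shows "zorder f a = zorder g a + int (card {j\<in>F. l j = a})"
    and "g a = 0 \<Longrightarrow> zorder g a > 0" and "g a \<noteq> 0 \<Longrightarrow> zorder g a = 0"
proof -
  define h where "h = zor_poly g a"
  have "\<exists>w\<in>UNIV. g w \<noteq> 0" using g(2) by auto
  note zorder_exist_zero[OF g(1) open_UNIV connected_UNIV UNIV_I this, of a, folded h_def]
  then obtain r where z: "if g a = 0 then zorder g a > 0 else zorder g a = 0"
    and r: "r > 0" "h holomorphic_on cball a r"
      "\<And>w. w \<in> cball a r \<Longrightarrow> g w = h w * (w - a) ^ nat (zorder g a) \<and> h w \<noteq> 0"
    by meson
  then have nn: "zorder g a \<ge> 0" by (auto split: if_splits)
  let ?k = "card {j\<in>F. l j = a}"
  define p where "p = (\<lambda>w. h w * (\<Prod>j\<in>{j\<in>F. l j \<noteq> a}. 1 - w / l j) * (- 1 / a) ^ ?k)"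
  show "zorder f a = zorder g a + int ?k"
  proof (rule zorder_eqI)
    show "open (ball a r)" "a \<in> ball a r" using r by auto
    show "p holomorphic_on ball a r" unfolding p_def
      by (intro holomorphic_intros holomorphic_on_subset[OF r(2)]) (use F in auto)
    have "h a \<noteq> 0" using r by auto
    moreover have "?k \<noteq> 0 \<Longrightarrow> a \<noteq> 0" using F by (auto simp: card_eq_0_iff)
    ultimately show "p a \<noteq> 0"
      unfolding p_def using F by auto
  next
    fix w assume w: "w \<in> ball a r" "w \<noteq> a"
    have "(\<Prod>j\<in>F. 1 - w / l j) =
        (\<Prod>j\<in>{j\<in>F. l j \<noteq> a}. 1 - w / l j) * (\<Prod>j\<in>{j\<in>F. l j = a}. 1 - w / l j)"
      using F(1) by (subst prod.union_disjoint[symmetric]) (auto intro!: prod.cong)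
    also have "(\<Prod>j\<in>{j\<in>F. l j = a}. 1 - w / l j) = (\<Prod>j\<in>{j\<in>F. l j = a}. (- 1 / a) * (w - a))"
      using F(2) by (intro prod.cong) (auto simp: field_simps)
    also have "\<dots> = (- 1 / a) ^ ?k * (w - a) ^ ?k"
      by (simp only: prod_constant power_mult_distrib)
    finally have "f w = p w * ((w - a) ^ nat (zorder g a) * (w - a) ^ ?k)"
      unfolding f p_def using r(3)[of w] w by (simp add: mult_ac)
    also have "(w - a) ^ nat (zorder g a) * (w - a) ^ ?k = (w - a) powi (zorder g a + int ?k)"
      using nn w by (subst power_int_add) (auto simp: power_int_def)
    finally show "f w = p w * (w - a) powi (zorder g a + int ?k)" .
  qed
  show "g a = 0 \<Longrightarrow> zorder g a > 0" and "g a \<noteq> 0 \<Longrightarrow> zorder g a = 0"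
    using z by auto
qed

text \<open>
  The map \<open>w \<mapsto> w / (2M - w)\<close> sends the half plane \<open>Re w < M\<close> into the unit disc and fixes \<open>0\<close>, so the Schwarz
  lemma applies to its composition with \<open>h\<close>.
\<close>
lemma Borel_Caratheodory:
  fixes h :: "complex \<Rightarrow> complex"
  assumes h: "h holomorphic_on ball 0 r" "h 0 = 0" and M: "\<And>z. norm z < r \<Longrightarrow> Re (h z) < M"
    and z: "norm z < r"
  shows "norm (h z) \<le> 2 * M * norm z / (r - norm z)"
proof -
  have r: "r > 0" using z by (meson norm_ge_zero order_le_less_trans)
  have M0: "M > 0" using M[of 0] h r by simp
  define \<phi> where "\<phi> = (\<lambda>w. h (of_real r * w) / (2 * of_real M - h (of_real r * w)))"
  have in_ball: "of_real r * w \<in> ball 0 r" if "norm w < 1" for w :: complex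
    using that r by (simp add: norm_mult)
  have lt: "norm (h (of_real r * w)) < norm (2 * of_real M - h (of_real r * w))" if "norm w < 1" for w
  proof -
    define x where "x = h (of_real r * w)"
    have x: "Re x < M" using M in_ball[OF that] by (simp add: x_def)
    have "(norm x)\<^sup>2 < (norm (2 * of_real M - x))\<^sup>2"
    proof -
      have "(norm (2 * of_real M - x))\<^sup>2 = (2 * M - Re x)\<^sup>2 + (Im x)\<^sup>2"
        unfolding cmod_power2 by simp
      also have "\<dots> = (norm x)\<^sup>2 + 4 * (M * (M - Re x))"
        unfolding cmod_power2 by (simp add: power2_eq_square algebra_simps)
      finally show ?thesis using mult_pos_pos[of M "M - Re x"] x M0 by simp
    qed
    then show ?thesis unfolding x_def by (rule power2_less_imp_less) simp
  qed
  have hol: "(\<lambda>w. h (of_real r * w)) holomorphic_on ball 0 1"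
    by (rule holomorphic_on_compose_gen[OF _ h(1), unfolded o_def])
      (use in_ball in \<open>auto intro!: holomorphic_intros\<close>)
  have "\<phi> holomorphic_on ball 0 1" unfolding \<phi>_def
  proof (intro holomorphic_on_divide hol holomorphic_intros)
    fix w :: complex assume "w \<in> ball 0 1"
    then show "2 * of_real M - h (of_real r * w) \<noteq> 0" using lt[of w] by auto
  qed
  moreover have "\<phi> 0 = 0" by (simp add: \<phi>_def h)
  moreover have "norm (\<phi> w) < 1" if "norm w < 1" for w
    using lt[OF that] unfolding \<phi>_def norm_divide
    by (subst divide_less_eq_1_pos) (auto intro: order_le_less_trans[OF norm_ge_zero])
  moreover have "norm (z / of_real r) < 1" using z r by (simp add: norm_divide)
  ultimately have "norm (\<phi> (z / of_real r)) \<le> norm (z / of_real r)"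
    by (rule Schwarz_Lemma(1))
  moreover have "\<phi> (z / of_real r) = h z / (2 * of_real M - h z)" using r by (simp add: \<phi>_def)
  ultimately have "norm (h z) / norm (2 * of_real M - h z) \<le> norm z / r"
    using r by (simp add: norm_divide)
  moreover have "norm (2 * of_real M - h z) > 0"
    using lt[of "z / of_real r"] z r by (auto simp: norm_divide intro: order_le_less_trans[OF norm_ge_zero])
  ultimately have "norm (h z) * r \<le> norm z * norm (2 * of_real M - h z)"
    using r by (simp add: field_simps)
  also have "\<dots> \<le> norm z * (2 * M + norm (h z))"
    using M0 norm_triangle_ineq4[of "2 * of_real M" "h z"] by (intro mult_left_mono) auto
  finally have "norm (h z) * (r - norm z) \<le> 2 * M * norm z"
    by (simp add: algebra_simps)
  then show ?thesis using z by (simp add: pos_le_divide_eq)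
qed

text \<open>
  The zeros of \<open>f\<close> are listed by \<open>l\<close> over the index set \<open>I\<close>, each as often as its order.
\<close>
locale zero_family =
  fixes f :: "complex \<Rightarrow> complex" and I :: "nat set" and l :: "nat \<Rightarrow> complex" and C c :: real
  assumes f_entire: "f holomorphic_on UNIV" and f0: "f 0 \<noteq> 0"
    and growth: "\<And>z. norm (f z) \<le> C * exp (c * sqrt (norm z))" and c0: "c \<ge> 0"
    and zeros: "\<And>j. j \<in> I \<Longrightarrow> f (l j) = 0"
    and mult: "\<And>a. f a = 0 \<Longrightarrow> finite {j\<in>I. l j = a} \<and> int (card {j\<in>I. l j = a}) = zorder f a"
begin

lemma nonzero: "j \<in> I \<Longrightarrow> l j \<noteq> 0"
  using zeros f0 by metis

text \<open>
  As long as some index is left over, the cofactor still vanishes at the corresponding point, because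
  the order of \<open>f\<close> there exceeds the number of factors divided out so far.
\<close>
lemma divide_zeros:
  assumes "finite F" "F \<subseteq> I"
  shows "\<exists>g. g holomorphic_on UNIV \<and> (\<forall>z. f z = g z * (\<Prod>j\<in>F. 1 - z / l j))"
  using assms
proof (induction F rule: finite_induct)
  case empty
  then show ?case using f_entire by auto
next
  case (insert i F)
  then obtain g where g: "g holomorphic_on UNIV" "\<And>z. f z = g z * (\<Prod>j\<in>F. 1 - z / l j)" by auto
  have g0: "g 0 \<noteq> 0" using g(2)[of 0] f0 by auto
  have fin: "finite {j\<in>I. l j = l i}" and
    card: "int (card {j\<in>I. l j = l i}) = zorder f (l i)"
    using mult[of "l i"] zeros insert by auto
  have nz: "l j \<noteq> 0" if "j \<in> F" for j using that nonzero insert by auto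
  have "card {j\<in>F. l j = l i} < card {j\<in>I. l j = l i}"
    using insert by (intro psubset_card_mono fin) auto
  then have "g (l i) = 0"
    using zorder_mult_linear_factors[OF g(1) g0 \<open>finite F\<close> nz g(2), where a="l i"] card by auto
  then obtain h where h: "h holomorphic_on UNIV" "\<And>z. g z = h z * (1 - z / l i)"
    using entire_divide_zero[OF g(1), of "l i"] nonzero insert by auto
  have "f z = h z * (\<Prod>j\<in>insert i F. 1 - z / l j)" for z
    using insert.hyps by (simp add: g(2) h(2) mult_ac)
  then show ?case using h(1) by blast
qed

text \<open>
  On the circle of radius \<open>3r\<close> every factor belonging to a zero in the disc of radius \<open>r\<close> has modulus
  at least \<open>2\<close>; the maximum modulus principle carries the resulting bound inside.
\<close>
lemma quotient_bound:
  assumes F: "finite F" "F \<subseteq> I" "\<And>j. j \<in> F \<Longrightarrow> norm (l j) \<le> r" and r: "r > 0"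
    and g: "g holomorphic_on UNIV" "\<And>z. f z = g z * (\<Prod>j\<in>F. 1 - z / l j)"
    and z: "norm z \<le> 3 * r"
  shows "norm (g z) \<le> C * exp (c * sqrt (3 * r)) / 2 ^ card F"
proof (rule maximum_modulus_frontier[where S = "cball 0 (3 * r)" and f = g])
  show "g holomorphic_on interior (cball 0 (3 * r))"
    using g(1) by (rule holomorphic_on_subset) auto
  show "continuous_on (closure (cball 0 (3 * r))) g"
    using g(1) by (intro holomorphic_on_imp_continuous_on holomorphic_on_subset[OF g(1)]) auto
  show "bounded (cball (0::complex) (3 * r))" "z \<in> cball 0 (3 * r)" using z by auto
  fix w :: complex assume "w \<in> frontier (cball 0 (3 * r))"
  then have w: "norm w = 3 * r" using r by (simp add: sphere_def)
  have "2 ^ card F = (\<Prod>j\<in>F. 2 :: real)" by simp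
  also have "\<dots> \<le> (\<Prod>j\<in>F. norm (1 - w / l j))"
  proof (rule prod_mono, intro conjI)
    fix j assume j: "j \<in> F"
    then have "norm (l j) > 0" using nonzero F by auto
    then have "3 \<le> norm (w / l j)" using F(3)[OF j] w by (simp add: norm_divide field_simps)
    then show "2 \<le> norm (1 - w / l j)"
      using norm_triangle_ineq2[of "w / l j" 1] by (simp add: norm_minus_commute)
  qed auto
  finally have "norm (g w) * 2 ^ card F \<le> norm (g w) * (\<Prod>j\<in>F. norm (1 - w / l j))"
    by (intro mult_left_mono) auto
  also have "\<dots> = norm (f w)" by (simp add: g(2) norm_mult prod_norm)
  also have "\<dots> \<le> C * exp (c * sqrt (3 * r))" using growth[of w] w by simp
  finally show "norm (g w) \<le> C * exp (c * sqrt (3 * r)) / 2 ^ card F"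
    by (simp add: pos_le_divide_eq)
qed

text \<open>
  Coefficients of the bound \<open>count_const + count_slope * \<surd>r\<close> for the number of zeros in the disc of radius \<open>r\<close>.
\<close>
definition count_const where "count_const = ln (C / norm (f 0)) / ln 2"
definition count_slope where "count_slope = c * sqrt 3 / ln 2"

lemma C_ge: "C \<ge> norm (f 0)" and C_pos: "C > 0"
  using growth[of 0] f0 by (auto intro: order_less_le_trans[of 0 "norm (f 0)"])

lemma count_nonneg: "count_const \<ge> 0" "count_slope \<ge> 0"
  using C_ge f0 c0 by (auto simp: count_const_def count_slope_def)

lemma ln_growth: "r \<ge> 0 \<Longrightarrow> ln (C * exp (c * sqrt (3 * r)) / norm (f 0)) = (count_const + count_slope * sqrt r) * ln 2"
  using C_pos f0 by (simp add: ln_div ln_mult real_sqrt_mult count_const_def count_slope_def field_simps)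

text \<open>
  Evaluate \<open>quotient_bound\<close> at the origin, where all factors are \<open>1\<close>: the gain \<open>2\<^sup>n\<close> cannot exceed the growth of \<open>f\<close>.
\<close>
lemma zero_count:
  assumes F: "finite F" "F \<subseteq> I" "\<And>j. j \<in> F \<Longrightarrow> norm (l j) \<le> r" and r: "r > 0"
  shows "real (card F) \<le> count_const + count_slope * sqrt r"
proof -
  obtain g where g: "g holomorphic_on UNIV" "\<And>z. f z = g z * (\<Prod>j\<in>F. 1 - z / l j)"
    using divide_zeros[OF F(1,2)] by auto
  have "norm (f 0) \<le> C * exp (c * sqrt (3 * r)) / 2 ^ card F"
    using quotient_bound[OF F r g, of 0] g(2)[of 0] r by simp
  then have "2 ^ card F \<le> C * exp (c * sqrt (3 * r)) / norm (f 0)"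
    using f0 by (simp add: field_simps)
  then have "ln (2 ^ card F) \<le> ln (C * exp (c * sqrt (3 * r)) / norm (f 0))"
    by (intro ln_mono) auto
  also have "\<dots> = (count_const + count_slope * sqrt r) * ln 2" using ln_growth r by simp
  finally show ?thesis by (simp add: ln_realpow)
qed

lemma finite_zeros_in_disc: "finite {j\<in>I. norm (l j) \<le> r}"
proof (cases "r > 0")
  case True
  show ?thesis
  proof (rule finite_if_finite_subsets_card_bdd[where C = "nat \<lceil>count_const + count_slope * sqrt r\<rceil>", THEN conjunct1])
    fix F assume F: "F \<subseteq> {j\<in>I. norm (l j) \<le> r}" "finite F"
    then have "real (card F) \<le> count_const + count_slope * sqrt r" by (intro zero_count True) auto
    then show "card F \<le> nat \<lceil>count_const + count_slope * sqrt r\<rceil>" by linarith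
  qed
next
  case False
  then have "\<not> norm (l j) \<le> r" if "j \<in> I" for j
    using nonzero[OF that] zero_less_norm_iff[of "l j"] by linarith
  then have "{j\<in>I. norm (l j) \<le> r} \<subseteq> {}" by blast
  then show ?thesis by (rule finite_subset) simp
qed

lemma zero_free_disc: obtains \<rho> where "\<rho> > 0" "\<And>j. j \<in> I \<Longrightarrow> norm (l j) \<ge> \<rho>"
proof -
  have "isCont f 0"
    using holomorphic_on_imp_continuous_on[OF f_entire] by (simp add: continuous_on_eq_continuous_at)
  then obtain \<rho> where \<rho>: "\<rho> > 0" "\<And>z. dist 0 z < \<rho> \<Longrightarrow> f z \<noteq> 0"
    using continuous_at_avoid[of 0 f 0] f0 by blast
  have "norm (l j) \<ge> \<rho>" if "j \<in> I" for j
    using \<rho>(2)[of "l j"] zeros[OF that] by force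
  then show thesis using that \<rho>(1) by blast
qed

text \<open>
  Sum over dyadic shells: the shell \<open>2\<^sup>k \<rho> \<le> \<bar>l j\<bar> \<le> 2\<^bsup>k+1\<^esup> \<rho>\<close> has \<open>O(2\<^bsup>k/2\<^esup>)\<close> members, each contributing at
  most \<open>1/(2\<^sup>k \<rho>)\<close>.
\<close>
lemma summable_inverse_zeros: "summable (\<lambda>j. if j \<in> I then 1 / norm (l j) else 0)"
proof -
  obtain \<rho> where \<rho>: "\<rho> > 0" "\<And>j. j \<in> I \<Longrightarrow> norm (l j) \<ge> \<rho>" using zero_free_disc by blast
  \<comment> \<open>\<open>b k\<close> bounds the contribution of the \<open>k\<close>-th shell, and \<open>\<kappa> j\<close> is the number of the shell of \<open>l j\<close>.\<close>
  define q where "q = 1 / sqrt (2::real)"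
  have q: "0 < q" "q < 1" "q\<^sup>2 = 1 / 2"
    by (auto simp: q_def power_divide real_less_rsqrt)
  define b where "b = (\<lambda>k. (count_const * (1/2) ^ k + count_slope * sqrt (2 * \<rho>) * q ^ k) / \<rho>)"
  have b: "summable b" unfolding b_def
    by (intro summable_divide summable_add summable_mult summable_geometric) (use q in auto)
  have b0: "b k \<ge> 0" for k using count_nonneg q \<rho> by (simp add: b_def)
  define \<kappa> where "\<kappa> = (\<lambda>j. nat \<lfloor>log 2 (norm (l j) / \<rho>)\<rfloor>)"
  have \<kappa>: "2 ^ \<kappa> j * \<rho> \<le> norm (l j)" "norm (l j) \<le> 2 ^ (\<kappa> j + 1) * \<rho>" if "j \<in> I" for j
  proof -
    let ?x = "norm (l j) / \<rho>"
    have x: "?x \<ge> 1" using \<rho>(2)[OF that] \<rho>(1) by simp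
    then have L: "log 2 ?x \<ge> 0" by simp
    then have k: "real (\<kappa> j) \<le> log 2 ?x" "log 2 ?x \<le> real (\<kappa> j + 1)"
      unfolding \<kappa>_def by linarith+
    have "2 powr real (\<kappa> j) \<le> ?x" using k(1) x by (subst (asm) le_log_iff) auto
    then show "2 ^ \<kappa> j * \<rho> \<le> norm (l j)" using \<rho>(1) by (simp add: powr_realpow field_simps)
    have "?x \<le> 2 powr real (\<kappa> j + 1)" using k(2) x by (subst (asm) log_le_iff) auto
    also have "\<dots> = 2 ^ (\<kappa> j + 1)" by (rule powr_realpow) simp
    finally show "norm (l j) \<le> 2 ^ (\<kappa> j + 1) * \<rho>" using \<rho>(1) by (simp add: pos_divide_le_eq)
  qed
  have shell: "(\<Sum>j\<in>F. 1 / norm (l j)) \<le> b k"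
    if F: "finite F" "F \<subseteq> I" "\<And>j. j \<in> F \<Longrightarrow> \<kappa> j = k" for F k
  proof -
    have "(\<Sum>j\<in>F. 1 / norm (l j)) \<le> (\<Sum>j\<in>F. 1 / (2 ^ k * \<rho>))"
      using \<kappa>(1) F \<rho>(1) nonzero by (intro sum_mono divide_left_mono) force+
    also have "\<dots> = real (card F) / (2 ^ k * \<rho>)" by simp
    also have "\<dots> \<le> (count_const + count_slope * sqrt (2 ^ (k + 1) * \<rho>)) / (2 ^ k * \<rho>)"
    proof (intro divide_right_mono zero_count F)
      show "j \<in> F \<Longrightarrow> norm (l j) \<le> 2 ^ (k + 1) * \<rho>" for j using \<kappa>(2)[of j] F by auto
    qed (use \<rho> in auto)
    also have "sqrt (2 ^ (k + 1) * \<rho>) = sqrt (2 * \<rho>) * sqrt 2 ^ k"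
      by (simp add: real_sqrt_mult real_sqrt_power)
    also have "(count_const + count_slope * (sqrt (2 * \<rho>) * sqrt 2 ^ k)) / (2 ^ k * \<rho>) = b k"
    proof -
      have "sqrt 2 ^ k / 2 ^ k = q ^ k"
      proof -
        have "1 / sqrt 2 = sqrt 2 / (2::real)" by (simp add: field_simps)
        then have "q ^ k = (sqrt 2 / 2) ^ k" by (simp only: q_def)
        also have "\<dots> = sqrt 2 ^ k / 2 ^ k" by (rule power_divide)
        finally show ?thesis by (rule sym)
      qed
      then show ?thesis
        unfolding b_def by (simp add: add_divide_distrib power_divide mult.assoc[symmetric] flip: divide_divide_eq_left)
          (simp add: field_simps)
    qed
    finally show ?thesis .
  qed
  show ?thesis
  proof (rule bounded_imp_summable)
    show "0 \<le> (if j \<in> I then 1 / norm (l j) else 0)" for j by simp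
    fix n
    let ?F = "I \<inter> {..n}" and ?K = "\<kappa> ` (I \<inter> {..n})"
    have "(\<Sum>j\<le>n. if j \<in> I then 1 / norm (l j) else 0) = (\<Sum>j\<in>?F. 1 / norm (l j))"
      by (subst sum.inter_restrict[symmetric]) (auto simp: Int_commute)
    also have "\<dots> = (\<Sum>k\<in>?K. \<Sum>j\<in>{j\<in>?F. \<kappa> j = k}. 1 / norm (l j))"
      by (rule sum.image_gen) auto
    also have "\<dots> \<le> (\<Sum>k\<in>?K. b k)" by (intro sum_mono shell) auto
    also have "\<dots> \<le> suminf b" using b b0 by (intro sum_le_suminf) auto
    finally show "(\<Sum>j\<le>n. if j \<in> I then 1 / norm (l j) else 0) \<le> suminf b" .
  qed
qed

text \<open>
  The cofactor \<open>g n\<close> of the zeros in the disc of radius \<open>n\<close> has no zeros there, so it is \<open>f 0 * exp h\<close> with \<open>h 0 = 0\<close>.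
  By \<open>quotient_bound\<close> the real part of \<open>h\<close> is \<open>O(\<surd>n)\<close> on the disc, hence \<open>h z = O(\<surd>n / n)\<close> by the
  Borel-Caratheodory inequality.
\<close>
lemma disc_products_tendsto:
  "(\<lambda>n. \<Prod>j\<in>{j\<in>I. norm (l j) \<le> real n}. 1 - z / l j) \<longlonglongrightarrow> f z / f 0"
proof -
  let ?J = "\<lambda>n::nat. {j\<in>I. norm (l j) \<le> real n}"
  have "\<exists>g. g holomorphic_on UNIV \<and> (\<forall>z. f z = g z * (\<Prod>j\<in>?J n. 1 - z / l j))" for n
    using finite_zeros_in_disc by (intro divide_zeros) auto
  then obtain g where g: "\<And>n. g n holomorphic_on UNIV"
      "\<And>n z. f z = g n z * (\<Prod>j\<in>?J n. 1 - z / l j)" by metis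
  have gn0: "g n 0 = f 0" for n using g(2)[of 0 n] by simp
  have g_nz: "g n a \<noteq> 0" if "norm a \<le> real n" for n a
  proof
    assume a: "g n a = 0"
    then have fa: "f a = 0" using g(2)[of a n] by simp
    have "{j \<in> ?J n. l j = a} = {j\<in>I. l j = a}" using that by auto
    moreover have "zorder f a = zorder (g n) a + int (card {j \<in> ?J n. l j = a})"
      "zorder (g n) a > 0"
      using zorder_mult_linear_factors[OF g(1) _ finite_zeros_in_disc _ g(2)] f0 gn0 nonzero a
      by auto
    ultimately show False using mult[OF fa] by simp
  qed
  \<comment> \<open>The added \<open>1\<close> makes the bound for the real part strict.\<close>
  define A where "A = (\<lambda>r. (count_const + count_slope * sqrt r) * ln 2 + 1)"
  have "\<exists>h. g n z = f 0 * exp h \<and> norm h \<le> 2 * A (real n) * norm z / (real n - norm z)"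
    if n: "real n > norm z" for n
  proof -
    have n0: "real n > 0" using n by (meson norm_ge_zero order_le_less_trans)
    have "g n holomorphic_on ball 0 (real n)" using g(1) by (rule holomorphic_on_subset) auto
    then obtain h where h: "h holomorphic_on ball 0 (real n)"
        "\<And>w. w \<in> ball 0 (real n) \<Longrightarrow> g n w = exp (h w)"
      using contractible_imp_holomorphic_log[of "g n" "ball 0 (real n)"] g_nz
      by (metis convex_ball convex_imp_contractible less_eq_real_def mem_ball_0)
    let ?h = "\<lambda>w. h w - h 0"
    have gh: "g n w = f 0 * exp (?h w)" if "norm w < real n" for w
      using h(2)[of w] h(2)[of 0] gn0[of n] that n0 by (simp add: exp_diff)
    have "Re (?h w) < A (real n)" if w: "norm w < real n" for w
    proof -
      have "norm (f 0) * exp (Re (?h w)) = norm (g n w)"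
        using gh[OF w] by (simp add: norm_mult)
      also have "\<dots> \<le> C * exp (c * sqrt (3 * real n)) / 2 ^ card (?J n)"
        by (rule quotient_bound[OF _ _ _ n0 g]) (use finite_zeros_in_disc w n0 in auto)
      also have "\<dots> \<le> C * exp (c * sqrt (3 * real n)) / 1"
        using C_pos by (intro divide_left_mono) auto
      finally have "exp (Re (?h w)) \<le> C * exp (c * sqrt (3 * real n)) / norm (f 0)"
        using f0 by (simp add: field_simps)
      then have "Re (?h w) \<le> ln (C * exp (c * sqrt (3 * real n)) / norm (f 0))"
        using C_pos f0 by (subst ln_ge_iff) auto
      then show ?thesis unfolding A_def using ln_growth[of "real n"] by simp
    qed
    moreover have "?h holomorphic_on ball 0 (real n)" by (intro holomorphic_intros h(1))
    ultimately have "norm (?h z) \<le> 2 * A (real n) * norm z / (real n - norm z)"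
      using n by (intro Borel_Caratheodory) auto
    then show ?thesis using gh n by blast
  qed
  then obtain h where h: "\<And>n. real n > norm z \<Longrightarrow> g n z = f 0 * exp (h n)"
      "\<And>n. real n > norm z \<Longrightarrow> norm (h n) \<le> 2 * A (real n) * norm z / (real n - norm z)"
    by metis
  have ev: "\<forall>\<^sub>F n in sequentially. real n > norm z"
    using filterlim_real_sequentially by (simp add: filterlim_at_top_dense)
  have "h \<longlonglongrightarrow> 0"
  proof (rule Lim_null_comparison)
    show "\<forall>\<^sub>F n in sequentially. norm (h n) \<le> 2 * A (real n) * norm z / (real n - norm z)"
      using ev by eventually_elim (rule h(2))
    show "(\<lambda>n. 2 * A (real n) * norm z / (real n - norm z)) \<longlonglongrightarrow> 0"
    proof -
      have "(\<lambda>n. 1 / (real n - norm z)) \<longlonglongrightarrow> 0" "(\<lambda>n. sqrt (real n) / (real n - norm z)) \<longlonglongrightarrow> 0"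
        by real_asymp+
      then have "(\<lambda>n. 2 * norm z * (count_const * ln 2 + 1) * (1 / (real n - norm z)) +
          2 * norm z * count_slope * ln 2 * (sqrt (real n) / (real n - norm z))) \<longlonglongrightarrow>
          2 * norm z * (count_const * ln 2 + 1) * 0 + 2 * norm z * count_slope * ln 2 * 0"
        by (intro tendsto_intros)
      then show ?thesis by (simp add: A_def add_divide_distrib[symmetric] algebra_simps)
    qed
  qed
  then have "(\<lambda>n. f z / (f 0 * exp (h n))) \<longlonglongrightarrow> f z / (f 0 * exp 0)"
    using f0 by (intro tendsto_intros) auto
  moreover have "\<forall>\<^sub>F n in sequentially. f z / (f 0 * exp (h n)) = (\<Prod>j\<in>?J n. 1 - z / l j)"
    using ev
  proof eventually_elim
    case (elim n)
    then show ?case using g(2)[of z n] h(1)[of n] f0 by simp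
  qed
  ultimately show ?thesis using Lim_transform_eventually by fastforce
qed

text \<open>
  The product converges absolutely, so the products over discs and the products over initial segments
  of the index set have the same limit.
\<close>
theorem has_prod_zeros:
  "(\<lambda>j. if j \<in> I then 1 - z / l j else 1) has_prod (f z / f 0)"
proof -
  define a where "a = (\<lambda>j. if j \<in> I then - z / l j else 0)"
  define u where "u = (\<lambda>j. 1 + a j)"
  have u: "(if j \<in> I then 1 - z / l j else 1) = u j" for j by (simp add: u_def a_def)
  have "(\<lambda>j. norm (a j)) = (\<lambda>j. norm z * (if j \<in> I then 1 / norm (l j) else 0))"
    by (auto simp: a_def norm_divide)
  then have sa: "summable (\<lambda>j. norm (a j))"
    using summable_inverse_zeros by (simp add: summable_mult)
  then have "convergent_prod u"
    unfolding u_def by (intro abs_convergent_prod_imp_convergent_prod summable_imp_abs_convergent_prod) simp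
  then have lim: "(\<lambda>n. \<Prod>j\<le>n. u j) \<longlonglongrightarrow> prodinf u" by (rule convergent_prod_LIMSEQ)
  let ?J = "\<lambda>n::nat. {j\<in>I. norm (l j) \<le> real n}"
  have J: "(\<lambda>n. \<Prod>j\<in>?J n. u j) \<longlonglongrightarrow> f z / f 0"
    using disc_products_tendsto[of z] by (simp add: u_def a_def)
  define S where "S = (\<Sum>j. norm (a j))"
  \<comment> \<open>Enlarging the index set \<open>{..n}\<close> changes the product by at most a multiple of \<open>exp (\<tau> n) - 1\<close>.\<close>
  define \<tau> where "\<tau> = (\<lambda>n. \<Sum>j. norm (a (j + Suc n)))"
  have tail: "norm ((\<Prod>j\<in>F. u j) - (\<Prod>j\<le>n. u j)) \<le> exp S * (exp (\<tau> n) - 1)"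
    if F: "finite F" "I \<inter> {..n} \<subseteq> F" "F \<subseteq> I" for F n
  proof -
    have "(\<Prod>j\<le>n. u j) = (\<Prod>j\<in>I \<inter> {..n}. u j)"
      by (rule prod.mono_neutral_right) (auto simp: u_def a_def)
    moreover have "(\<Prod>j\<in>F. u j) = (\<Prod>j\<in>I \<inter> {..n}. u j) * (\<Prod>j\<in>F - {..n}. u j)"
      using F by (subst prod.union_disjoint[symmetric]) (auto intro!: prod.cong)
    ultimately have "(\<Prod>j\<in>F. u j) - (\<Prod>j\<le>n. u j) = (\<Prod>j\<le>n. u j) * ((\<Prod>j\<in>F - {..n}. u j) - 1)"
      by (simp add: algebra_simps)
    then have "norm ((\<Prod>j\<in>F. u j) - (\<Prod>j\<le>n. u j)) =
        norm (\<Prod>j\<le>n. u j) * norm ((\<Prod>j\<in>F - {..n}. u j) - 1)" by (simp add: norm_mult)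
    also have "\<dots> \<le> exp S * (exp (\<tau> n) - 1)"
    proof (intro mult_mono)
      have "norm (\<Prod>j\<le>n. u j) \<le> (\<Prod>j\<le>n. 1 + norm (a j))"
        unfolding u_def prod_norm[symmetric] by (intro prod_mono) (auto intro: norm_triangle_le)
      also have "\<dots> \<le> exp (\<Sum>j\<le>n. norm (a j))" by (rule prod_le_exp_sum) auto
      also have "\<dots> \<le> exp S" unfolding S_def using sa by (auto intro: sum_le_suminf)
      finally show "norm (\<Prod>j\<le>n. u j) \<le> exp S" .
      have "norm ((\<Prod>j\<in>F - {..n}. u j) - 1) \<le> (\<Prod>j\<in>F - {..n}. 1 + norm (a j)) - 1"
        unfolding u_def by (rule norm_prod_minus1_le_prod_minus1)
      also have "(\<Prod>j\<in>F - {..n}. 1 + norm (a j)) \<le> exp (\<Sum>j\<in>F - {..n}. norm (a j))"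
        by (rule prod_le_exp_sum) auto
      also have "(\<Sum>j\<in>F - {..n}. norm (a j)) = (\<Sum>j\<in>(\<lambda>j. j - Suc n) ` (F - {..n}). norm (a (j + Suc n)))"
        by (subst sum.reindex) (auto simp: inj_on_def)
      also have "\<dots> \<le> \<tau> n" unfolding \<tau>_def using F sa
        by (intro sum_le_suminf summable_ignore_initial_segment[OF sa]) auto
      finally show "norm ((\<Prod>j\<in>F - {..n}. u j) - 1) \<le> exp (\<tau> n) - 1" by simp
    qed auto
    finally show ?thesis .
  qed
  have bound: "norm (f z / f 0 - (\<Prod>j\<le>n. u j)) \<le> exp S * (exp (\<tau> n) - 1)" for n
  proof (rule tendsto_upperbound)
    show "(\<lambda>N. norm ((\<Prod>j\<in>?J N. u j) - (\<Prod>j\<le>n. u j))) \<longlonglongrightarrow> norm (f z / f 0 - (\<Prod>j\<le>n. u j))"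
      by (intro tendsto_intros J)
    let ?m = "Max (insert 0 ((\<lambda>j. norm (l j)) ` (I \<inter> {..n})))"
    have "\<forall>\<^sub>F N in sequentially. real N \<ge> ?m"
      using filterlim_real_sequentially by (simp only: filterlim_at_top)
    then show "\<forall>\<^sub>F N in sequentially. norm ((\<Prod>j\<in>?J N. u j) - (\<Prod>j\<le>n. u j)) \<le> exp S * (exp (\<tau> n) - 1)"
    proof eventually_elim
      case (elim N)
      then show ?case by (intro tail) (auto simp: finite_zeros_in_disc)
    qed
  qed auto
  have "\<tau> \<longlonglongrightarrow> 0"
    unfolding \<tau>_def using sa
    by (intro LIMSEQ_Suc[OF suminf_exist_split2]) auto
  then have "(\<lambda>n. exp S * (exp (\<tau> n) - 1)) \<longlonglongrightarrow> exp S * (exp 0 - 1)"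
    by (intro tendsto_intros)
  then have "(\<lambda>n. exp S * (exp (\<tau> n) - 1)) \<longlonglongrightarrow> 0" by simp
  then have "(\<lambda>n. f z / f 0 - (\<Prod>j\<le>n. u j)) \<longlonglongrightarrow> 0"
    by (rule Lim_null_comparison[OF always_eventually[OF allI[OF bound]]])
  then have "(\<lambda>n. \<Prod>j\<le>n. u j) \<longlonglongrightarrow> f z / f 0"
    using tendsto_diff[OF tendsto_const[of "f z / f 0"], of "\<lambda>n. f z / f 0 - (\<Prod>j\<le>n. u j)" 0 sequentially]
    by simp
  then have "prodinf u = f z / f 0" using lim LIMSEQ_unique by blast
  then show ?thesis using \<open>convergent_prod u\<close> u by (simp add: has_prod_iff)
qed

end

section \<open>Power series matrices acting on principal parts\<close>

text \<open>
  A finitely supported sequence \<open>s\<close> stands for the principal part \<open>\<Sum> s\<^sub>n \<epsilon>\<^bsup>-1-n\<^esup>\<close>.  A power series acts on it by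
  multiplication followed by dropping the regular terms; in particular \<open>\<epsilon>\<close> itself acts as the shift
  \<open>s \<mapsto> (\<lambda>n. s (n + 1))\<close>.
\<close>
definition fin_supp :: "(nat \<Rightarrow> 'a::zero) \<Rightarrow> bool" where
  "fin_supp s \<longleftrightarrow> (\<exists>k. \<forall>i\<ge>k. s i = 0)"

definition fps_act :: "'a::comm_ring_1 fps \<Rightarrow> (nat \<Rightarrow> 'a) \<Rightarrow> nat \<Rightarrow> 'a" where
  "fps_act a s j = (\<Sum>i | s (j + i) \<noteq> 0. fps_nth a i * s (j + i))"

lemma fps_act_eq_sum:
  assumes "\<And>i. i \<ge> k \<Longrightarrow> s i = 0"
  shows "fps_act a s j = (\<Sum>i<k. fps_nth a i * s (j + i))"
  unfolding fps_act_def
proof (rule sum.mono_neutral_left)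
  show "{i. s (j + i) \<noteq> 0} \<subseteq> {..<k}"
    using assms by (metis (mono_tags, lifting) lessThan_iff mem_Collect_eq not_le subsetI trans_le_add2)
qed auto

lemma fps_act_X:
  assumes "fin_supp s"
  shows "fps_act (fps_X * a) s j = fps_act a (\<lambda>i. s (Suc i)) j"
proof -
  obtain k where k: "\<And>i. i \<ge> k \<Longrightarrow> s i = 0" using assms by (auto simp: fin_supp_def)
  have "fps_act (fps_X * a) s j = (\<Sum>i<Suc k. fps_nth (fps_X * a) i * s (j + i))"
    using k by (intro fps_act_eq_sum) auto
  also have "\<dots> = (\<Sum>i<k. fps_nth a i * s (Suc (j + i)))"
    by (subst sum.lessThan_Suc_shift) simp
  also have "\<dots> = fps_act a (\<lambda>i. s (Suc i)) j"
    using k by (subst fps_act_eq_sum[of k]) auto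
  finally show ?thesis .
qed

lemma fps_act_diff_const_mult:
  assumes "fin_supp s"
  shows "fps_act (a - (\<Sum>k\<in>A. fps_const (x k) * b k)) s j
    = fps_act a s j - (\<Sum>k\<in>A. x k * fps_act (b k) s j)"
proof -
  obtain n where n: "\<And>i. i \<ge> n \<Longrightarrow> s i = 0" using assms by (auto simp: fin_supp_def)
  have "(\<Sum>i<n. (\<Sum>k\<in>A. x k * fps_nth (b k) i) * s (j + i)) =
      (\<Sum>k\<in>A. x k * (\<Sum>i<n. fps_nth (b k) i * s (j + i)))"
    unfolding sum_distrib_right sum_distrib_left by (subst sum.swap) (simp add: mult_ac)
  then show ?thesis
    by (simp add: fps_act_eq_sum[OF n] fps_sum_nth left_diff_distrib sum_subtractf)
qed

lemma fps_act_seq_diff: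
  assumes "fin_supp s" "fin_supp t"
  shows "fps_act a (\<lambda>i. s i - x * t i) j = fps_act a s j - x * fps_act a t j"
proof -
  obtain n where n: "\<And>i. i \<ge> n \<Longrightarrow> s i = 0" using assms by (auto simp: fin_supp_def)
  obtain m where m: "\<And>i. i \<ge> m \<Longrightarrow> t i = 0" using assms by (auto simp: fin_supp_def)
  let ?k = "max n m"
  have "fps_act a s j = (\<Sum>i<?k. fps_nth a i * s (j + i))"
    "fps_act a t j = (\<Sum>i<?k. fps_nth a i * t (j + i))"
    "fps_act a (\<lambda>i. s i - x * t i) j = (\<Sum>i<?k. fps_nth a i * (s (j + i) - x * t (j + i)))"
    by (intro fps_act_eq_sum; simp add: n m)+
  then show ?thesis
    by (simp add: algebra_simps sum_subtractf sum_distrib_left)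
qed

text \<open>
  The vectors \<open>q\<close> of principal parts for which \<open>M q\<close> is regular.
\<close>
definition shift_kernel :: "'a::comm_ring_1 fps ^ 'n ^ 'n \<Rightarrow> (nat \<Rightarrow> 'a ^ 'n) set" where
  "shift_kernel M = {q. fin_supp q \<and>
     (\<forall>j i. (\<Sum>k\<in>UNIV. fps_act (M $ i $ k) (\<lambda>n. q n $ k) j) = 0)}"

definition seq_basis :: "(nat \<Rightarrow> 'a::comm_ring_1 ^ 'n) set \<Rightarrow> nat \<Rightarrow> (nat \<Rightarrow> nat \<Rightarrow> 'a ^ 'n) \<Rightarrow> bool" where
  "seq_basis S d b \<longleftrightarrow> (\<forall>i<d. b i \<in> S) \<and>
     (\<forall>q\<in>S. \<exists>!c. (\<forall>i\<ge>d. c i = 0) \<and> q = (\<lambda>n. \<Sum>i<d. c i *s b i n))"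

text \<open>
  Replacing column \<open>r\<close> by a combination of all columns multiplies the determinant by the coefficient
  of column \<open>r\<close>, since the other summands repeat a column.
\<close>
lemma det_column_combination:
  fixes M :: "'a::comm_ring_1 ^ 'n ^ 'n"
  shows "det (\<chi> i j. if j = r then \<Sum>k\<in>UNIV. x k * M $ i $ k else M $ i $ j) = x r * det M"
proof -
  let ?T = "transpose M"
  have t: "transpose (\<chi> i j. if j = r then \<Sum>k\<in>UNIV. x k * M $ i $ k else M $ i $ j) =
      (\<chi> i. if i = r then \<Sum>k\<in>UNIV. x k *s (?T $ k) else ?T $ i)"
    by (simp add: transpose_def vec_eq_iff)
  have same: "(\<chi> i. if i = r then ?T $ r else ?T $ i) = ?T" by (auto simp: vec_eq_iff)
  have z: "det (\<chi> i. if i = r then ?T $ k else ?T $ i) = 0" if "k \<noteq> r" for k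
    using that by (intro det_identical_rows[of k r]) (auto simp: row_def vec_eq_iff)
  have "det (\<chi> i j. if j = r then \<Sum>k\<in>UNIV. x k * M $ i $ k else M $ i $ j) =
      det (\<chi> i. if i = r then \<Sum>k\<in>UNIV. x k *s (?T $ k) else ?T $ i)"
    by (subst det_transpose[symmetric]) (simp only: t)
  also have "\<dots> = (\<Sum>k\<in>UNIV. x k * det (\<chi> i. if i = r then ?T $ k else ?T $ i))"
    by (simp add: det_linear_row_sum det_row_mul)
  also have "\<dots> = (\<Sum>k\<in>UNIV. if k = r then x r * det ?T else 0)"
    by (intro sum.cong refl) (auto simp: z same)
  finally show ?thesis by (simp add: det_transpose)
qed

lemma det_column_mult:
  fixes M :: "'a::comm_ring_1 ^ 'n ^ 'n"
  shows "det (\<chi> i j. if j = r then x * M $ i $ j else M $ i $ j) = x * det M"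
proof -
  have "(\<Sum>k\<in>UNIV. (if k = r then x else 0) * M $ i $ k) = x * M $ i $ r" for i
    by (simp add: if_distrib[of "\<lambda>y. y * _"] cong: if_cong)
  moreover have "(\<chi> i j. if j = r then x * M $ i $ j else M $ i $ j) =
      (\<chi> i j. if j = r then x * M $ i $ r else M $ i $ j)"
    by (auto simp: vec_eq_iff)
  ultimately show ?thesis
    using det_column_combination[of r "\<lambda>k. if k = r then x else 0" M]
    by (simp only: if_True refl)
qed

lemma fps_nth_0_prod: "fps_nth (prod f A) 0 = (\<Prod>x\<in>A. fps_nth (f x :: 'a::comm_ring_1 fps) 0)"
  by (induction A rule: infinite_finite_induct) auto

lemma fps_nth_0_det:
  "fps_nth (det M) 0 = det (\<chi> i j. fps_nth (M $ i $ j :: 'a::comm_ring_1 fps) 0)"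
proof -
  have "fps_nth (of_int z :: 'a fps) 0 = of_int z" for z
    by simp
  then show ?thesis unfolding det_def by (simp add: fps_sum_nth fps_nth_0_prod)
qed

lemma fin_supp_component: "fin_supp q \<Longrightarrow> fin_supp (\<lambda>n. q n $ k)"
  unfolding fin_supp_def by (metis zero_index)

text \<open>
  The space of principal parts \<open>q\<close> for which \<open>M q\<close> is regular has dimension \<open>ord (det M)\<close>.  If the constant term
  \<open>M\<^sub>0\<close> is invertible, the leading coefficient of such a \<open>q\<close> would be in the kernel of \<open>M\<^sub>0\<close>, so \<open>q = 0\<close>.
  Otherwise \<open>M\<^sub>0 c = 0\<close> for some \<open>c\<close> with an entry \<open>c\<^sub>r = 1\<close>, so that \<open>M c\<close> is divisible by \<open>\<epsilon>\<close>.  Replacing column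
  \<open>r\<close> of \<open>M\<close> by \<open>(M c) / \<epsilon>\<close> gives \<open>M'\<close> with \<open>det M = \<epsilon> det M'\<close> and \<open>M = M' E\<close> for an elementary matrix \<open>E\<close>.
  As \<open>E\<close> is surjective on principal parts, with kernel spanned by \<open>\<epsilon>\<^sup>-\<^sup>1 c\<close>, the dimension for \<open>M\<close> is one more
  than that for \<open>M'\<close>.
\<close>
theorem shift_kernel_basis:
  fixes M :: "'a::field fps ^ 'n ^ 'n"
  assumes "det M \<noteq> 0"
  shows "\<exists>b. seq_basis (shift_kernel M) (subdegree (det M)) b"
  using assms
proof (induction "subdegree (det M)" arbitrary: M)
  case 0
  define M0 where "M0 = (\<chi> i j. fps_nth (M $ i $ j) 0)"
  have "det M0 \<noteq> 0" using 0 nth_subdegree_nonzero[of "det M"] by (simp add: M0_def fps_nth_0_det)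
  then have inj: "M0 *v v = 0 \<Longrightarrow> v = 0" for v
    using invertible_det_nz[of M0] matrix_left_invertible_ker[of M0] by (auto simp: invertible_def)
  have "q = (\<lambda>n. 0)" if q: "q \<in> shift_kernel M" for q
  proof -
    have "(\<forall>i\<ge>k. q i = 0) \<Longrightarrow> q = (\<lambda>n. 0)" for k
    proof (induction k)
      case (Suc k)
      have z: "q n $ i = 0" if "n \<ge> Suc k" for i n using Suc.prems that by auto
      have "fps_act a (\<lambda>n. q n $ i) k = fps_nth a 0 * q k $ i" for a i
      proof -
        have "fps_act a (\<lambda>n. q n $ i) k = (\<Sum>n<Suc k. fps_nth a n * q (k + n) $ i)"
          using z by (intro fps_act_eq_sum) auto
        also have "\<dots> = (\<Sum>n<Suc k. if n = 0 then fps_nth a 0 * q k $ i else 0)"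
          by (intro sum.cong) (auto simp: z)
        finally show ?thesis by (simp add: sum.delta)
      qed
      moreover have "(\<Sum>j\<in>UNIV. fps_act (M $ i $ j) (\<lambda>n. q n $ j) k) = 0" for i
        using q by (simp add: shift_kernel_def)
      ultimately have "M0 *v q k = 0"
        by (simp add: M0_def matrix_vector_mult_def vec_eq_iff)
      then have "q k = 0" by (rule inj)
      then show ?case using Suc by (metis Suc_le_eq le_less)
    qed auto
    then show ?thesis using q by (auto simp: shift_kernel_def fin_supp_def)
  qed
  then have "seq_basis (shift_kernel M) 0 (\<lambda>_ _. 0)"
    by (auto simp: seq_basis_def)
  then show ?case using 0 by auto
next
  case (Suc m)
  define M0 where "M0 = (\<chi> i j. fps_nth (M $ i $ j) 0)"
  have "det M0 = 0" using nth_less_subdegree_zero[of 0 "det M"] Suc(2) by (simp add: M0_def fps_nth_0_det[symmetric])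
  then obtain c0 where c0: "M0 *v c0 = 0" "c0 \<noteq> 0"
    using invertible_det_nz[of M0] matrix_left_invertible_ker[of M0]
    by (metis invertible_left_inverse)
  then obtain r where r: "c0 $ r \<noteq> 0" by (auto simp: vec_eq_iff)
  define c where "c = (1 / c0 $ r) *s c0"
  have c: "M0 *v c = 0" "c $ r = 1"
    using c0(1) r unfolding c_def by (simp_all add: vector_scalar_commute)
  define col where "col = (\<lambda>i. \<Sum>k\<in>UNIV. fps_const (c $ k) * M $ i $ k)"
  have col0: "fps_nth (col i) 0 = 0" for i
    using c(1) by (simp add: col_def fps_sum_nth M0_def matrix_vector_mult_def vec_eq_iff mult.commute)
  define M' where "M' = (\<chi> i j. if j = r then fps_shift 1 (col i) else M $ i $ j)"
  have col: "col i = fps_X * M' $ i $ r" for i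
    by (rule fps_ext) (simp add: M'_def col0)
  have M': "M' $ i $ k = M $ i $ k" if "k \<noteq> r" for i k using that by (simp add: M'_def)
  have det: "det M = fps_X * det M'"
  proof -
    have "det M = det (\<chi> i j. if j = r then \<Sum>k\<in>UNIV. fps_const (c $ k) * M $ i $ k else M $ i $ j)"
      by (simp add: det_column_combination c)
    also have "(\<chi> i j. if j = r then \<Sum>k\<in>UNIV. fps_const (c $ k) * M $ i $ k else M $ i $ j)
        = (\<chi> i j. if j = r then fps_X * M' $ i $ j else M' $ i $ j)"
      by (auto simp: vec_eq_iff M' col[symmetric] col_def)
    finally show ?thesis by (simp add: det_column_mult)
  qed
  then have "det M' \<noteq> 0" "subdegree (det M') = m"
    using Suc(2,3) by auto
  then obtain b' where b': "seq_basis (shift_kernel M') m b'" using Suc(1)[of M'] by auto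
  \<comment> \<open>\<open>L\<close> is a linear right inverse of \<open>E\<close>, and \<open>e\<close> spans the kernel of \<open>E\<close>.\<close>
  define E where "E = (\<lambda>q n. \<chi> j. if j = r then q (Suc n) $ r else q n $ j - c $ j * q n $ r)"
  define L where "L = (\<lambda>p n. let s = (case n of 0 \<Rightarrow> 0 | Suc n' \<Rightarrow> p n' $ r) in
      (\<chi> j. if j = r then s else p n $ j + c $ j * s))"
  define e where "e = (\<lambda>n::nat. if n = 0 then c else 0)"
  have EL: "E (L p) = p" for p
    by (auto simp: E_def L_def fun_eq_iff vec_eq_iff Let_def)
  have q_eq: "q = (\<lambda>n. L (E q) n + q 0 $ r *s e n)" for q
    by (auto simp: E_def L_def e_def fun_eq_iff vec_eq_iff Let_def c split: nat.splits)
  have fin_E: "fin_supp (E q)" if fs: "fin_supp q" for q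
  proof -
    obtain k where "\<forall>i\<ge>k. q i = 0" using fs unfolding fin_supp_def by blast
    then have "\<forall>i\<ge>k. E q i = 0" by (auto simp: E_def vec_eq_iff)
    then show ?thesis unfolding fin_supp_def by blast
  qed
  have fin_L: "fin_supp (L p)" if fs: "fin_supp p" for p
  proof -
    obtain k where "\<forall>i\<ge>k. p i = 0" using fs unfolding fin_supp_def by blast
    then have "\<forall>i\<ge>Suc k. L p i = 0" by (auto simp: L_def vec_eq_iff Let_def split: nat.splits)
    then show ?thesis unfolding fin_supp_def by blast
  qed
  have fin_e: "fin_supp e" by (auto simp: fin_supp_def e_def intro!: exI[of _ 1])
  have act: "(\<Sum>k\<in>UNIV. fps_act (M $ i $ k) (\<lambda>n. q n $ k) j) =
      (\<Sum>k\<in>UNIV. fps_act (M' $ i $ k) (\<lambda>n. E q n $ k) j)" if q: "fin_supp q" for q i j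
  proof -
    note fq = fin_supp_component[OF q]
    have Mr: "M $ i $ r = fps_X * M' $ i $ r - (\<Sum>k\<in>UNIV - {r}. fps_const (c $ k) * M $ i $ k)"
    proof -
      have "col i = M $ i $ r + (\<Sum>k\<in>UNIV - {r}. fps_const (c $ k) * M $ i $ k)"
        unfolding col_def by (subst sum.remove[of _ r]) (auto simp: c)
      then show ?thesis using col[of i] by simp
    qed
    have "fps_act (M $ i $ r) (\<lambda>n. q n $ r) j = fps_act (M' $ i $ r) (\<lambda>n. E q n $ r) j
        - (\<Sum>k\<in>UNIV - {r}. c $ k * fps_act (M $ i $ k) (\<lambda>n. q n $ r) j)"
      by (subst Mr) (simp add: fps_act_diff_const_mult fq fps_act_X E_def)
    moreover have "fps_act (M' $ i $ k) (\<lambda>n. E q n $ k) j =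
        fps_act (M $ i $ k) (\<lambda>n. q n $ k) j - c $ k * fps_act (M $ i $ k) (\<lambda>n. q n $ r) j"
      if "k \<noteq> r" for k
      using that by (simp add: E_def M' fps_act_seq_diff fq)
    ultimately show ?thesis
      by (simp add: sum.remove[of UNIV r] sum_subtractf)
  qed
  have mem: "q \<in> shift_kernel M \<longleftrightarrow> E q \<in> shift_kernel M'" if "fin_supp q" for q
    using that by (simp add: shift_kernel_def act fin_E)
  define b where "b = (\<lambda>i. if i < m then L (b' i) else e)"
  have E_e: "E e = (\<lambda>n. 0)" using c by (auto simp: E_def e_def fun_eq_iff vec_eq_iff)
  have E_b: "E (b i) = (if i < m then b' i else (\<lambda>n. 0))" for i
    by (simp add: b_def EL E_e)
  have E_sum: "E (\<lambda>n. \<Sum>i<Suc m. d i *s b i n) = (\<lambda>n. \<Sum>i<m. d i *s b' i n)" for d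
  proof -
    have "E (\<lambda>n. \<Sum>i<Suc m. d i *s b i n) = (\<lambda>n. \<Sum>i<Suc m. d i *s E (b i) n)"
      by (auto simp: E_def fun_eq_iff vec_eq_iff sum_distrib_left algebra_simps sum_subtractf sum.distrib)
    also have "\<dots> = (\<lambda>n. \<Sum>i<m. d i *s b' i n)"
      by (simp add: E_b)
    finally show ?thesis .
  qed
  have r_sum: "(\<Sum>i<Suc m. d i *s b i 0) $ r = d m" for d
    by (simp add: b_def L_def e_def c)
  have "seq_basis (shift_kernel M) (Suc m) b"
    unfolding seq_basis_def
  proof (intro conjI allI impI ballI)
    fix i assume "i < Suc m"
    show "b i \<in> shift_kernel M"
    proof (cases "i < m")
      case True
      then have "b' i \<in> shift_kernel M'" using b' by (simp add: seq_basis_def)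
      then show ?thesis using True mem[of "L (b' i)"] fin_L[of "b' i"]
        by (simp add: b_def EL shift_kernel_def)
    next
      case False
      have "(\<lambda>n. 0) \<in> shift_kernel M'"
        by (auto simp: shift_kernel_def fin_supp_def fps_act_def)
      then show ?thesis using False mem[OF fin_e] by (simp add: b_def E_e)
    qed
  next
    fix q assume q: "q \<in> shift_kernel M"
    then have "E q \<in> shift_kernel M'" using mem by (auto simp: shift_kernel_def)
    then have ex: "\<exists>!d. (\<forall>i\<ge>m. d i = 0) \<and> E q = (\<lambda>n. \<Sum>i<m. d i *s b' i n)"
      using b' by (simp add: seq_basis_def)
    then obtain d where d: "\<forall>i\<ge>m. d i = 0" "E q = (\<lambda>n. \<Sum>i<m. d i *s b' i n)" by auto
    define d' where "d' = d(m := q 0 $ r)"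
    show "\<exists>!d. (\<forall>i\<ge>Suc m. d i = 0) \<and> q = (\<lambda>n. \<Sum>i<Suc m. d i *s b i n)"
    proof (rule ex1I[of _ d'], intro conjI)
      show "\<forall>i\<ge>Suc m. d' i = 0" using d by (auto simp: d'_def)
      have "E q = E (\<lambda>n. \<Sum>i<Suc m. d' i *s b i n)"
        unfolding E_sum by (simp add: d d'_def)
      moreover have "q 0 $ r = (\<Sum>i<Suc m. d' i *s b i 0) $ r" by (simp only: r_sum) (simp add: d'_def)
      ultimately show "q = (\<lambda>n. \<Sum>i<Suc m. d' i *s b i n)"
        using q_eq[of q] q_eq[of "\<lambda>n. \<Sum>i<Suc m. d' i *s b i n"] by simp
    next
      fix d2 assume d2: "(\<forall>i\<ge>Suc m. d2 i = 0) \<and> q = (\<lambda>n. \<Sum>i<Suc m. d2 i *s b i n)"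
      have "E q = (\<lambda>n. \<Sum>i<m. (d2(m := 0)) i *s b' i n)"
        using d2 E_sum[of d2] by simp
      moreover have "\<forall>i\<ge>m. (d2(m := 0)) i = 0" using d2 by (auto simp: Suc_le_eq)
      ultimately have "d2(m := 0) = d" using ex d by blast
      moreover have "q 0 $ r = d2 m" using d2 r_sum[of d2] by metis
      ultimately show "d2 = d'" unfolding d'_def by (metis fun_upd_triv fun_upd_upd)
    qed
  qed
  then show ?case using Suc(2) by auto
qed

section \<open>Block matrices\<close>

lemma bounded_bilinear_matrix_mult: "bounded_bilinear ((**) :: complex^'b^'a \<Rightarrow> complex^'c^'b \<Rightarrow> complex^'c^'a)"
  unfolding bilinear_conv_bounded_bilinear[symmetric] bilinear_def
  by (intro conjI allI linearI)
    (simp_all add: matrix_matrix_mult_def vec_eq_iff sum.distrib algebra_simps scaleR_sum_right)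

lemma bounded_bilinear_matrix_vector: "bounded_bilinear ((*v) :: complex^'b^'a \<Rightarrow> complex^'b \<Rightarrow> complex^'a)"
  unfolding bilinear_conv_bounded_bilinear[symmetric] bilinear_def
  by (intro conjI allI linearI)
    (simp_all add: matrix_vector_mult_def vec_eq_iff sum.distrib algebra_simps scaleR_sum_right)

lemma bounded_linear_mat: "bounded_linear (mat :: complex \<Rightarrow> complex^'a^'a)"
  unfolding linear_conv_bounded_linear[symmetric]
  by (intro linearI) (simp_all add: mat_def vec_eq_iff)

lemma bounded_linear_transpose: "bounded_linear (transpose :: complex^'b^'a \<Rightarrow> complex^'a^'b)"
  unfolding linear_conv_bounded_linear[symmetric]
  by (intro linearI) (simp_all add: transpose_def vec_eq_iff)

lemma bounded_linear_cmat: "bounded_linear (cmat :: real^'b^'a \<Rightarrow> complex^'b^'a)"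
  unfolding linear_conv_bounded_linear[symmetric]
  by (intro linearI) (simp_all add: vec_eq_iff flip: scaleR_conv_of_real)

lemma mat_mult_nth: "(mat e ** M) $ i $ j = e * (M $ i $ j :: 'a::comm_ring_1)"
  by (simp add: matrix_matrix_mult_def mat_def if_distrib[of "\<lambda>x. x * _"] sum.delta cong: if_cong)

lemma mat_mult_commute: "mat e ** M = M ** mat (e :: 'a::comm_ring_1)"
  by (simp add: vec_eq_iff mat_mult_nth)
    (simp add: matrix_matrix_mult_def mat_def if_distrib[of "\<lambda>x. _ * x"] sum.delta' mult.commute cong: if_cong)

lemma mat_mult_vec: "mat e *v v = e *s (v :: 'a::comm_ring_1^'n)"
  by (simp add: vec_eq_iff matrix_vector_mult_def mat_def if_distrib[of "\<lambda>x. x * _"] sum.delta cong: if_cong)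

lemma cmat_mult: "cmat (A ** B) = cmat A ** cmat B"
  by (simp add: vec_eq_iff matrix_matrix_mult_def)

lemma cmat_mat_1: "cmat (mat 1) = mat 1"
  by (simp add: vec_eq_iff mat_def)

lemma cmat_transpose: "cmat (transpose A) = transpose (cmat A)"
  by (simp add: vec_eq_iff transpose_def)

lemma matrix_inv_mult:
  assumes "invertible A"
  shows "A ** matrix_inv A = mat 1" "matrix_inv A ** A = mat 1"
  using someI_ex[OF assms[unfolded invertible_def]] by (simp_all add: matrix_inv_def)

lemma vjoin_nth [simp]: "vjoin x y $ Inl k = x $ k" "vjoin x y $ Inr k = y $ k"
  by (simp_all add: vjoin_def)

definition upper :: "'a ^ ('n + 'n) \<Rightarrow> 'a ^ 'n" where "upper z = (\<chi> k. z $ Inl k)"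
definition lower :: "'a ^ ('n + 'n) \<Rightarrow> 'a ^ 'n" where "lower z = (\<chi> k. z $ Inr k)"

lemma upper_lower_vjoin [simp]: "upper (vjoin x y) = x" "lower (vjoin x y) = y"
  by (simp_all add: upper_def lower_def vec_eq_iff)

lemma vec_eq_iff_sum: "u = v \<longleftrightarrow> (\<forall>k. u $ Inl k = v $ Inl k) \<and> (\<forall>k. u $ Inr k = v $ Inr k)"
  by (auto simp: vec_eq_iff split_sum_all)

lemma vjoin_upper_lower [simp]: "vjoin (upper z) (lower z) = z"
  by (simp add: vec_eq_iff_sum upper_def lower_def)

lemma vjoin_inj: "vjoin x y = vjoin x' y' \<longleftrightarrow> x = x' \<and> y = y'"
  by (metis upper_lower_vjoin)

lemma vjoin_add: "vjoin x y + vjoin x' y' = vjoin (x + x') (y + y')"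
  by (simp add: vec_eq_iff_sum)

lemma vjoin_scale: "c *s vjoin x y = vjoin (c *s x) (c *s y)"
  by (simp add: vec_eq_iff_sum)

lemma bounded_linear_upper_lower:
  "bounded_linear (upper :: complex^('n::finite+'n) \<Rightarrow> _)" "bounded_linear (lower :: complex^('n+'n) \<Rightarrow> _)"
  unfolding linear_conv_bounded_linear[symmetric]
  by (intro linearI; simp add: upper_def lower_def vec_eq_iff)+

lemma bounded_linear_vjoin: "bounded_linear (\<lambda>p. vjoin (fst p) (snd p) :: complex^('n::finite+'n))"
  unfolding linear_conv_bounded_linear[symmetric]
  by (intro linearI; simp add: vec_eq_iff_sum)

lemma sum_UNIV_Plus: "(\<Sum>k\<in>UNIV. f k) = (\<Sum>k\<in>UNIV. f (Inl k)) + (\<Sum>k\<in>UNIV. f (Inr k))"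
  for f :: "'a::finite + 'b::finite \<Rightarrow> 'c::comm_monoid_add"
  by (simp add: UNIV_Plus_UNIV[symmetric] sum.Plus del: UNIV_Plus_UNIV)

lemma side_by_side_mult: "side_by_side U V *v vjoin u w = U *v u + V *v w"
  by (simp add: vec_eq_iff side_by_side_def matrix_vector_mult_def sum_UNIV_Plus)

lemma block_matrix_mult:
  "block_matrix A B C D *v vjoin x y = vjoin (A *v x + B *v y) (C *v x + D *v y)"
  by (simp add: vec_eq_iff_sum block_matrix_def side_by_side_def matrix_vector_mult_def sum_UNIV_Plus)

lemma block_matrix_transpose:
  "transpose (block_matrix A B C D) = block_matrix (transpose A) (transpose C) (transpose B) (transpose D)"
  by (simp add: vec_eq_iff_sum block_matrix_def side_by_side_def transpose_def)

lemma minus_matrix_vector_mult: "(- A) *v x = - (A *v x)" for A :: "'a::comm_ring_1^'n^'m"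
  by (simp add: vec_eq_iff matrix_vector_mult_def sum_negf)

lemma sympl_J_mult: "sympl_J *v vjoin x y = vjoin (- y) (x :: 'a::comm_ring_1^'n)"
  by (simp add: sympl_J_def block_matrix_mult minus_matrix_vector_mult)

lemma matrix_eq_vjoin: "M = N \<longleftrightarrow> (\<forall>x y. M *v vjoin x y = N *v vjoin x y)"
  for M N :: "'a::comm_ring_1^('n::finite+'n)^'m"
  unfolding matrix_eq by (metis vjoin_upper_lower)

lemma sympl_J_square: "sympl_J ** sympl_J = (- mat 1 :: 'a::comm_ring_1^('n::finite+'n)^('n+'n))"
proof -
  show ?thesis
    unfolding matrix_eq_vjoin by (simp add: minus_matrix_vector_mult matrix_vector_mul_assoc[symmetric] sympl_J_mult vec_eq_iff_sum)
qed

lemma sympl_J_transpose: "transpose sympl_J = (- sympl_J :: 'a::comm_ring_1^('n::finite+'n)^('n+'n))"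
  unfolding sympl_J_def block_matrix_transpose
  by (simp add: vec_eq_iff_sum block_matrix_def side_by_side_def transpose_def mat_def)

lemma continuous_on_det:
  fixes M :: "real \<Rightarrow> real^'n^'n"
  assumes "\<And>i j. continuous_on S (\<lambda>t. M t $ i $ j)"
  shows "continuous_on S (\<lambda>t. det (M t))"
  unfolding det_def by (intro continuous_intros assms)

text \<open>
  By Cramer's rule the entries of the inverse are quotients of determinants.
\<close>
lemma continuous_on_matrix_inv:
  fixes M :: "real \<Rightarrow> real^'n^'n"
  assumes "continuous_on S M" "\<And>t. t \<in> S \<Longrightarrow> invertible (M t)"
  shows "continuous_on S (\<lambda>t. matrix_inv (M t))"
proof -
  have entry: "continuous_on S (\<lambda>t. M t $ i $ j)" for i j
    by (intro continuous_intros assms)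
  have eq: "matrix_inv (M t) $ k $ l =
      det (\<chi> i j. if j = k then axis l 1 $ i else M t $ i $ j) / det (M t)" if "t \<in> S" for t k l
  proof -
    have d: "det (M t) \<noteq> 0" using assms(2)[OF that] by (simp add: invertible_det_nz)
    have "M t *v (column l (matrix_inv (M t))) = axis l 1"
      using matrix_inv_mult(1)[OF assms(2)[OF that]]
      by (metis matrix_vector_mul_assoc matrix_vector_mult_basis matrix_vector_mul_lid)
    then have "column l (matrix_inv (M t)) =
        (\<chi> k. det (\<chi> i j. if j = k then axis l 1 $ i else M t $ i $ j) / det (M t))"
      using cramer[OF d] by blast
    then show ?thesis
      by (simp add: vec_eq_iff column_def)
  qed
  have "continuous_on S (\<lambda>t. det (\<chi> i j. if j = k then axis l 1 $ i else M t $ i $ j) / det (M t))" for k l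
  proof (intro continuous_on_divide continuous_on_det ballI)
    show "continuous_on S (\<lambda>t. (\<chi> i j. if j = k then axis l 1 $ i else M t $ i $ j) $ i $ j)" for i j
      by (cases "j = k") (simp_all add: entry)
  qed (use assms(2) entry in \<open>simp_all add: invertible_det_nz\<close>)
  then have "continuous_on S (\<lambda>t. matrix_inv (M t) $ k $ l)" for k l
    using eq by (metis (no_types, lifting) continuous_on_cong)
  then show ?thesis
    by (intro continuous_on_vec_lambda[where f="\<lambda>i t. matrix_inv (M t) $ i", simplified]
      continuous_on_vec_lambda[where f="\<lambda>i t. matrix_inv (M t) $ _ $ i", simplified])
qed

lemma continuous_on_block_matrix:
  fixes M11 :: "'t::topological_space \<Rightarrow> 'a::real_normed_vector^'n::finite^'n"
  assumes "continuous_on S M11" "continuous_on S M12" "continuous_on S M21" "continuous_on S M22"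
  shows "continuous_on S (\<lambda>t. block_matrix (M11 t) (M12 t) (M21 t) (M22 t))"
proof -
  have "continuous_on S (\<lambda>t. block_matrix (M11 t) (M12 t) (M21 t) (M22 t) $ i $ j)" for i j
    by (cases i; cases j)
      (simp_all add: block_matrix_def side_by_side_def, (intro continuous_intros assms)+)
  then show ?thesis
    by (intro continuous_on_vec_lambda[where f="\<lambda>i t. block_matrix (M11 t) (M12 t) (M21 t) (M22 t) $ i", simplified]
      continuous_on_vec_lambda[where f="\<lambda>i t. block_matrix (M11 t) (M12 t) (M21 t) (M22 t) $ _ $ i", simplified])
qed

lemmas continuous_on_matrix_mult [continuous_intros] =
  bounded_bilinear.continuous_on[OF bounded_bilinear_matrix_mult]
lemmas continuous_on_matrix_vector [continuous_intros] =
  bounded_bilinear.continuous_on[OF bounded_bilinear_matrix_vector]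
lemmas continuous_on_transpose [continuous_intros] =
  bounded_linear.continuous_on[OF bounded_linear_transpose]
lemmas continuous_on_cmat [continuous_intros] =
  bounded_linear.continuous_on[OF bounded_linear_cmat]

lemma matrix_minus_mult: "(- A) ** B = - (A ** B)" "A ** (- B) = - (A ** B)"
  for A :: "'a::comm_ring_1^'n^'m"
  by (simp_all add: vec_eq_iff matrix_matrix_mult_def sum_negf)

section \<open>The Hamiltonian system\<close>

locale sturm_liouville =
  fixes T :: real and P Q R R1 :: "real \<Rightarrow> real ^ 'n::finite ^ 'n"
    and \<gamma> :: "complex \<Rightarrow> real \<Rightarrow> complex^('n+'n)^('n+'n)"
  assumes T_pos: "T > 0"
    and cont: "continuous_on {0..T} P" "continuous_on {0..T} Q"
      "continuous_on {0..T} R" "continuous_on {0..T} R1"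
    and sym: "\<And>t. t \<in> {0..T} \<Longrightarrow> transpose (P t) = P t"
      "\<And>t. t \<in> {0..T} \<Longrightarrow> transpose (R t) = R t"
      "\<And>t. t \<in> {0..T} \<Longrightarrow> transpose (R1 t) = R1 t"
    and P_inv: "\<And>t. t \<in> {0..T} \<Longrightarrow> invertible (P t)"
    and fund: "\<And>l. fundamental_solution T (\<lambda>t. sympl_J ** B_matrix P Q R R1 l t) (\<gamma> l)"
begin

abbreviation has_deriv :: "(real \<Rightarrow> 'b::real_normed_vector) \<Rightarrow> 'b \<Rightarrow> real \<Rightarrow> bool" where
  "has_deriv f f' t \<equiv> (f has_vector_derivative f') (at t within {0..T})"

text \<open>
  The matrix \<open>A l t\<close> generates \<open>\<gamma> l\<close>.  It is affine in \<open>l\<close>, and \<open>H t\<close> is its derivative in \<open>l\<close>.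
  In a solution \<open>z = (x, y)\<close>, \<open>velocity t x y\<close> is the derivative of \<open>y\<close>.
\<close>
definition A :: "complex \<Rightarrow> real \<Rightarrow> complex^('n+'n)^('n+'n)" where
  "A l t = sympl_J ** B_matrix P Q R R1 l t"

definition H :: "real \<Rightarrow> complex^('n+'n)^('n+'n)" where
  "H t = block_matrix 0 (cmat (R1 t)) 0 0"

definition velocity :: "real \<Rightarrow> complex^'n \<Rightarrow> complex^'n \<Rightarrow> complex^'n" where
  "velocity t x y = cmat (matrix_inv (P t)) *v (x - cmat (Q t) *v y)"

lemma H_mult: "H t *v z = vjoin (cmat (R1 t) *v lower z) 0"
  using block_matrix_mult[of 0 "cmat (R1 t)" 0 0 "upper z" "lower z"] by (simp add: H_def)

lemma A_mult: "A l t *v vjoin x y =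
    vjoin (cmat (transpose (Q t)) *v velocity t x y + cmat (R t) *v y + l *s (cmat (R1 t) *v y)) (velocity t x y)"
  unfolding A_def B_matrix_def Let_def matrix_vector_mul_assoc[symmetric] block_matrix_mult sympl_J_mult
  by (simp add: vjoin_inj velocity_def cmat_mult minus_matrix_vector_mult matrix_vector_mul_assoc[symmetric]
      matrix_vector_mult_diff_distrib matrix_vector_mult_diff_rdistrib mat_mult_vec del: transpose_matrix_vector)

lemma A_add: "A (l + e) t = A l t + mat e ** H t"
proof -
  have "A (l + e) t *v vjoin x y = (A l t + mat e ** H t) *v vjoin x y" for x y
    by (simp add: A_mult matrix_vector_mult_add_rdistrib matrix_vector_mul_assoc[symmetric] H_mult
        mat_mult_vec vjoin_scale vjoin_add vector_sadd_rdistrib add.assoc)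
  then show ?thesis unfolding matrix_eq_vjoin by blast
qed

lemma continuous_on_matrix_inv_P: "continuous_on {0..T} (\<lambda>t. matrix_inv (P t))"
  by (intro continuous_on_matrix_inv cont P_inv)

lemma continuous_on_transpose_Q: "continuous_on {0..T} (\<lambda>t. cmat (transpose (Q t)))"
  unfolding cmat_transpose by (intro continuous_intros cont)

lemma continuous_on_H: "continuous_on {0..T} H"
  unfolding H_def by (intro continuous_on_block_matrix continuous_intros cont)

lemma continuous_on_A: "continuous_on {0..T} (A l)"
  unfolding A_def B_matrix_def Let_def cmat_mult
  by (intro continuous_on_block_matrix continuous_intros cont continuous_on_matrix_inv_P continuous_on_transpose_Q)

lemma transpose_B_matrix:
  assumes t: "t \<in> {0..T}"
  shows "transpose (B_matrix P Q R R1 l t) = B_matrix P Q R R1 l t"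
proof -
  have i: "matrix_inv (P t) ** P t = mat 1" "P t ** matrix_inv (P t) = mat 1"
    using matrix_inv_mult[OF P_inv[OF t]] by auto
  have "transpose (matrix_inv (P t)) = transpose (matrix_inv (P t)) ** (P t ** matrix_inv (P t))"
    by (simp add: i)
  also have "\<dots> = transpose (P t ** matrix_inv (P t)) ** matrix_inv (P t)"
    by (simp add: matrix_transpose_mul sym[OF t] matrix_mul_assoc)
  finally have s: "transpose (matrix_inv (P t)) = matrix_inv (P t)" by (simp add: i)
  have tm: "transpose (- X) = - transpose X" "transpose (X - Y) = transpose X - transpose Y"
    for X Y :: "complex^'n^'n"
    by (simp_all add: transpose_def vec_eq_iff)
  show ?thesis
    unfolding B_matrix_def Let_def block_matrix_transpose tm cmat_mult matrix_transpose_mul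
      cmat_transpose[symmetric] s sym[OF t] transpose_transpose transpose_mat
      mat_mult_commute[of l, symmetric]
    by (simp add: matrix_mul_assoc)
qed

lemma gamma_0: "\<gamma> l 0 = mat 1"
  using fund[of l] by (simp add: fundamental_solution_def)

lemma gamma_deriv: "t \<in> {0..T} \<Longrightarrow> has_deriv (\<gamma> l) (A l t ** \<gamma> l t) t"
  using fund[of l] by (simp add: fundamental_solution_def A_def)

lemma continuous_on_gamma: "continuous_on {0..T} (\<gamma> l)"
  using gamma_deriv by (meson continuous_on_eq_continuous_within has_vector_derivative_continuous)

text \<open>
  As \<open>J B\<close> is Hamiltonian, \<open>\<gamma>\<^sup>T J \<gamma> = J\<close>.  This makes \<open>\<gamma>\<close> invertible with the explicit inverse \<open>- J \<gamma>\<^sup>T J\<close>,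
  which maps every solution to a constant.
\<close>
definition gamma_inv :: "complex \<Rightarrow> real \<Rightarrow> complex^('n+'n)^('n+'n)" where
  "gamma_inv l t = - (sympl_J ** transpose (\<gamma> l t) ** sympl_J)"

lemma A_symplectic:
  assumes "t \<in> {0..T}"
  shows "transpose (A l t) ** sympl_J = B_matrix P Q R R1 l t"
    "sympl_J ** A l t = - B_matrix P Q R R1 l t"
proof -
  show 1: "sympl_J ** A l t = - B_matrix P Q R R1 l t"
    by (simp add: A_def matrix_mul_assoc sympl_J_square matrix_minus_mult)
  show "transpose (A l t) ** sympl_J = B_matrix P Q R R1 l t"
    by (simp add: A_def matrix_transpose_mul transpose_B_matrix[OF assms] sympl_J_transpose matrix_minus_mult
        matrix_mul_assoc[symmetric] sympl_J_square)
qed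

lemma transpose_gamma_deriv:
  "t \<in> {0..T} \<Longrightarrow> ((\<lambda>t. transpose (\<gamma> l t)) has_vector_derivative
     transpose (\<gamma> l t) ** transpose (A l t)) (at t within {0..T})"
  using bounded_linear.has_vector_derivative[OF bounded_linear_transpose gamma_deriv[of t l]]
  by (simp add: matrix_transpose_mul)

lemma gamma_symplectic:
  assumes "t \<in> {0..T}"
  shows "transpose (\<gamma> l t) ** sympl_J ** \<gamma> l t = sympl_J"
proof -
  let ?f = "\<lambda>t. transpose (\<gamma> l t) ** sympl_J ** \<gamma> l t"
  have "has_deriv ?f 0 t" if t: "t \<in> {0..T}" for t
  proof -
    have 1: "((\<lambda>t. transpose (\<gamma> l t) ** sympl_J) has_vector_derivative
       transpose (\<gamma> l t) ** transpose (A l t) ** sympl_J) (at t within {0..T})"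
      using bounded_bilinear.has_vector_derivative[OF bounded_bilinear_matrix_mult
          transpose_gamma_deriv[OF t] has_vector_derivative_const[of sympl_J]]
      by simp
    have "has_deriv ?f (transpose (\<gamma> l t) ** sympl_J ** (A l t ** \<gamma> l t) +
       transpose (\<gamma> l t) ** transpose (A l t) ** sympl_J ** \<gamma> l t) t"
      by (rule bounded_bilinear.has_vector_derivative[OF bounded_bilinear_matrix_mult 1 gamma_deriv[OF t]])
    moreover have "transpose (\<gamma> l t) ** sympl_J ** (A l t ** \<gamma> l t) +
       transpose (\<gamma> l t) ** transpose (A l t) ** sympl_J ** \<gamma> l t
       = transpose (\<gamma> l t) ** (sympl_J ** A l t) ** \<gamma> l t
         + transpose (\<gamma> l t) ** (transpose (A l t) ** sympl_J) ** \<gamma> l t"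
      by (simp add: matrix_mul_assoc)
    moreover have "\<dots> = 0" unfolding A_symplectic[OF t] by (simp add: matrix_minus_mult)
    ultimately show ?thesis by simp
  qed
  then obtain c where "\<And>t. t \<in> {0..T} \<Longrightarrow> ?f t = c"
    using has_vector_derivative_zero_constant[of "{0..T}" ?f] by auto
  then have "?f t = ?f 0" using assms T_pos by (metis atLeastAtMost_iff less_imp_le order_refl)
  then show ?thesis by (simp add: gamma_0)
qed

lemma gamma_inv_left: "t \<in> {0..T} \<Longrightarrow> gamma_inv l t ** \<gamma> l t = mat 1"
  using gamma_symplectic[of t l]
  by (simp add: gamma_inv_def matrix_minus_mult matrix_mul_assoc[symmetric] sympl_J_square)

lemma gamma_inv_right: "t \<in> {0..T} \<Longrightarrow> \<gamma> l t ** gamma_inv l t = mat 1"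
  using gamma_inv_left[of t l] by (simp add: matrix_left_right_inverse)

lemma gamma_inv_deriv:
  assumes t: "t \<in> {0..T}"
  shows "has_deriv (gamma_inv l) (- (gamma_inv l t ** A l t)) t"
proof -
  have "bounded_linear (\<lambda>X. - (sympl_J ** X ** sympl_J) :: complex^('n+'n)^('n+'n))"
    by (intro bounded_linear_minus bounded_linear_compose[OF
          bounded_bilinear.bounded_linear_left[OF bounded_bilinear_matrix_mult]]
        bounded_bilinear.bounded_linear_right[OF bounded_bilinear_matrix_mult])
  from bounded_linear.has_vector_derivative[OF this transpose_gamma_deriv[OF t]]
  have "(gamma_inv l has_vector_derivative
      - (sympl_J ** (transpose (\<gamma> l t) ** transpose (A l t)) ** sympl_J)) (at t within {0..T})"
    unfolding gamma_inv_def .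
  moreover have "- (sympl_J ** (transpose (\<gamma> l t) ** transpose (A l t)) ** sympl_J) =
      - (sympl_J ** transpose (\<gamma> l t) ** (transpose (A l t) ** sympl_J))"
    by (simp add: matrix_mul_assoc)
  moreover have "\<dots> = - (gamma_inv l t ** A l t)"
    by (simp add: gamma_inv_def matrix_minus_mult matrix_mul_assoc[symmetric] A_symplectic[OF t])
  ultimately show ?thesis by simp
qed

lemma continuous_on_gamma_inv: "continuous_on {0..T} (gamma_inv l)"
  unfolding gamma_inv_def by (intro continuous_intros continuous_on_gamma)

text \<open>
  Variation of constants: applying \<open>\<gamma>\<inverse>\<close> to a solution of an inhomogeneous system leaves only the
  inhomogeneity.
\<close>
lemma gamma_inv_deriv_vec:
  assumes t: "t \<in> {0..T}" and z: "has_deriv z (A l t *v z t + h) t"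
  shows "has_deriv (\<lambda>t. gamma_inv l t *v z t) (gamma_inv l t *v h) t"
  using bounded_bilinear.has_vector_derivative[OF bounded_bilinear_matrix_vector gamma_inv_deriv[OF t, of l] z]
  by (simp add: minus_matrix_vector_mult matrix_vector_right_distrib matrix_vector_mul_assoc)

lemma gamma_inv_deriv_mat:
  assumes t: "t \<in> {0..T}" and z: "has_deriv z (A l t ** z t + h) t"
  shows "has_deriv (\<lambda>t. gamma_inv l t ** z t) (gamma_inv l t ** h) t"
  using bounded_bilinear.has_vector_derivative[OF bounded_bilinear_matrix_mult gamma_inv_deriv[OF t, of l] z]
  by (simp add: matrix_minus_mult matrix_add_ldistrib matrix_mul_assoc)

lemma solution_unique:
  assumes z: "\<And>t. t \<in> {0..T} \<Longrightarrow> has_deriv z (A l t *v z t + h t) t"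
    and w: "\<And>t. t \<in> {0..T} \<Longrightarrow> has_deriv w (A l t *v w t + h t) t"
    and "z 0 = w 0" and t: "t \<in> {0..T}"
  shows "z t = w t"
proof -
  let ?d = "\<lambda>t. z t - w t"
  have "has_deriv ?d (A l t *v ?d t + 0) t" if "t \<in> {0..T}" for t
    using has_vector_derivative_diff[OF z[OF that] w[OF that]]
    by (simp add: matrix_vector_mult_diff_distrib)
  from gamma_inv_deriv_vec[OF _ this]
  have "has_deriv (\<lambda>t. gamma_inv l t *v ?d t) 0 t" if "t \<in> {0..T}" for t
    using that by simp
  then obtain c where "\<And>t. t \<in> {0..T} \<Longrightarrow> gamma_inv l t *v ?d t = c"
    using has_vector_derivative_zero_constant[of "{0..T}" "\<lambda>t. gamma_inv l t *v ?d t"] by auto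
  then have "gamma_inv l t *v ?d t = gamma_inv l 0 *v ?d 0"
    using t T_pos by (metis atLeastAtMost_iff less_imp_le order_refl)
  then have "\<gamma> l t *v (gamma_inv l t *v ?d t) = 0" by (simp add: assms(3))
  then have "mat 1 *v ?d t = 0" by (metis matrix_vector_mul_assoc gamma_inv_right[OF t])
  then show ?thesis by simp
qed

section \<open>Power series in the spectral parameter\<close>

lemma bounded_on_interval:
  fixes f :: "real \<Rightarrow> 'b::real_normed_vector"
  assumes "continuous_on {0..T} f"
  obtains B where "B > 0" "\<And>t. t \<in> {0..T} \<Longrightarrow> norm (f t) \<le> B"
proof -
  have "bounded (f ` {0..T})"
    by (intro compact_imp_bounded compact_continuous_image assms compact_Icc)
  then show thesis using that unfolding bounded_pos by (metis imageI)
qed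

text \<open>
  The Taylor coefficients in \<open>e\<close> of \<open>\<gamma> (l + e)\<close>: comparing coefficients in the differential equation gives
  \<open>\<Gamma>\<^bsub>j+1\<^esub>' = A \<Gamma>\<^bsub>j+1\<^esub> + H \<Gamma>\<^sub>j\<close> with \<open>\<Gamma>\<^bsub>j+1\<^esub>(0) = 0\<close>, which is solved by variation of constants.
\<close>
primrec gamma_coeff :: "complex \<Rightarrow> nat \<Rightarrow> real \<Rightarrow> complex^('n+'n)^('n+'n)" where
  "gamma_coeff l 0 = \<gamma> l"
| "gamma_coeff l (Suc j) = (\<lambda>t. \<gamma> l t ** integral {0..t} (\<lambda>s. gamma_inv l s ** (H s ** gamma_coeff l j s)))"

lemma gamma_coeff_initial: "gamma_coeff l j 0 = (if j = 0 then mat 1 else 0)"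
  by (cases j) (simp_all add: gamma_0)

lemma gamma_coeff_deriv_cont:
  "(\<forall>t\<in>{0..T}. (gamma_coeff l j has_vector_derivative
      A l t ** gamma_coeff l j t + (case j of 0 \<Rightarrow> 0 | Suc i \<Rightarrow> H t ** gamma_coeff l i t)) (at t within {0..T})) \<and>
   continuous_on {0..T} (gamma_coeff l j)"
proof (induction j)
  case 0
  then show ?case using gamma_deriv continuous_on_gamma by simp
next
  case (Suc j)
  let ?g = "\<lambda>s. gamma_inv l s ** (H s ** gamma_coeff l j s)"
  have g: "continuous_on {0..T} ?g"
    using Suc by (intro continuous_intros continuous_on_gamma_inv continuous_on_H) auto
  have d: "has_deriv (gamma_coeff l (Suc j)) (A l t ** gamma_coeff l (Suc j) t + H t ** gamma_coeff l j t) t"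
    if t: "t \<in> {0..T}" for t
  proof -
    have "(gamma_coeff l (Suc j) has_vector_derivative
        \<gamma> l t ** ?g t + (A l t ** \<gamma> l t) ** integral {0..t} ?g) (at t within {0..T})"
      using bounded_bilinear.has_vector_derivative[OF bounded_bilinear_matrix_mult gamma_deriv[OF t]
          integral_has_vector_derivative[OF g t], of l] by simp
    moreover have "\<gamma> l t ** ?g t = H t ** gamma_coeff l j t"
      by (simp add: matrix_mul_assoc gamma_inv_right[OF t])
    ultimately show ?thesis by (simp add: matrix_mul_assoc add.commute)
  qed
  then have "continuous_on {0..T} (gamma_coeff l (Suc j))"
    unfolding continuous_on_eq_continuous_within using has_vector_derivative_continuous by blast
  then show ?case using d by (simp del: gamma_coeff.simps)
qed

lemmas gamma_coeff_deriv = gamma_coeff_deriv_cont[THEN conjunct1, rule_format]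
text \<open>
  The constant \<open>K\<close> depends only on \<open>l\<close>.  Hence each step in the Taylor expansion gains a factor \<open>K \<bar>e\<bar>\<close>, which is all
  that local convergence needs.
\<close>
lemma perturbation_bound:
  obtains K where "K > 0" "\<And>(E :: real \<Rightarrow> complex^('n+'n)^('n+'n)) F e C t. \<lbrakk>\<And>t. t \<in> {0..T} \<Longrightarrow>
      has_deriv E (A l t ** E t + mat e ** (H t ** F t)) t;
      E 0 = 0; \<And>t. t \<in> {0..T} \<Longrightarrow> norm (F t) \<le> C; C \<ge> 0; t \<in> {0..T}\<rbrakk>
    \<Longrightarrow> norm (E t) \<le> K * norm e * C"
proof -
  obtain k where k: "k > 0" "\<And>(X :: complex^('n+'n)^('n+'n)) (Y :: complex^('n+'n)^('n+'n)). norm (X ** Y) \<le> norm X * norm Y * k"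
    using bounded_bilinear.pos_bounded[OF bounded_bilinear_matrix_mult] by blast
  obtain m where m: "m > 0" "\<And>e. norm (mat e :: complex^('n+'n)^('n+'n)) \<le> norm e * m"
    using bounded_linear.pos_bounded[OF bounded_linear_mat] by blast
  obtain G where G: "G > 0" "\<And>t. t \<in> {0..T} \<Longrightarrow> norm (\<gamma> l t) \<le> G"
    using bounded_on_interval[OF continuous_on_gamma] by blast
  obtain Gi where Gi: "Gi > 0" "\<And>t. t \<in> {0..T} \<Longrightarrow> norm (gamma_inv l t) \<le> Gi"
    using bounded_on_interval[OF continuous_on_gamma_inv] by blast
  obtain h where h: "h > 0" "\<And>t. t \<in> {0..T} \<Longrightarrow> norm (H t) \<le> h"
    using bounded_on_interval[OF continuous_on_H] by blast
  have mult: "norm (X ** Y) \<le> a * b * k" if "norm X \<le> a" "norm Y \<le> b" for X Y :: "complex^('n+'n)^('n+'n)" and a b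
    using k(2)[of X Y] mult_mono[OF that order_trans[OF norm_ge_zero that(1)] norm_ge_zero] k(1)
    by (meson mult_right_mono less_imp_le order_trans)
  define K where "K = G * (Gi * (m * (h * k) * k) * k * T) * k"
  show thesis
  proof
    show "K > 0" using k m G Gi h T_pos by (simp add: K_def)
    fix E F :: "real \<Rightarrow> complex^('n+'n)^('n+'n)" and e and C t :: real
    assume E: "\<And>t. t \<in> {0..T} \<Longrightarrow>
        has_deriv E (A l t ** E t + mat e ** (H t ** F t)) t"
      and E0: "E 0 = 0" and F: "\<And>t. t \<in> {0..T} \<Longrightarrow> norm (F t) \<le> C" and C: "C \<ge> 0" and t: "t \<in> {0..T}"
    let ?g = "\<lambda>s. gamma_inv l s ** (mat e ** (H s ** F s))"
    have "(?g has_integral gamma_inv l t ** E t - gamma_inv l 0 ** E 0) {0..t}"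
    proof (rule fundamental_theorem_of_calculus)
      fix s assume "s \<in> {0..t}"
      then have "s \<in> {0..T}" "{0..t} \<subseteq> {0..T}" using t by auto
      then show "((\<lambda>s. gamma_inv l s ** E s) has_vector_derivative ?g s) (at s within {0..t})"
        using gamma_inv_deriv_mat[OF _ E] has_vector_derivative_within_subset by blast
    qed (use t in auto)
    then have i: "(?g has_integral gamma_inv l t ** E t) {0..t}" by (simp add: E0)
    have "norm (gamma_inv l t ** E t) \<le> Gi * (norm e * m * (h * C * k) * k) * k * measure lborel {0..t}"
    proof (rule has_integral_bound_real[OF _ _ i])
      fix s assume "s \<in> {0..t} - {}"
      then have "s \<in> {0..T}" using t by auto
      then show "norm (?g s) \<le> Gi * (norm e * m * (h * C * k) * k) * k"
        by (intro mult Gi m h F)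
    qed (use k m h Gi C in auto)
    also have "\<dots> \<le> Gi * (norm e * m * (h * C * k) * k) * k * T"
      using t k m h Gi C by (intro mult_left_mono) auto
    finally have "norm (\<gamma> l t ** (gamma_inv l t ** E t)) \<le> G * (Gi * (norm e * m * (h * C * k) * k) * k * T) * k"
      by (intro mult G t)
    then show "norm (E t) \<le> K * norm e * C"
      by (simp add: matrix_mul_assoc gamma_inv_right[OF t] K_def mult_ac)
  qed
qed

definition taylor_rem :: "complex \<Rightarrow> complex \<Rightarrow> nat \<Rightarrow> real \<Rightarrow> complex^('n+'n)^('n+'n)" where
  "taylor_rem l e n t = \<gamma> (l + e) t - (\<Sum>j<n. mat (e ^ j) ** gamma_coeff l j t)"

lemma mat_mult_mat: "mat (a * b) ** X = mat a ** (mat b ** X)" for a b :: complex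
  by (simp add: vec_eq_iff mat_mult_nth)

lemma mat_mult_left_commute: "X ** (mat a ** Y) = mat a ** (X ** Y)"
  for a :: complex and X :: "complex^'b^'a" and Y :: "complex^'c^'b"
  by (metis mat_mult_commute matrix_mul_assoc)

lemma matrix_sum_mult: "X ** (\<Sum>i\<in>I. Y i) = (\<Sum>i\<in>I. X ** Y i)"
  for X :: "complex^'b^'a" and Y :: "'i \<Rightarrow> complex^'c^'b"
  using linear_sum[OF bounded_linear.linear[OF
    bounded_bilinear.bounded_linear_right[OF bounded_bilinear_matrix_mult]]] by metis

lemma matrix_diff_ldistrib: "X ** (Y - Z) = X ** Y - X ** Z"
  for X :: "complex^'b^'a" and Y :: "complex^'c^'b"
  by (simp add: vec_eq_iff matrix_matrix_mult_def right_diff_distrib sum_subtractf)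

lemma matrix_add_mult: "(X + Y) ** Z = X ** Z + Y ** Z"
  for X :: "complex^'b^'a" and Z :: "complex^'c^'b"
  by (simp add: vec_eq_iff matrix_matrix_mult_def distrib_right sum.distrib)

text \<open>
  The remainders satisfy the same recursive system as the coefficients, with the next remainder driven by
  the previous one; so \<open>perturbation_bound\<close> shows that they tend to zero geometrically.
\<close>
lemma taylor_rem_deriv:
  assumes t: "t \<in> {0..T}"
  shows "(taylor_rem l e (Suc n) has_vector_derivative
    A l t ** taylor_rem l e (Suc n) t + mat e ** (H t ** taylor_rem l e n t)) (at t within {0..T})"
proof -
  let ?D = "\<lambda>j. A l t ** gamma_coeff l j t + (case j of 0 \<Rightarrow> 0 | Suc i \<Rightarrow> H t ** gamma_coeff l i t)"
  have "has_deriv (\<lambda>t. mat (e ^ j) ** gamma_coeff l j t) (mat (e ^ j) ** ?D j) t" for j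
    by (intro bounded_linear.has_vector_derivative[OF _ gamma_coeff_deriv[OF t]]
      bounded_bilinear.bounded_linear_right[OF bounded_bilinear_matrix_mult])
  then have "(taylor_rem l e (Suc n) has_vector_derivative
      A (l + e) t ** \<gamma> (l + e) t - (\<Sum>j<Suc n. mat (e ^ j) ** ?D j)) (at t within {0..T})"
    unfolding taylor_rem_def by (intro has_vector_derivative_diff gamma_deriv t has_vector_derivative_sum)
  also have "(\<Sum>j<Suc n. mat (e ^ j) ** ?D j) =
      A l t ** (\<Sum>j<Suc n. mat (e ^ j) ** gamma_coeff l j t) +
      (\<Sum>j<Suc n. mat (e ^ j) ** (case j of 0 \<Rightarrow> 0 | Suc i \<Rightarrow> H t ** gamma_coeff l i t))"
    unfolding matrix_sum_mult by (simp only: matrix_add_ldistrib sum.distrib mat_mult_left_commute)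
  also have "(\<Sum>j<Suc n. mat (e ^ j) ** (case j of 0 \<Rightarrow> 0 | Suc i \<Rightarrow> H t ** gamma_coeff l i t)) =
      mat e ** (H t ** (\<Sum>j<n. mat (e ^ j) ** gamma_coeff l j t))"
    unfolding matrix_sum_mult by (subst sum.lessThan_Suc_shift) (simp add: mat_mult_mat mat_mult_left_commute[of "H t"])
  also have "A (l + e) t ** \<gamma> (l + e) t - (A l t ** (\<Sum>j<Suc n. mat (e ^ j) ** gamma_coeff l j t) +
      mat e ** (H t ** (\<Sum>j<n. mat (e ^ j) ** gamma_coeff l j t))) =
      A l t ** taylor_rem l e (Suc n) t + mat e ** (H t ** taylor_rem l e n t)"
    unfolding A_add[of l e] taylor_rem_def
    by (simp add: matrix_add_mult matrix_diff_ldistrib matrix_mul_assoc[symmetric] del: sum.lessThan_Suc)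
  finally show ?thesis .
qed

lemma taylor_rem_initial: "taylor_rem l e (Suc n) 0 = 0"
proof -
  have "(\<Sum>j<Suc n. mat (e ^ j) ** gamma_coeff l j 0) = mat 1"
    by (subst sum.lessThan_Suc_shift) (simp add: gamma_coeff_initial del: gamma_coeff.simps)
  then show ?thesis by (simp add: taylor_rem_def gamma_0 del: sum.lessThan_Suc)
qed

lemma gamma_power_series:
  obtains \<epsilon> where "\<epsilon> > 0" "\<And>e i j. norm e < \<epsilon> \<Longrightarrow> (\<lambda>k. gamma_coeff l k T $ i $ j * e ^ k) sums (\<gamma> (l + e) T $ i $ j)"
proof (rule perturbation_bound[of l], goal_cases)
  case K: (1 K)
  show thesis
  proof
    show "1 / K > 0" using K(2) by simp
    fix e :: complex and i j assume e: "norm e < 1 / K"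
    obtain C where C: "C > 0" "\<And>t. t \<in> {0..T} \<Longrightarrow> norm (\<gamma> (l + e) t) \<le> C"
      using bounded_on_interval[OF continuous_on_gamma] by blast
    have taylor_rem: "norm (taylor_rem l e n t) \<le> C * (K * norm e) ^ n" if "t \<in> {0..T}" for n t
      using that
    proof (induction n arbitrary: t)
      case 0
      then show ?case using C by (simp add: taylor_rem_def)
    next
      case (Suc n)
      have "norm (taylor_rem l e (Suc n) t) \<le> K * norm e * (C * (K * norm e) ^ n)"
        by (rule K(3)[OF taylor_rem_deriv taylor_rem_initial])
          (use Suc K(2) C in auto)
      then show ?case by (simp add: mult_ac)
    qed
    have T: "T \<in> {0..T}" using T_pos by simp
    have "(\<lambda>n. C * (K * norm e) ^ n) \<longlonglongrightarrow> C * 0"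
      using K(2) e by (intro tendsto_intros LIMSEQ_power_zero) (simp add: field_simps)
    then have "(\<lambda>n. C * (K * norm e) ^ n) \<longlonglongrightarrow> 0" by simp
    then have "(\<lambda>n. taylor_rem l e n T) \<longlonglongrightarrow> 0"
      by (rule Lim_null_comparison[OF always_eventually[OF allI[OF taylor_rem[OF T]]]])
    then have "(\<lambda>n. \<gamma> (l + e) T - taylor_rem l e n T) \<longlonglongrightarrow> \<gamma> (l + e) T - 0"
      by (intro tendsto_intros)
    then have "(\<lambda>n. (\<gamma> (l + e) T - taylor_rem l e n T) $ i $ j) \<longlonglongrightarrow> \<gamma> (l + e) T $ i $ j"
      by (intro tendsto_vec_nth) simp
    then show "(\<lambda>k. gamma_coeff l k T $ i $ j * e ^ k) sums (\<gamma> (l + e) T $ i $ j)"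
      unfolding sums_def taylor_rem_def by (simp add: mat_mult_nth mult.commute)
  qed
qed

lemma gamma_has_fps_expansion:
  "(\<lambda>e. \<gamma> (l + e) T $ i $ j) has_fps_expansion Abs_fps (\<lambda>k. gamma_coeff l k T $ i $ j)"
proof -
  obtain \<epsilon> where \<epsilon>: "\<epsilon> > 0" "\<And>e i j. norm e < \<epsilon> \<Longrightarrow> (\<lambda>k. gamma_coeff l k T $ i $ j * e ^ k) sums (\<gamma> (l + e) T $ i $ j)"
    using gamma_power_series by blast
  let ?F = "Abs_fps (\<lambda>k. gamma_coeff l k T $ i $ j)"
  have "norm (of_real (\<epsilon> / 2) :: complex) < \<epsilon>" using \<epsilon> by simp
  from \<epsilon>(2)[OF this, of i j] have "summable (\<lambda>k. gamma_coeff l k T $ i $ j * of_real (\<epsilon> / 2) ^ k)"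
    by (rule sums_summable)
  then have r: "conv_radius (\<lambda>k. gamma_coeff l k T $ i $ j) \<ge> norm (of_real (\<epsilon> / 2) :: complex)"
    by (rule conv_radius_geI)
  have "ereal (norm (of_real (\<epsilon> / 2) :: complex)) > 0" using \<epsilon>(1) by simp
  then have "conv_radius (\<lambda>k. gamma_coeff l k T $ i $ j) > 0" using r by (rule order_less_le_trans)
  then have "fps_conv_radius ?F > 0" by (simp add: fps_conv_radius_def)
  moreover have "\<forall>\<^sub>F e in nhds 0. eval_fps ?F e = \<gamma> (l + e) T $ i $ j"
    unfolding eventually_nhds_metric
    using \<epsilon> by (intro exI[of _ \<epsilon>]) (auto simp: eval_fps_def sums_iff)
  ultimately show ?thesis by (simp add: has_fps_expansion_def)
qed

section \<open>Growth in the spectral parameter\<close>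

lemma norm_upper_lower: "(norm z)\<^sup>2 = (norm (upper z))\<^sup>2 + (norm (lower z))\<^sup>2"
  for z :: "complex^('n+'n)"
  by (simp add: norm_vec_def L2_set_def sum_UNIV_Plus upper_def lower_def sum_nonneg)

text \<open>
  The algebra behind the growth estimate.  With \<open>X = \<bar>x\<bar>\<close>, \<open>y\<close> in place of \<open>\<bar>y\<bar>\<close> and \<open>m = \<bar>\<lambda>\<bar>\<close>, the left hand side
  bounds half of the derivative of the energy \<open>\<bar>x\<bar>\<^sup>2 + \<mu>\<^sup>2 \<bar>y\<bar>\<^sup>2\<close>.  In terms of \<open>Y = \<mu> y\<close> the coupling \<open>m X y\<close> is at most \<open>\<mu> X Y\<close>, which is
  linear in \<open>\<mu>\<close>.
\<close>
lemma weighted_energy_bound: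
  fixes K C X y \<mu> m :: real
  assumes "K \<ge> 0" "C \<ge> 0" "X \<ge> 0" "y \<ge> 0" "\<mu> \<ge> 1" "m \<le> \<mu>\<^sup>2" "m \<ge> 0"
  shows "X * (K * (X + y) + m * (C * y)) + \<mu>\<^sup>2 * (y * (K * (X + y))) \<le> \<mu> * (2 * K + C) * (X\<^sup>2 + \<mu>\<^sup>2 * y\<^sup>2)"
proof -
  define Y where "Y = \<mu> * y"
  have Y: "y \<le> Y" "Y \<ge> 0" "m * y \<le> \<mu> * Y"
    using assms mult_right_mono[of 1 \<mu> y] mult_right_mono[of m "\<mu>\<^sup>2" y]
    by (auto simp: Y_def power2_eq_square mult_ac)
  have "X * (K * (X + y) + m * (C * y)) \<le> X * (K * (X + Y) + C * (\<mu> * Y))"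
    using Y assms mult_left_mono[OF Y(3), of C] by (intro mult_left_mono add_mono) (auto simp: mult_ac)
  also have "\<dots> \<le> \<mu> * (K * (X\<^sup>2 + X * Y) + C * (X * Y))"
    using mult_right_mono[of 1 \<mu> "K * (X\<^sup>2 + X * Y)"] assms Y
    by (auto simp: algebra_simps power2_eq_square)
  finally have 1: "X * (K * (X + y) + m * (C * y)) \<le> \<mu> * (K * (X\<^sup>2 + X * Y) + C * (X * Y))" .
  have "\<mu>\<^sup>2 * (y * (K * (X + y))) = \<mu> * (K * (X * Y)) + K * Y\<^sup>2"
    by (simp add: Y_def power2_eq_square algebra_simps)
  also have "\<dots> \<le> \<mu> * (K * (X * Y)) + \<mu> * (K * Y\<^sup>2)"
    using mult_right_mono[of 1 \<mu> "K * Y\<^sup>2"] assms by auto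
  finally have 2: "\<mu>\<^sup>2 * (y * (K * (X + y))) \<le> \<mu> * (K * (X * Y) + K * Y\<^sup>2)" by (simp add: algebra_simps)
  have "X * Y \<le> (X\<^sup>2 + Y\<^sup>2) / 2"
    using sum_squares_bound[of X Y] by simp
  then have "(2 * K + C) * (X * Y) \<le> (2 * K + C) * ((X\<^sup>2 + Y\<^sup>2) / 2)"
    using assms by (intro mult_left_mono) auto
  also have "\<dots> \<le> (K + C) * (X\<^sup>2 + Y\<^sup>2)"
    using assms mult_right_mono[of "C / 2" C "X\<^sup>2 + Y\<^sup>2"] by (simp add: algebra_simps)
  finally have "K * (X\<^sup>2 + X * Y) + C * (X * Y) + (K * (X * Y) + K * Y\<^sup>2) \<le> (2 * K + C) * (X\<^sup>2 + Y\<^sup>2)"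
    by (simp add: algebra_simps)
  then have "\<mu> * (K * (X\<^sup>2 + X * Y) + C * (X * Y) + (K * (X * Y) + K * Y\<^sup>2)) \<le> \<mu> * ((2 * K + C) * (X\<^sup>2 + Y\<^sup>2))"
    using assms by (intro mult_left_mono) auto
  moreover have "\<mu> * ((2 * K + C) * (X\<^sup>2 + Y\<^sup>2)) = \<mu> * (2 * K + C) * (X\<^sup>2 + \<mu>\<^sup>2 * y\<^sup>2)"
    by (simp add: Y_def power_mult_distrib)
  ultimately show ?thesis using 1 2 by (simp add: distrib_left)
qed

text \<open>
  Gronwall's argument for the weighted energy \<open>N t = \<bar>x\<bar>\<^sup>2 + \<mu>\<^sup>2 \<bar>y\<bar>\<^sup>2\<close> with \<open>\<mu> = 1 + \<surd>\<bar>l\<bar>\<close>.  The exponent is proportional to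
  \<open>\<surd>\<bar>l\<bar>\<close>; the unweighted energy would only give an exponent proportional to \<open>\<bar>l\<bar>\<close>.
\<close>
lemma gamma_growth:
  obtains a where "a \<ge> 0" "\<And>l v. norm (\<gamma> l T *v v) \<le> exp (a * (1 + sqrt (norm l))) * norm v"
proof -
  obtain k where k: "k > 0" "\<And>(X :: complex^('n+'n)^('n+'n)) v. norm (X *v v) \<le> norm X * norm v * k"
    using bounded_bilinear.pos_bounded[OF bounded_bilinear_matrix_vector] by blast
  obtain k' where k': "k' > 0" "\<And>(X :: complex^'n ^ 'n) v. norm (X *v v) \<le> norm X * norm v * k'"
    using bounded_bilinear.pos_bounded[OF bounded_bilinear_matrix_vector] by blast
  obtain Ka where Ka: "Ka > 0" "\<And>t. t \<in> {0..T} \<Longrightarrow> norm (A 0 t) \<le> Ka"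
    using bounded_on_interval[OF continuous_on_A] by blast
  have "continuous_on {0..T} (\<lambda>t. cmat (R1 t))" by (intro continuous_intros cont)
  then obtain Kr where Kr: "Kr > 0" "\<And>t. t \<in> {0..T} \<Longrightarrow> norm (cmat (R1 t)) \<le> Kr"
    using bounded_on_interval by blast
  define K where "K = Ka * k"
  define C where "C = Kr * k'"
  have KC: "K > 0" "C > 0" using k k' Ka Kr by (auto simp: K_def C_def)
  have K: "norm (A 0 t *v z) \<le> K * norm z" if "t \<in> {0..T}" for t z
  proof -
    have "norm (A 0 t *v z) \<le> norm (A 0 t) * norm z * k" by (rule k(2))
    also have "\<dots> \<le> Ka * norm z * k" using k(1) by (intro mult_right_mono Ka(2) that) auto
    finally show ?thesis by (simp add: K_def mult_ac)
  qed
  have C: "norm (cmat (R1 t) *v y) \<le> C * norm y" if "t \<in> {0..T}" for t y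
  proof -
    have "norm (cmat (R1 t) *v y) \<le> norm (cmat (R1 t)) * norm y * k'" by (rule k'(2))
    also have "\<dots> \<le> Kr * norm y * k'" using k'(1) by (intro mult_right_mono Kr(2) that) auto
    finally show ?thesis by (simp add: C_def mult_ac)
  qed
  have bound: "norm (\<gamma> l T *v v) \<le> (1 + sqrt (norm l)) * exp ((2 * K + C) * T * (1 + sqrt (norm l))) * norm v" for l v
  proof -
    define \<mu> where "\<mu> = 1 + sqrt (norm l)"
    have \<mu>: "\<mu> \<ge> 1" "norm l \<le> \<mu>\<^sup>2" by (auto simp: \<mu>_def power2_eq_square algebra_simps)
    define a where "a = 2 * (\<mu> * (2 * K + C))"
    define z where "z = (\<lambda>t. \<gamma> l t *v v)"
    define x where "x = (\<lambda>t. upper (z t))"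
    define y where "y = (\<lambda>t. lower (z t))"
    define x' where "x' = (\<lambda>t. upper (A 0 t *v z t) + l *s (cmat (R1 t) *v y t))"
    define y' where "y' = (\<lambda>t. lower (A 0 t *v z t))"
    have z: "has_deriv z (A l t *v z t) t" if "t \<in> {0..T}" for t
      using bounded_linear.has_vector_derivative[OF bounded_bilinear.bounded_linear_left[OF bounded_bilinear_matrix_vector, of v]
          gamma_deriv[OF that]]
      by (simp add: z_def matrix_vector_mul_assoc)
    have Az: "A l t *v z t = A 0 t *v z t + vjoin (l *s (cmat (R1 t) *v y t)) 0" for t
      using A_add[of 0 l t]
      by (simp add: matrix_vector_mult_add_rdistrib matrix_vector_mul_assoc[symmetric] H_mult mat_mult_vec
          vjoin_scale y_def)
    have x: "has_deriv x (x' t) t"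
      and y: "has_deriv y (y' t) t" if "t \<in> {0..T}" for t
      using bounded_linear.has_vector_derivative[OF bounded_linear_upper_lower(1) z[OF that]]
        bounded_linear.has_vector_derivative[OF bounded_linear_upper_lower(2) z[OF that]]
      unfolding Az
      by (simp_all add: x_def y_def x'_def y'_def linear_add[OF bounded_linear.linear] bounded_linear_upper_lower)
    define N where "N = (\<lambda>t. x t \<bullet> x t + \<mu>\<^sup>2 * (y t \<bullet> y t))"
    define N' where "N' = (\<lambda>t. 2 * (x t \<bullet> x' t + \<mu>\<^sup>2 * (y t \<bullet> y' t)))"
    have N: "(N has_real_derivative N' t) (at t within {0..T})" if "t \<in> {0..T}" for t
      using has_vector_derivative_add[OF
        bounded_bilinear.has_vector_derivative[OF bounded_bilinear_inner x[OF that] x[OF that]]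
        bounded_linear.has_vector_derivative[OF bounded_linear_mult_right
          bounded_bilinear.has_vector_derivative[OF bounded_bilinear_inner y[OF that] y[OF that]], of "\<mu>\<^sup>2"]]
      by (simp add: has_real_derivative_iff_has_vector_derivative N_def N'_def inner_commute algebra_simps)
    have N'_le: "N' t \<le> a * N t" if t: "t \<in> {0..T}" for t
    proof -
      have nz: "norm (z t) \<le> norm (x t) + norm (y t)"
      proof (rule power2_le_imp_le)
        show "(norm (z t))\<^sup>2 \<le> (norm (x t) + norm (y t))\<^sup>2"
          unfolding norm_upper_lower[of "z t"] by (simp add: x_def y_def power2_sum)
      qed simp
      have ul: "norm (upper w) \<le> norm w" "norm (lower w) \<le> norm w" for w :: "complex^('n+'n)"
        by (rule power2_le_imp_le, use norm_upper_lower[of w] in simp, simp)+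
      have Kz: "norm (A 0 t *v z t) \<le> K * (norm (x t) + norm (y t))"
        by (rule order_trans[OF K[OF t] mult_left_mono[OF nz]]) (use KC in simp)
      have sc: "norm (l *s w) = norm l * norm w" for w :: "complex^'n"
        by (simp add: norm_vec_def norm_mult L2_set_right_distrib)
      have "norm (x' t) \<le> K * (norm (x t) + norm (y t)) + norm l * (C * norm (y t))"
        unfolding x'_def
      proof (rule norm_triangle_le, rule add_mono)
        show "norm (upper (A 0 t *v z t)) \<le> K * (norm (x t) + norm (y t))"
          using ul(1) Kz by (rule order_trans)
        show "norm (l *s (cmat (R1 t) *v y t)) \<le> norm l * (C * norm (y t))"
          unfolding sc by (intro mult_left_mono C t) simp
      qed
      then have 1: "x t \<bullet> x' t \<le> norm (x t) * (K * (norm (x t) + norm (y t)) + norm l * (C * norm (y t)))"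
        by (rule order_trans[OF norm_cauchy_schwarz mult_left_mono]) simp
      have "norm (y' t) \<le> K * (norm (x t) + norm (y t))"
        unfolding y'_def using ul(2) Kz by (rule order_trans)
      then have 2: "y t \<bullet> y' t \<le> norm (y t) * (K * (norm (x t) + norm (y t)))"
        by (rule order_trans[OF norm_cauchy_schwarz mult_left_mono]) simp
      have "x t \<bullet> x' t + \<mu>\<^sup>2 * (y t \<bullet> y' t) \<le>
          norm (x t) * (K * (norm (x t) + norm (y t)) + norm l * (C * norm (y t))) +
          \<mu>\<^sup>2 * (norm (y t) * (K * (norm (x t) + norm (y t))))"
        by (intro add_mono 1 mult_left_mono 2) simp
      also have "\<dots> \<le> \<mu> * (2 * K + C) * ((norm (x t))\<^sup>2 + \<mu>\<^sup>2 * (norm (y t))\<^sup>2)"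
        by (rule weighted_energy_bound) (use KC \<mu> in auto)
      finally have "x t \<bullet> x' t + \<mu>\<^sup>2 * (y t \<bullet> y' t) \<le>
          \<mu> * (2 * K + C) * ((norm (x t))\<^sup>2 + \<mu>\<^sup>2 * (norm (y t))\<^sup>2)" .
      then show ?thesis by (simp add: N'_def N_def a_def power2_norm_eq_inner)
    qed
    define F where "F = (\<lambda>t. exp (- (a * t)) * N t)"
    have F: "(F has_real_derivative exp (- (a * t)) * (N' t - a * N t)) (at t within {0..T})" if "t \<in> {0..T}" for t
      unfolding F_def by (auto intro!: derivative_eq_intros N[OF that] simp: algebra_simps)
    have "F T \<le> F 0"
    proof (rule DERIV_nonpos_imp_decreasing_open[where f = F and a = 0 and b = T])
      show "0 \<le> T" using T_pos by simp
      show "continuous_on {0..T} F"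
        using F by (meson continuous_on_eq_continuous_within DERIV_continuous)
      fix t assume t: "0 < t" "t < T"
      then have "(F has_real_derivative exp (- (a * t)) * (N' t - a * N t)) (at t)"
        using F[of t] by (simp add: at_within_Icc_at)
      moreover have "exp (- (a * t)) * (N' t - a * N t) \<le> 0"
        using N'_le[of t] t by (intro mult_nonneg_nonpos) auto
      ultimately show "\<exists>D. (F has_real_derivative D) (at t) \<and> D \<le> 0" by blast
    qed
    then have NT: "N T \<le> exp (a * T) * N 0"
      by (simp add: F_def exp_minus field_simps)
    have "(norm (z T))\<^sup>2 \<le> N T"
      unfolding norm_upper_lower[of "z T"] N_def power2_norm_eq_inner[symmetric] x_def y_def
      using \<mu>(1) mult_right_mono[of 1 "\<mu>\<^sup>2" "(norm (lower (z T)))\<^sup>2"] by simp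
    also note NT
    also have "exp (a * T) * N 0 \<le> exp (a * T) * (\<mu>\<^sup>2 * (norm v)\<^sup>2)"
    proof (rule mult_left_mono)
      have "z 0 = v" by (simp add: z_def gamma_0)
      then show "N 0 \<le> \<mu>\<^sup>2 * (norm v)\<^sup>2"
        unfolding norm_upper_lower[of v] N_def power2_norm_eq_inner[symmetric] x_def y_def distrib_left
        using \<mu>(1) mult_right_mono[of 1 "\<mu>\<^sup>2" "(norm (upper v))\<^sup>2"] by simp
    qed simp
    also have "\<dots> = (\<mu> * exp ((2 * K + C) * T * \<mu>) * norm v)\<^sup>2"
      by (simp add: power_mult_distrib a_def exp_double[symmetric] mult_ac)
    finally have "norm (z T) \<le> \<mu> * exp ((2 * K + C) * T * \<mu>) * norm v"
      by (rule power2_le_imp_le) (use \<mu> in simp)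
    then show ?thesis by (simp add: z_def \<mu>_def)
  qed
  show thesis
  proof
    show "(2 * K + C) * T + 1 \<ge> 0" using KC T_pos by simp
    fix l :: complex and v :: "complex^('n+'n)"
    let ?m = "1 + sqrt (norm l)"
    have "?m * exp ((2 * K + C) * T * ?m) \<le> exp ?m * exp ((2 * K + C) * T * ?m)"
      using exp_ge_add_one_self[of ?m] by (intro mult_right_mono) auto
    also have "\<dots> = exp (((2 * K + C) * T + 1) * ?m)" by (simp add: exp_add[symmetric] algebra_simps)
    finally show "norm (\<gamma> l T *v v) \<le> exp (((2 * K + C) * T + 1) * ?m) * norm v"
      by (rule order_trans[OF bound mult_right_mono]) simp
  qed
qed

end

section \<open>Lagrangian boundary conditions and the characteristic determinant\<close>

lemma has_vector_derivative_upper_lower: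
  fixes z :: "real \<Rightarrow> complex ^ ('n::finite + 'n)"
  shows "(z has_vector_derivative w) (at t within S) \<longleftrightarrow>
    ((\<lambda>t. upper (z t)) has_vector_derivative upper w) (at t within S) \<and>
    ((\<lambda>t. lower (z t)) has_vector_derivative lower w) (at t within S)"
proof
  assume "((\<lambda>t. upper (z t)) has_vector_derivative upper w) (at t within S) \<and>
    ((\<lambda>t. lower (z t)) has_vector_derivative lower w) (at t within S)"
  then have "((\<lambda>t. (upper (z t), lower (z t))) has_vector_derivative (upper w, lower w)) (at t within S)"
    by (simp add: has_vector_derivative_Pair)
  from bounded_linear.has_vector_derivative[OF bounded_linear_vjoin this]
  show "(z has_vector_derivative w) (at t within S)" by simp
qed (auto intro: bounded_linear.has_vector_derivative bounded_linear_upper_lower)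

lemma cmat_Re_Im: "Re ((cmat Z *v u) $ i) = (Z *v (\<chi> k. Re (u $ k))) $ i"
  "Im ((cmat Z *v u) $ i) = (Z *v (\<chi> k. Im (u $ k))) $ i"
  by (simp_all add: matrix_vector_mult_def)

lemma complexification_frame:
  assumes "lagrangian_frame Z L"
  shows "complexification L = range (\<lambda>u. cmat Z *v u)"
proof (intro set_eqI iffI)
  fix z assume "z \<in> complexification L"
  then have "(\<chi> i. Re (z $ i)) \<in> range (\<lambda>u. Z *v u)" "(\<chi> i. Im (z $ i)) \<in> range (\<lambda>u. Z *v u)"
    using assms unfolding complexification_def lagrangian_frame_def by auto
  then obtain a b where ab: "(\<chi> i. Re (z $ i)) = Z *v a" "(\<chi> i. Im (z $ i)) = Z *v b"
    by blast
  have "z = cmat Z *v (\<chi> k. Complex (a $ k) (b $ k))"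
    using ab by (simp add: vec_eq_iff complex_eq_iff cmat_Re_Im)
  then show "z \<in> range (\<lambda>u. cmat Z *v u)" by blast
next
  fix z assume "z \<in> range (\<lambda>u. cmat Z *v u)"
  then obtain u where "z = cmat Z *v u" by blast
  then have "(\<chi> i. Re (z $ i)) = Z *v (\<chi> k. Re (u $ k))" "(\<chi> i. Im (z $ i)) = Z *v (\<chi> k. Im (u $ k))"
    by (simp_all add: vec_eq_iff cmat_Re_Im)
  then show "z \<in> complexification L"
    using assms unfolding complexification_def lagrangian_frame_def by auto
qed

text \<open>
  A Lagrangian subspace has dimension \<open>n\<close>, so the \<open>n\<close> columns of a frame are independent over the reals, and
  therefore over the complex numbers.
\<close>
lemma lagrangian_frame_inj:
  fixes Z :: "real ^ 'n ^ ('n::finite + 'n)"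
  assumes "lagrangian_frame Z L" "lagrangian L" "cmat Z *v u = 0"
  shows "u = 0"
proof -
  have "rank Z = CARD('n)"
    using assms(1,2) by (simp add: rank_dim_range lagrangian_frame_def lagrangian_def)
  then have inj: "Z *v v = 0 \<Longrightarrow> v = 0" for v
    by (metis full_rank_injective injD matrix_vector_mult_0_right)
  have "Z *v (\<chi> k. Re (u $ k)) = 0" "Z *v (\<chi> k. Im (u $ k)) = 0"
    unfolding vec_eq_iff cmat_Re_Im[symmetric] assms(3) by simp_all
  then have "(\<chi> k. Re (u $ k)) = 0" "(\<chi> k. Im (u $ k)) = 0" using inj by blast+
  then show ?thesis by (simp add: vec_eq_iff complex_eq_iff)
qed

lemma matrix_vector_mult_minus: "X *v (- v) = - (X *v v)" for X :: "'a::comm_ring_1^'n^'m"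
  by (simp add: vec_eq_iff matrix_vector_mult_def sum_negf)

lemma vjoin_zero: "vjoin 0 0 = 0"
  by (simp add: vec_eq_iff_sum)

locale sturm_liouville_bvp = sturm_liouville T P Q R R1 \<gamma>
  for T :: real and P Q R R1 :: "real \<Rightarrow> real ^ 'n::finite ^ 'n"
    and \<gamma> :: "complex \<Rightarrow> real \<Rightarrow> complex^('n+'n)^('n+'n)" +
  fixes L0 L1 :: "(real ^ ('n + 'n)) set" and Z0 Z1 :: "real ^ 'n ^ ('n + 'n)"
  assumes lagr: "lagrangian L0" "lagrangian L1"
    and frame: "lagrangian_frame Z0 L0" "lagrangian_frame Z1 L1"
    and nondeg: "\<not> SL_eigenvalue T P Q R R1 L0 L1 0"
begin

abbreviation "C0 \<equiv> complexification L0"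
abbreviation "C1 \<equiv> complexification L1"

definition D :: "complex \<Rightarrow> complex" where
  "D l = det (side_by_side (\<gamma> l T ** cmat Z0) (cmat Z1))"

lemma zero_T_in [simp]: "0 \<in> {0..T}" "T \<in> {0..T}"
  using T_pos by auto

lemmas compl0 = complexification_frame[OF frame(1)]
lemmas compl1 = complexification_frame[OF frame(2)]
lemmas frame0_inj = lagrangian_frame_inj[OF frame(1) lagr(1)]
lemmas frame1_inj = lagrangian_frame_inj[OF frame(2) lagr(2)]

text \<open>
  In a nontrivial relation \<open>\<gamma> Z\<^sub>0 u = Z\<^sub>1 w\<close> the vector \<open>u\<close> is nonzero because \<open>Z\<^sub>1\<close> is injective.
\<close>
lemma D_eq_0_iff:
  "D l = 0 \<longleftrightarrow> (\<exists>u w. u \<noteq> 0 \<and> \<gamma> l T *v (cmat Z0 *v u) = cmat Z1 *v w)"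
proof -
  let ?M = "side_by_side (\<gamma> l T ** cmat Z0) (cmat Z1)"
  have "D l = 0 \<longleftrightarrow> (\<exists>z. z \<noteq> 0 \<and> ?M *v z = 0)"
    unfolding D_def
    by (metis invertible_det_nz invertible_left_inverse matrix_left_invertible_ker matrix_vector_mult_0_right)
  also have "\<dots> \<longleftrightarrow> (\<exists>u w. u \<noteq> 0 \<and> \<gamma> l T *v (cmat Z0 *v u) = cmat Z1 *v w)"
  proof
    assume "\<exists>z. z \<noteq> 0 \<and> ?M *v z = 0"
    then obtain z where z: "z \<noteq> 0" "?M *v vjoin (upper z) (lower z) = 0" by auto
    have eq: "\<gamma> l T *v (cmat Z0 *v upper z) = cmat Z1 *v (- lower z)"
      using z(2)[unfolded side_by_side_mult] by (simp add: matrix_vector_mul_assoc eq_neg_iff_add_eq_0 matrix_vector_mult_minus)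
    have "upper z \<noteq> 0"
    proof
      assume u: "upper z = 0"
      then have "- lower z = 0" using eq by (intro frame1_inj) simp
      then have "vjoin (upper z) (lower z) = vjoin 0 0" using u by simp
      then have "z = 0" by (simp add: vec_eq_iff_sum)
      then show False using z by simp
    qed
    then show "\<exists>u w. u \<noteq> 0 \<and> \<gamma> l T *v (cmat Z0 *v u) = cmat Z1 *v w" using eq by blast
  next
    assume "\<exists>u w. u \<noteq> 0 \<and> \<gamma> l T *v (cmat Z0 *v u) = cmat Z1 *v w"
    then obtain u w where uw: "u \<noteq> 0" "\<gamma> l T *v (cmat Z0 *v u) = cmat Z1 *v w" by blast
    have "?M *v vjoin u (- w) = \<gamma> l T *v (cmat Z0 *v u) - cmat Z1 *v w"
      by (simp add: side_by_side_mult matrix_vector_mul_assoc matrix_vector_mult_minus)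
    moreover have "vjoin u (- w) \<noteq> 0" using uw(1) by (auto simp: vec_eq_iff_sum vec_eq_iff)
    ultimately show "\<exists>z. z \<noteq> 0 \<and> ?M *v z = 0" using uw(2) by (intro exI[of _ "vjoin u (- w)"]) simp
  qed
  finally show ?thesis .
qed

lemma velocity_iff:
  assumes t: "t \<in> {0..T}"
  shows "x = cmat (P t) *v v + cmat (Q t) *v y \<longleftrightarrow> v = velocity t x y"
proof -
  have i: "cmat (P t) ** cmat (matrix_inv (P t)) = mat 1" "cmat (matrix_inv (P t)) ** cmat (P t) = mat 1"
    using matrix_inv_mult[OF P_inv[OF t]] by (simp_all add: cmat_mult[symmetric] cmat_mat_1)
  show ?thesis
  proof
    assume "x = cmat (P t) *v v + cmat (Q t) *v y"
    then show "v = velocity t x y" by (simp add: velocity_def matrix_vector_mul_assoc i)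
  next
    assume "v = velocity t x y"
    then show "x = cmat (P t) *v v + cmat (Q t) *v y" by (simp add: velocity_def matrix_vector_mul_assoc i)
  qed
qed

lemma gamma_solution:
  "t \<in> {0..T} \<Longrightarrow> has_deriv (\<lambda>t. \<gamma> l t *v v) (A l t *v (\<gamma> l t *v v)) t"
  using bounded_linear.has_vector_derivative[OF
      bounded_bilinear.bounded_linear_left[OF bounded_bilinear_matrix_vector, of v] gamma_deriv]
  by (simp add: matrix_vector_mul_assoc)

lemma solution_eq_gamma:
  assumes "\<And>t. t \<in> {0..T} \<Longrightarrow> has_deriv z (A l t *v z t) t" "t \<in> {0..T}"
  shows "z t = \<gamma> l t *v z 0"
  by (rule solution_unique[of z l "\<lambda>_. 0"]) (use assms gamma_solution in \<open>auto simp: gamma_0\<close>)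

text \<open>
  If \<open>y\<close> vanishes identically, then so does its derivative, and \<open>x = P y' + Q y\<close> vanishes as well.
\<close>
lemma vanishing_lower:
  assumes z: "\<And>t. t \<in> {0..T} \<Longrightarrow> has_deriv z (A l t *v z t + vjoin (g t) 0) t"
    and y: "\<And>t. t \<in> {0..T} \<Longrightarrow> lower (z t) = 0" and t: "t \<in> {0..T}"
  shows "z t = 0"
proof -
  have "has_deriv (\<lambda>t. lower (z t)) (velocity t (upper (z t)) (lower (z t))) t"
    using z[OF t] A_mult[of l t "upper (z t)" "lower (z t)"] by (simp add: has_vector_derivative_upper_lower vjoin_add)
  moreover have "has_deriv (\<lambda>t. lower (z t)) 0 t"
    by (rule has_vector_derivative_transform[OF t _ has_vector_derivative_const[of 0]]) (use y in auto)
  ultimately have "velocity t (upper (z t)) 0 = 0"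
    using vector_derivative_unique_within_closed_interval[of 0 T t "\<lambda>t. lower (z t)"] T_pos t y[OF t] by fastforce
  then have "upper (z t) = 0"
    using velocity_iff[OF t, of "upper (z t)" 0 0] by simp
  then have "vjoin (upper (z t)) (lower (z t)) = vjoin 0 0" using y[OF t] by simp
  then show ?thesis by (simp add: vec_eq_iff_sum)
qed

text \<open>
  With \<open>x = P y' + Q y\<close>, that is \<open>y' = velocity t x y\<close>, the equation of second order becomes the Hamiltonian system
  for \<open>z = (x, y)\<close>.
\<close>
lemma SL_eigenvalue_iff_solution:
  "SL_eigenvalue T P Q R R1 L0 L1 l \<longleftrightarrow>
    (\<exists>z. (\<forall>t\<in>{0..T}. has_deriv z (A l t *v z t) t) \<and>
      z 0 \<in> C0 \<and> z T \<in> C1 \<and> (\<exists>t\<in>{0..T}. lower (z t) \<noteq> 0))"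
proof
  assume "SL_eigenvalue T P Q R R1 L0 L1 l"
  then obtain y y' x x' :: "real \<Rightarrow> complex^'n" where s0: "\<forall>t\<in>{0..T}.
       has_deriv y (y' t) t \<and>
       x t = cmat (P t) *v y' t + cmat (Q t) *v y t \<and>
       has_deriv x (x' t) t \<and>
       - x' t + cmat (transpose (Q t)) *v y' t + (cmat (R t) + mat l ** cmat (R1 t)) *v y t = 0"
    and bc: "vjoin (x 0) (y 0) \<in> C0" "vjoin (x T) (y T) \<in> C1"
    "\<exists>t\<in>{0..T}. y t \<noteq> 0"
    unfolding SL_eigenvalue_def by blast
  note s = s0[rule_format, THEN conjunct1] s0[rule_format, THEN conjunct2, THEN conjunct1]
    s0[rule_format, THEN conjunct2, THEN conjunct2, THEN conjunct1]
    s0[rule_format, THEN conjunct2, THEN conjunct2, THEN conjunct2]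
  have "has_deriv (\<lambda>t. vjoin (x t) (y t)) (A l t *v vjoin (x t) (y t)) t"
    if t: "t \<in> {0..T}" for t
  proof -
    have v: "y' t = velocity t (x t) (y t)" using s(2)[OF t] by (simp add: velocity_iff[OF t])
    have "x' t = cmat (transpose (Q t)) *v y' t + (cmat (R t) + mat l ** cmat (R1 t)) *v y t"
      using s(4)[OF t] by (simp add: algebra_simps add_eq_0_iff)
    then have "x' t = cmat (transpose (Q t)) *v velocity t (x t) (y t) + cmat (R t) *v y t + l *s (cmat (R1 t) *v y t)"
      unfolding v by (simp add: matrix_vector_mult_add_rdistrib matrix_vector_mul_assoc[symmetric] mat_mult_vec add.assoc)
    then show ?thesis
      using s(1)[OF t] s(3)[OF t] v by (simp add: has_vector_derivative_upper_lower A_mult)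
  qed
  then show "\<exists>z. (\<forall>t\<in>{0..T}. has_deriv z (A l t *v z t) t) \<and>
      z 0 \<in> C0 \<and> z T \<in> C1 \<and> (\<exists>t\<in>{0..T}. lower (z t) \<noteq> 0)"
    using bc by (intro exI[of _ "\<lambda>t. vjoin (x t) (y t)"]) simp
next
  assume "\<exists>z. (\<forall>t\<in>{0..T}. has_deriv z (A l t *v z t) t) \<and>
      z 0 \<in> C0 \<and> z T \<in> C1 \<and> (\<exists>t\<in>{0..T}. lower (z t) \<noteq> 0)"
  then obtain z where z: "\<And>t. t \<in> {0..T} \<Longrightarrow> has_deriv z (A l t *v z t) t"
      "z 0 \<in> C0" "z T \<in> C1" "\<exists>t\<in>{0..T}. lower (z t) \<noteq> 0" by blast
  let ?x = "\<lambda>t. upper (z t)" and ?y = "\<lambda>t. lower (z t)"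
  let ?v = "\<lambda>t. velocity t (?x t) (?y t)"
  let ?x' = "\<lambda>t. cmat (transpose (Q t)) *v ?v t + cmat (R t) *v ?y t + l *s (cmat (R1 t) *v ?y t)"
  have "A l t *v z t = vjoin (?x' t) (?v t)" for t
    using A_mult[of l t "?x t" "?y t"] by simp
  then have d: "has_deriv ?x (?x' t) t"
     "has_deriv ?y (?v t) t" if "t \<in> {0..T}" for t
    using z(1)[OF that] by (simp_all add: has_vector_derivative_upper_lower)
  have "- ?x' t + cmat (transpose (Q t)) *v ?v t + (cmat (R t) + mat l ** cmat (R1 t)) *v ?y t = 0" for t
    by (simp add: matrix_vector_mult_add_rdistrib matrix_vector_mul_assoc[symmetric] mat_mult_vec)
  moreover have "?x t = cmat (P t) *v ?v t + cmat (Q t) *v ?y t" if "t \<in> {0..T}" for t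
    using velocity_iff[OF that] by blast
  ultimately show "SL_eigenvalue T P Q R R1 L0 L1 l"
    unfolding SL_eigenvalue_def using d z(2-4)
    by (intro exI[of _ ?y] exI[of _ ?v] exI[of _ ?x] exI[of _ ?x']) auto
qed

lemma SL_eigenvalue_iff_D: "SL_eigenvalue T P Q R R1 L0 L1 l \<longleftrightarrow> D l = 0"
proof
  assume "SL_eigenvalue T P Q R R1 L0 L1 l"
  then obtain z where z: "\<And>t. t \<in> {0..T} \<Longrightarrow> has_deriv z (A l t *v z t) t"
      "z 0 \<in> C0" "z T \<in> C1" "\<exists>t\<in>{0..T}. lower (z t) \<noteq> 0"
    unfolding SL_eigenvalue_iff_solution by blast
  obtain u w where uw: "z 0 = cmat Z0 *v u" "z T = cmat Z1 *v w"
    using z(2,3) unfolding compl0 compl1 by blast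
  have zt: "z t = \<gamma> l t *v (cmat Z0 *v u)" if "t \<in> {0..T}" for t
    using solution_eq_gamma[of z l t] z(1) that uw(1) by simp
  have "u \<noteq> 0"
  proof
    assume "u = 0"
    then have "z t = 0" if "t \<in> {0..T}" for t using zt[OF that] by simp
    then show False using z(4) by (auto simp: lower_def vec_eq_iff)
  qed
  then show "D l = 0" unfolding D_eq_0_iff using zt[OF zero_T_in(2)] uw(2) by metis
next
  assume "D l = 0"
  then obtain u w where uw: "u \<noteq> 0" "\<gamma> l T *v (cmat Z0 *v u) = cmat Z1 *v w"
    unfolding D_eq_0_iff by blast
  let ?z = "\<lambda>t. \<gamma> l t *v (cmat Z0 *v u)"
  have "\<exists>t\<in>{0..T}. lower (?z t) \<noteq> 0"
  proof (rule ccontr)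
    assume "\<not> (\<exists>t\<in>{0..T}. lower (?z t) \<noteq> 0)"
    then have "?z 0 = 0" by (intro vanishing_lower[of ?z l "\<lambda>_. 0"]) (use gamma_solution T_pos in \<open>auto simp: vjoin_zero\<close>)
    then show False using frame0_inj uw(1) by (simp add: gamma_0)
  qed
  then show "SL_eigenvalue T P Q R R1 L0 L1 l"
    unfolding SL_eigenvalue_iff_solution compl0 compl1
    by (intro exI[of _ ?z]) (use gamma_solution uw(2) in \<open>auto simp: gamma_0\<close>)
qed

lemma D_0: "D 0 \<noteq> 0"
  using nondeg by (simp add: SL_eigenvalue_iff_D)

text \<open>
  The Taylor series at \<open>l\<close> of the matrix whose determinant is \<open>D\<close>.
\<close>
definition boundary_fps :: "complex \<Rightarrow> complex fps ^ ('n + 'n) ^ ('n + 'n)" where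
  "boundary_fps l = (\<chi> r c. case c of
     Inl k \<Rightarrow> \<Sum>m\<in>UNIV. Abs_fps (\<lambda>i. gamma_coeff l i T $ r $ m) * fps_const (cmat Z0 $ m $ k)
   | Inr k \<Rightarrow> fps_const (cmat Z1 $ r $ k))"

lemma has_fps_expansion_det:
  fixes M :: "complex \<Rightarrow> complex ^ 'm ^ 'm"
  assumes "\<And>i j. (\<lambda>e. M e $ i $ j) has_fps_expansion F $ i $ j"
  shows "(\<lambda>e. det (M e)) has_fps_expansion det F"
proof -
  have mult: "(\<lambda>e. of_int k * f e) has_fps_expansion of_int k * G" if "f has_fps_expansion G"
    for k and f :: "complex \<Rightarrow> complex" and G
    using has_fps_expansion_cmult_left[OF that, of "of_int k"] by (simp add: fps_of_int)
  show ?thesis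
    unfolding det_def by (intro has_fps_expansion_sum mult has_fps_expansion_prod assms)
qed

lemma D_has_fps_expansion: "(\<lambda>e. D (l + e)) has_fps_expansion det (boundary_fps l)"
  unfolding D_def
proof (rule has_fps_expansion_det)
  fix r c :: "'n + 'n"
  show "(\<lambda>e. side_by_side (\<gamma> (l + e) T ** cmat Z0) (cmat Z1) $ r $ c) has_fps_expansion boundary_fps l $ r $ c"
  proof (cases c)
    case (Inl k)
    then show ?thesis
      using has_fps_expansion_sum[of UNIV "\<lambda>m e. \<gamma> (l + e) T $ r $ m * cmat Z0 $ m $ k"
        "\<lambda>m. Abs_fps (\<lambda>i. gamma_coeff l i T $ r $ m) * fps_const (cmat Z0 $ m $ k)"]
      by (simp add: side_by_side_def boundary_fps_def matrix_matrix_mult_def has_fps_expansion_mult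
          gamma_has_fps_expansion)
  next
    case (Inr k)
    then show ?thesis by (simp add: side_by_side_def boundary_fps_def)
  qed
qed

lemma D_entire: "D holomorphic_on UNIV"
proof -
  have "D analytic_on {l}" for l
  proof -
    have "(\<lambda>e. D (l + e)) analytic_on {0}"
      using D_has_fps_expansion[of l] by (rule has_fps_expansion_imp_analytic_0)
    then have "((\<lambda>e. D (l + e)) \<circ> (\<lambda>x. x - l)) analytic_on {l}"
      by (intro analytic_on_compose analytic_intros) simp
    then show ?thesis by (simp add: o_def)
  qed
  then have "D analytic_on UNIV" using analytic_on_analytic_at by blast
  then show ?thesis by (rule analytic_imp_holomorphic)
qed

text \<open>
  If the series vanished, \<open>D\<close> would vanish near \<open>l\<close> and then, by analytic continuation, at \<open>0\<close>.
\<close>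
lemma zorder_D:
  shows "det (boundary_fps l) \<noteq> 0" "zorder D l = int (subdegree (det (boundary_fps l)))"
proof -
  show nz: "det (boundary_fps l) \<noteq> 0"
  proof
    assume "det (boundary_fps l) = 0"
    then have "(\<lambda>e. D (l + e)) has_fps_expansion 0" using D_has_fps_expansion[of l] by simp
    then have "\<forall>\<^sub>F e in nhds 0. D (l + e) = 0" by (simp add: has_fps_expansion_0_iff)
    then obtain d where d: "d > 0" "\<And>e. dist e 0 < d \<Longrightarrow> D (l + e) = 0"
      unfolding eventually_nhds_metric by blast
    have S: "open (ball l d)" "l \<in> ball l d" "\<And>e. e \<in> ball l d \<Longrightarrow> D e = 0"
      using d(1) d(2)[of "_ - l"] by (auto simp: dist_norm norm_minus_commute)
    have "D 0 = 0"
      by (rule analytic_continuation_open[of "ball l d" UNIV D "\<lambda>_. 0"]) (use S D_entire in auto)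
    then show False using D_0 by simp
  qed
  show "zorder D l = int (subdegree (det (boundary_fps l)))"
    using has_fps_expansion_zorder[OF D_has_fps_expansion nz] .
qed

text \<open>
  The determinant is a polynomial in entries that are bounded by a multiple of \<open>exp (a (1 + \<surd>\<bar>l\<bar>))\<close>.
\<close>
lemma D_growth:
  obtains C c where "c \<ge> 0" "\<And>l. norm (D l) \<le> C * exp (c * sqrt (norm l))"
proof -
  obtain a where a: "a \<ge> 0" "\<And>l v. norm (\<gamma> l T *v v) \<le> exp (a * (1 + sqrt (norm l))) * norm v"
    using gamma_growth by blast
  define B where "B = 1 + (\<Sum>k\<in>UNIV. norm (column k (cmat Z0))) + (\<Sum>r\<in>UNIV. \<Sum>k\<in>UNIV. norm (cmat Z1 $ r $ k))"
  have B: "norm (column k (cmat Z0)) \<le> B" "norm (cmat Z1 $ r $ k) \<le> B" "B \<ge> 0" for r k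
  proof -
    have 1: "norm (column k (cmat Z0)) \<le> (\<Sum>k\<in>UNIV. norm (column k (cmat Z0)))"
      by (intro member_le_sum) auto
    have "norm (cmat Z1 $ r $ k) \<le> (\<Sum>k\<in>UNIV. norm (cmat Z1 $ r $ k))"
      by (rule member_le_sum) auto
    also have "\<dots> \<le> (\<Sum>r\<in>UNIV. \<Sum>k\<in>UNIV. norm (cmat Z1 $ r $ k))"
      by (rule member_le_sum[of r UNIV "\<lambda>r. \<Sum>k\<in>UNIV. norm (cmat Z1 $ r $ k)"]) (auto intro: sum_nonneg)
    finally have 2: "norm (cmat Z1 $ r $ k) \<le> (\<Sum>r\<in>UNIV. \<Sum>k\<in>UNIV. norm (cmat Z1 $ r $ k))" .
    have 3: "(\<Sum>k\<in>UNIV. norm (column k (cmat Z0))) \<ge> 0" "(\<Sum>r\<in>UNIV. \<Sum>k\<in>UNIV. norm (cmat Z1 $ r $ k)) \<ge> 0"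
      by (intro sum_nonneg; simp)+
    show "norm (column k (cmat Z0)) \<le> B" "norm (cmat Z1 $ r $ k) \<le> B" "B \<ge> 0"
      unfolding B_def using 1 2 3 by linarith+
  qed
  define N where "N = CARD('n + 'n)"
  show thesis
  proof
    show "real N * a \<ge> 0" using a by simp
    fix l :: complex
    define E where "E = exp (a * (1 + sqrt (norm l)))"
    have E: "E \<ge> 1" using a by (simp add: E_def)
    let ?M = "side_by_side (\<gamma> l T ** cmat Z0) (cmat Z1)"
    have entry: "norm (?M $ r $ c) \<le> B * E" for r c
    proof (cases c)
      case (Inl k)
      have "norm ((\<gamma> l T *v column k (cmat Z0)) $ r) \<le> norm (\<gamma> l T *v column k (cmat Z0))"
        by (rule Finite_Cartesian_Product.norm_nth_le)
      also have "\<dots> \<le> E * norm (column k (cmat Z0))" unfolding E_def by (rule a(2))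
      also have "\<dots> \<le> E * B" using E B(1)[of k] by (intro mult_left_mono) auto
      finally show ?thesis using Inl
        by (simp add: side_by_side_def matrix_matrix_mult_def matrix_vector_mult_def column_def mult.commute)
    next
      case (Inr k)
      then have "norm (?M $ r $ c) \<le> B" using B(2)[of r k] by (simp add: side_by_side_def)
      also have "\<dots> \<le> B * E" using mult_left_mono[OF E B(3)] by simp
      finally show ?thesis .
    qed
    have "norm (D l) \<le> (\<Sum>p\<in>{p. p permutes (UNIV :: ('n+'n) set)}. norm (of_int (sign p) * (\<Prod>i\<in>UNIV. ?M $ i $ p i)))"
      unfolding D_def det_def by (rule norm_sum)
    also have "\<dots> \<le> (\<Sum>p\<in>{p. p permutes (UNIV :: ('n+'n) set)}. (B * E) ^ N)"
    proof (rule sum_mono)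
      fix p :: "'n + 'n \<Rightarrow> 'n + 'n"
      have "norm (of_int (sign p) :: complex) = 1" by (simp add: sign_def)
      then have "norm (of_int (sign p) * (\<Prod>i\<in>UNIV. ?M $ i $ p i)) = (\<Prod>i\<in>UNIV. norm (?M $ i $ p i))"
        by (simp add: norm_mult prod_norm)
      also have "\<dots> \<le> (\<Prod>i\<in>(UNIV :: ('n+'n) set). B * E)" by (intro prod_mono) (auto simp: entry)
      finally show "norm (of_int (sign p) * (\<Prod>i\<in>UNIV. ?M $ i $ p i)) \<le> (B * E) ^ N" by (simp add: N_def)
    qed
    also have "\<dots> = fact N * ((B * exp a) ^ N * exp (real N * a * sqrt (norm l)))"
      unfolding E_def
      by (simp add: card_permutations[of UNIV N] N_def power_mult_distrib exp_of_nat_mult[symmetric]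
          exp_add[symmetric] algebra_simps)
    finally show "norm (D l) \<le> fact N * (B * exp a) ^ N * exp (real N * a * sqrt (norm l))" by simp
  qed
qed

end

section \<open>Square integrable functions\<close>

lemma L2_eqI: "(\<And>t. t \<in> {0..T} \<Longrightarrow> f t = g t) \<Longrightarrow> L2_eq T f g"
  unfolding L2_eq_def by (intro AE_I2) (simp add: space_restrict_space)

lemma L2_eq_refl [simp]: "L2_eq T f f"
  by (rule L2_eqI) simp

lemma L2_eq_sym: "L2_eq T f g \<Longrightarrow> L2_eq T g f"
  unfolding L2_eq_def by (auto elim: eventually_mono)

lemma L2_eq_trans: "L2_eq T f g \<Longrightarrow> L2_eq T g h \<Longrightarrow> L2_eq T f h"
  unfolding L2_eq_def by (auto elim: eventually_elim2)

lemma L2_eq_lincomb: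
  "L2_eq T f g \<Longrightarrow> L2_eq T f' g' \<Longrightarrow> L2_eq T (\<lambda>t. a *s f t + b *s f' t) (\<lambda>t. a *s g t + b *s g' t)"
  unfolding L2_eq_def by (auto elim: eventually_elim2)

lemma L2_eq_scale: "L2_eq T f g \<Longrightarrow> L2_eq T (\<lambda>t. a *s f t) (\<lambda>t. a *s g t)"
  unfolding L2_eq_def by (auto elim: eventually_mono)

lemma L2_eq_negligible:
  assumes "L2_eq T f g"
  obtains N where "negligible N" "\<And>t. t \<in> {0..T} - N \<Longrightarrow> f t = g t"
proof -
  have "AE t in lebesgue. t \<in> {0..T} \<longrightarrow> f t = g t"
    using assms unfolding L2_eq_def by (simp add: AE_restrict_space_iff)
  then obtain N where "\<And>t. t \<in> space lebesgue - N \<Longrightarrow> t \<in> {0..T} \<longrightarrow> f t = g t" "N \<in> null_sets lebesgue"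
    using AE_E3 by blast
  then show thesis using that[of N] by (auto simp: negligible_iff_null_sets)
qed

lemma continuous_on_scale_vec [continuous_intros]:
  fixes f :: "'b::topological_space \<Rightarrow> complex^'n"
  shows "continuous_on S f \<Longrightarrow> continuous_on S (\<lambda>t. c *s f t)"
  unfolding mat_mult_vec[symmetric] by (intro continuous_intros)

lemma norm_scale_vec: "norm (c *s v) = norm c * norm v" for v :: "complex^'n"
  by (simp add: norm_vec_def norm_mult L2_set_right_distrib)

lemma L2_continuous:
  assumes "continuous_on {0..T} f"
  shows "f \<in> L2 T"
proof -
  have "integrable (lebesgue_on {0..T}) (\<lambda>t. (norm (f t))\<^sup>2)"
    by (intro continuous_imp_integrable_real continuous_intros assms)
  then show ?thesis
    unfolding L2_def by (simp add: continuous_imp_measurable_on_sets_lebesgue assms)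
qed

lemma L2_lincomb:
  assumes f: "f \<in> L2 T" and g: "g \<in> L2 T"
  shows "(\<lambda>t. a *s f t + b *s g t) \<in> L2 T"
proof -
  have fm: "f \<in> borel_measurable (lebesgue_on {0..T})" "g \<in> borel_measurable (lebesgue_on {0..T})"
    using f g by (auto simp: L2_def)
  have scm: "(\<lambda>v. c *s v) \<in> borel_measurable borel" for c :: complex
    by (intro borel_measurable_continuous_onI continuous_intros)
  have m: "(\<lambda>t. a *s f t + b *s g t) \<in> borel_measurable (lebesgue_on {0..T})"
    by (intro borel_measurable_add measurable_compose[OF fm(1) scm] measurable_compose[OF fm(2) scm])
  have "integrable (lebesgue_on {0..T}) (\<lambda>t. 2 * (norm a)\<^sup>2 * (norm (f t))\<^sup>2 + 2 * (norm b)\<^sup>2 * (norm (g t))\<^sup>2)"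
    using f g by (auto simp: L2_def)
  then have "integrable (lebesgue_on {0..T}) (\<lambda>t. (norm (a *s f t + b *s g t))\<^sup>2)"
  proof (rule Bochner_Integration.integrable_bound)
    show "(\<lambda>t. (norm (a *s f t + b *s g t))\<^sup>2) \<in> borel_measurable (lebesgue_on {0..T})"
      by (intro borel_measurable_power measurable_compose[OF m borel_measurable_norm])
    show "AE t in lebesgue_on {0..T}. norm ((norm (a *s f t + b *s g t))\<^sup>2)
        \<le> norm (2 * (norm a)\<^sup>2 * (norm (f t))\<^sup>2 + 2 * (norm b)\<^sup>2 * (norm (g t))\<^sup>2)"
    proof (rule AE_I2)
      fix t
      have "(norm (a *s f t + b *s g t))\<^sup>2 \<le> (norm a * norm (f t) + norm b * norm (g t))\<^sup>2"
        using norm_triangle_ineq[of "a *s f t" "b *s g t"] by (intro power_mono) (auto simp: norm_scale_vec)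
      also have "\<dots> \<le> 2 * (norm a * norm (f t))\<^sup>2 + 2 * (norm b * norm (g t))\<^sup>2"
        using sum_squares_bound[of "norm a * norm (f t)" "norm b * norm (g t)"] by (simp add: power2_sum)
      finally show "norm ((norm (a *s f t + b *s g t))\<^sup>2)
        \<le> norm (2 * (norm a)\<^sup>2 * (norm (f t))\<^sup>2 + 2 * (norm b)\<^sup>2 * (norm (g t))\<^sup>2)"
        by (simp add: power_mult_distrib mult.assoc)
    qed
  qed
  then show ?thesis using m by (simp add: L2_def)
qed

lemma L2_scale: "f \<in> L2 T \<Longrightarrow> (\<lambda>t. a *s f t) \<in> L2 T"
  using L2_lincomb[of f T f a 0] by simp

lemma W12_lincomb:
  assumes "W12 T y v" "W12 T y' v'"
  shows "W12 T (\<lambda>t. a *s y t + b *s y' t) (\<lambda>t. a *s v t + b *s v' t)"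
proof -
  have bl: "bounded_linear (\<lambda>x. c *s x)" for c :: complex and x :: "complex^'n"
    unfolding mat_mult_vec[symmetric] by (rule bounded_bilinear.bounded_linear_right[OF bounded_bilinear_matrix_vector])
  have "((\<lambda>t. a *s v t + b *s v' t) has_integral (a *s (y t - y 0) + b *s (y' t - y' 0))) {0..t}"
    if "t \<in> {0..T}" for t
    using assms that unfolding W12_def
    by (intro has_integral_add has_integral_linear[OF _ bl, unfolded o_def]) auto
  then show ?thesis
    using assms unfolding W12_def
    by (auto intro!: L2_lincomb simp: vector_ssub_ldistrib algebra_simps)
qed

lemma W12_continuous:
  assumes "W12 T y v" "T > 0"
  shows "continuous_on {0..T} y"
proof -
  have "(v has_integral (y T - y 0)) {0..T}" using assms by (simp add: W12_def)
  then have c: "continuous_on {0..T} (\<lambda>t. y 0 + integral {0..t} v)"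
    by (intro continuous_intros indefinite_integral_continuous_1) (rule has_integral_integrable)
  have "y 0 + integral {0..t} v = y t" if "t \<in> {0..T}" for t
  proof -
    have "(v has_integral (y t - y 0)) {0..t}" using assms that by (simp add: W12_def)
    then show ?thesis by (simp add: integral_unique)
  qed
  then show ?thesis using continuous_on_eq[OF c] by blast
qed

lemma W12_C1:
  assumes "\<And>t. t \<in> {0..T} \<Longrightarrow> (y has_vector_derivative v t) (at t within {0..T})" "continuous_on {0..T} v"
  shows "W12 T y v"
  unfolding W12_def
proof (intro conjI ballI)
  show "v \<in> L2 T" by (rule L2_continuous) fact
  fix t assume t: "t \<in> {0..T}"
  show "(v has_integral y t - y 0) {0..t}"
  proof (rule fundamental_theorem_of_calculus)
    fix s assume "s \<in> {0..t}"
    then show "(y has_vector_derivative v s) (at s within {0..t})"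
      using t by (intro has_vector_derivative_within_subset[OF assms(1)]) auto
  qed (use t in auto)
qed

text \<open>
  \<open>y\<close> is the integral of \<open>v\<close>, hence of the continuous representative \<open>w\<close>.
\<close>
lemma W12_derivative:
  assumes "W12 T y v" "L2_eq T v w" "continuous_on {0..T} w" "t \<in> {0..T}"
  shows "(y has_vector_derivative w t) (at t within {0..T})"
proof -
  obtain N where N: "negligible N" "\<And>t. t \<in> {0..T} - N \<Longrightarrow> v t = w t"
    using L2_eq_negligible[OF assms(2)] by blast
  have eq: "y s = y 0 + integral {0..s} w" if s: "s \<in> {0..T}" for s
  proof -
    have "(v has_integral y s - y 0) {0..s}" using assms(1) s by (simp add: W12_def)
    then have "(w has_integral y s - y 0) {0..s}"
      by (rule has_integral_spike[OF N(1), rotated]) (use N(2) s in auto)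
    then show ?thesis by (simp add: integral_unique)
  qed
  have "((\<lambda>s. y 0 + integral {0..s} w) has_vector_derivative 0 + w t) (at t within {0..T})"
    by (intro has_vector_derivative_add has_vector_derivative_const integral_has_vector_derivative assms)
  then have d: "((\<lambda>s. y 0 + integral {0..s} w) has_vector_derivative w t) (at t within {0..T})" by simp
  show ?thesis by (rule has_vector_derivative_transform[OF assms(4) _ d]) (use eq in \<open>simp only:\<close>)
qed

context sturm_liouville_bvp begin

section \<open>The Sturm-Liouville operator\<close>

abbreviation "SLop \<equiv> SL_operator T P Q R L0 L1"
abbreviation "Kop \<equiv> R1_A_inv T P Q R R1 L0 L1"

lemma compl_lincomb:
  "z \<in> C0 \<Longrightarrow> w \<in> C0 \<Longrightarrow> a *s z + b *s w \<in> C0"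
  "z \<in> C1 \<Longrightarrow> w \<in> C1 \<Longrightarrow> a *s z + b *s w \<in> C1"
proof -
  have "a *s (Z *v u) + b *s (Z *v v) = Z *v (a *s u + b *s v)" for Z :: "complex^'n ^ ('n + 'n)" and u v
    by (simp add: matrix_vector_right_distrib vector_scalar_commute)
  then show "z \<in> C0 \<Longrightarrow> w \<in> C0 \<Longrightarrow> a *s z + b *s w \<in> C0"
  "z \<in> C1 \<Longrightarrow> w \<in> C1 \<Longrightarrow> a *s z + b *s w \<in> C1"
    unfolding compl0 compl1 by (auto simp: image_iff)
qed

lemma compl_zero: "0 \<in> C0" "0 \<in> C1"
  unfolding compl0 compl1 by (metis matrix_vector_mult_0_right rangeI)+

lemma SLop_lincomb:
  assumes "SLop y f" "SLop y2 f2"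
  shows "SLop (\<lambda>t. a *s y t + b *s y2 t) (\<lambda>t. a *s f t + b *s f2 t)"
proof -
  obtain v x w where 1: "f \<in> L2 T" "W12 T y v" "W12 T x w"
    "L2_eq T x (\<lambda>t. cmat (P t) *v v t + cmat (Q t) *v y t)"
    "L2_eq T f (\<lambda>t. - w t + cmat (transpose (Q t)) *v v t + cmat (R t) *v y t)"
    "vjoin (x 0) (y 0) \<in> C0" "vjoin (x T) (y T) \<in> C1"
    using assms(1) unfolding SL_operator_def by blast
  obtain v2 x2 w2 where 2: "f2 \<in> L2 T" "W12 T y2 v2" "W12 T x2 w2"
    "L2_eq T x2 (\<lambda>t. cmat (P t) *v v2 t + cmat (Q t) *v y2 t)"
    "L2_eq T f2 (\<lambda>t. - w2 t + cmat (transpose (Q t)) *v v2 t + cmat (R t) *v y2 t)"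
    "vjoin (x2 0) (y2 0) \<in> C0" "vjoin (x2 T) (y2 T) \<in> C1"
    using assms(2) unfolding SL_operator_def by blast
  have lin: "X *v (a *s u + b *s u2) = a *s (X *v u) + b *s (X *v u2)" for X :: "complex^'n ^ 'n" and u u2
    by (simp add: matrix_vector_right_distrib vector_scalar_commute)
  have "L2_eq T (\<lambda>t. a *s x t + b *s x2 t)
      (\<lambda>t. cmat (P t) *v (a *s v t + b *s v2 t) + cmat (Q t) *v (a *s y t + b *s y2 t))"
    using L2_eq_lincomb[OF 1(4) 2(4), of a b] by (simp add: lin vector_add_ldistrib vector_scalar_commute algebra_simps)
  moreover have "L2_eq T (\<lambda>t. a *s f t + b *s f2 t)
      (\<lambda>t. - (a *s w t + b *s w2 t) + cmat (transpose (Q t)) *v (a *s v t + b *s v2 t)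
        + cmat (R t) *v (a *s y t + b *s y2 t))"
    using L2_eq_lincomb[OF 1(5) 2(5), of a b]
    by (simp add: lin vector_add_ldistrib vector_scalar_commute vector_ssub_ldistrib algebra_simps)
  moreover have "vjoin (a *s x s + b *s x2 s) (a *s y s + b *s y2 s) = a *s vjoin (x s) (y s) + b *s vjoin (x2 s) (y2 s)" for s
    by (simp add: vjoin_scale vjoin_add)
  ultimately show ?thesis
    unfolding SL_operator_def
    by (intro conjI exI[of _ "\<lambda>t. a *s v t + b *s v2 t"] exI[of _ "\<lambda>t. a *s x t + b *s x2 t"]
        exI[of _ "\<lambda>t. a *s w t + b *s w2 t"])
      (simp_all add: L2_lincomb W12_lincomb 1 2 compl_lincomb)
qed

lemma SLop_cong: "SLop y f \<Longrightarrow> L2_eq T f f' \<Longrightarrow> f' \<in> L2 T \<Longrightarrow> SLop y f'"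
  unfolding SL_operator_def by (meson L2_eq_sym L2_eq_trans)

lemma SLop_continuous: "SLop y f \<Longrightarrow> continuous_on {0..T} y"
  unfolding SL_operator_def using W12_continuous T_pos by blast

lemma continuous_on_velocity:
  assumes "continuous_on {0..T} x" "continuous_on {0..T} y"
  shows "continuous_on {0..T} (\<lambda>t. velocity t (x t) (y t))"
  unfolding velocity_def by (intro continuous_intros continuous_on_matrix_inv_P cont assms)

text \<open>
  For a continuous right hand side the weak formulation of \<open>A y = h\<close> gives a classical solution: \<open>x\<close> and \<open>y\<close>
  are continuous, the almost everywhere equations express their weak derivatives by continuous functions,
  and \<open>W12_derivative\<close> applies.
\<close>
lemma SLop_solution:
  assumes "SLop y f" "L2_eq T f h" and h: "continuous_on {0..T} h"
  obtains z where "\<And>t. t \<in> {0..T} \<Longrightarrow> has_deriv z (A 0 t *v z t + vjoin (- h t) 0) t"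
    "\<And>t. lower (z t) = y t" "z 0 \<in> C0" "z T \<in> C1"
proof -
  obtain v x w where 1: "W12 T y v" "W12 T x w"
    "L2_eq T x (\<lambda>t. cmat (P t) *v v t + cmat (Q t) *v y t)"
    "L2_eq T f (\<lambda>t. - w t + cmat (transpose (Q t)) *v v t + cmat (R t) *v y t)"
    "vjoin (x 0) (y 0) \<in> C0" "vjoin (x T) (y T) \<in> C1"
    using assms(1) unfolding SL_operator_def by blast
  have cx: "continuous_on {0..T} x" and cy: "continuous_on {0..T} y"
    using W12_continuous 1(1,2) T_pos by blast+
  let ?v = "\<lambda>t. velocity t (x t) (y t)"
  let ?w = "\<lambda>t. cmat (transpose (Q t)) *v ?v t + cmat (R t) *v y t - h t"
  have in_T: "AE t in lebesgue_on {0..T}. t \<in> {0..T}"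
    by (rule AE_I2) (simp add: space_restrict_space)
  have v: "L2_eq T v ?v"
    using 1(3) in_T unfolding L2_eq_def
  proof eventually_elim
    case (elim t)
    then show ?case using velocity_iff[of t] by blast
  qed
  have w: "L2_eq T w ?w"
    using v assms(2) 1(4) unfolding L2_eq_def
  proof eventually_elim
    case (elim t)
    then show ?case by (simp add: algebra_simps)
  qed
  have cv: "continuous_on {0..T} ?v" using cx cy by (rule continuous_on_velocity)
  have cw: "continuous_on {0..T} ?w"
    by (intro continuous_intros continuous_on_transpose_Q cv cy cont h)
  show thesis
  proof
    fix t assume t: "t \<in> {0..T}"
    show "has_deriv (\<lambda>t. vjoin (x t) (y t)) (A 0 t *v vjoin (x t) (y t) + vjoin (- h t) 0) t"
      using W12_derivative[OF 1(1) v cv t] W12_derivative[OF 1(2) w cw t]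
      by (simp add: has_vector_derivative_upper_lower A_mult vjoin_add)
  qed (use 1 in simp_all)
qed

lemma solution_SLop:
  assumes z: "\<And>t. t \<in> {0..T} \<Longrightarrow> has_deriv z (A 0 t *v z t + vjoin (- h t) 0) t"
    and h: "continuous_on {0..T} h" and bc: "z 0 \<in> C0" "z T \<in> C1"
  shows "SLop (\<lambda>t. lower (z t)) h"
proof -
  let ?x = "\<lambda>t. upper (z t)" and ?y = "\<lambda>t. lower (z t)"
  let ?v = "\<lambda>t. velocity t (?x t) (?y t)"
  let ?w = "\<lambda>t. cmat (transpose (Q t)) *v ?v t + cmat (R t) *v ?y t - h t"
  have "A 0 t *v z t + vjoin (- h t) 0 = vjoin (?w t) (?v t)" for t
    using A_mult[of 0 t "?x t" "?y t"] by (simp add: vjoin_add)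
  then have d: "has_deriv ?x (?w t) t"
     "has_deriv ?y (?v t) t" if "t \<in> {0..T}" for t
    using z[OF that] by (simp_all add: has_vector_derivative_upper_lower)
  then have cx: "continuous_on {0..T} ?x" and cy: "continuous_on {0..T} ?y"
    unfolding continuous_on_eq_continuous_within using has_vector_derivative_continuous by blast+
  have cv: "continuous_on {0..T} ?v" using cx cy by (rule continuous_on_velocity)
  have cw: "continuous_on {0..T} ?w"
    by (intro continuous_intros continuous_on_transpose_Q cv cy cont h)
  have "W12 T ?y ?v" "W12 T ?x ?w" using d cv cw by (auto intro: W12_C1)
  moreover have "L2_eq T ?x (\<lambda>t. cmat (P t) *v ?v t + cmat (Q t) *v ?y t)"
    using velocity_iff by (intro L2_eqI) blast
  moreover have "L2_eq T h (\<lambda>t. - ?w t + cmat (transpose (Q t)) *v ?v t + cmat (R t) *v ?y t)"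
    by (rule L2_eqI) simp
  ultimately show ?thesis
    unfolding SL_operator_def using bc L2_continuous[OF h]
    by (intro conjI exI[of _ ?v] exI[of _ ?x] exI[of _ ?w]) simp_all
qed

text \<open>
  A solution for the right hand side \<open>0\<close> would be an eigenfunction for the eigenvalue \<open>0\<close>.
\<close>
lemma SLop_injective:
  assumes "SLop y f" "L2_eq T f (\<lambda>t. 0)" "t \<in> {0..T}"
  shows "y t = 0"
proof -
  obtain z where z: "\<And>t. t \<in> {0..T} \<Longrightarrow> has_deriv z (A 0 t *v z t + vjoin (- 0) 0) t"
    "\<And>t. lower (z t) = y t" "z 0 \<in> C0" "z T \<in> C1"
    using SLop_solution[OF assms(1,2)] by auto
  then have "\<not> (\<exists>t\<in>{0..T}. lower (z t) \<noteq> 0)"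
    using nondeg unfolding SL_eigenvalue_iff_solution by (auto simp: vjoin_zero)
  then show ?thesis using assms(3) z(2) by auto
qed

lemma SLop_unique:
  assumes "SLop y f" "SLop y' f'" "L2_eq T f f'" "t \<in> {0..T}"
  shows "y t = y' t"
proof -
  have "L2_eq T (\<lambda>t. 1 *s f t + (-1) *s f' t) (\<lambda>t. 1 *s f' t + (-1) *s f' t)"
    by (intro L2_eq_lincomb assms) simp
  then have "L2_eq T (\<lambda>t. 1 *s f t + (-1) *s f' t) (\<lambda>t. 0)" by simp
  from SLop_injective[OF SLop_lincomb[OF assms(1,2)] this assms(4)]
  show ?thesis by simp
qed

lemma SLop_zero: "SLop (\<lambda>t. 0) (\<lambda>t. 0)"
  using solution_SLop[of "\<lambda>t. 0" "\<lambda>t. 0"] compl_zero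
  by (simp add: vjoin_zero has_vector_derivative_const lower_def zero_vec_def[symmetric])

section \<open>Generalized eigenspaces\<close>

lemma Kop_lincomb:
  assumes "Kop f g" "Kop f2 g2"
  shows "Kop (\<lambda>t. a *s f t + b *s f2 t) (\<lambda>t. a *s g t + b *s g2 t)"
proof -
  obtain y where y: "g \<in> L2 T" "SLop y f" "L2_eq T g (\<lambda>t. cmat (R1 t) *v y t)"
    using assms(1) unfolding R1_A_inv_def by blast
  obtain y2 where y2: "g2 \<in> L2 T" "SLop y2 f2" "L2_eq T g2 (\<lambda>t. cmat (R1 t) *v y2 t)"
    using assms(2) unfolding R1_A_inv_def by blast
  have "cmat (R1 t) *v (a *s u + b *s u2) = a *s (cmat (R1 t) *v u) + b *s (cmat (R1 t) *v u2)" for t u u2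
    by (simp add: matrix_vector_right_distrib vector_scalar_commute)
  then have "L2_eq T (\<lambda>t. a *s g t + b *s g2 t) (\<lambda>t. cmat (R1 t) *v (a *s y t + b *s y2 t))"
    using L2_eq_lincomb[OF y(3) y2(3), of a b] by simp
  then show ?thesis
    unfolding R1_A_inv_def using L2_lincomb[OF y(1) y2(1)] SLop_lincomb[OF y(2) y2(2)] by blast
qed

lemma Kop_cong: "Kop f g \<Longrightarrow> L2_eq T f f' \<Longrightarrow> f' \<in> L2 T \<Longrightarrow> Kop f' g"
  unfolding R1_A_inv_def using SLop_cong by blast

lemma Kop_unique:
  assumes "Kop f g" "Kop f' g'" "L2_eq T f f'"
  shows "L2_eq T g g'"
proof -
  obtain y where y: "SLop y f" "L2_eq T g (\<lambda>t. cmat (R1 t) *v y t)"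
    using assms(1) unfolding R1_A_inv_def by blast
  obtain y' where y': "SLop y' f'" "L2_eq T g' (\<lambda>t. cmat (R1 t) *v y' t)"
    using assms(2) unfolding R1_A_inv_def by blast
  have "L2_eq T (\<lambda>t. cmat (R1 t) *v y t) (\<lambda>t. cmat (R1 t) *v y' t)"
    using SLop_unique[OF y(1) y'(1) assms(3)] by (intro L2_eqI) simp
  then show ?thesis using y(2) y'(2) L2_eq_trans L2_eq_sym by blast
qed

lemma L2_zero: "(\<lambda>t. 0) \<in> L2 T"
  by (intro L2_continuous continuous_intros)

lemma Kop_zero: "Kop (\<lambda>t. 0) (\<lambda>t. 0)"
  unfolding R1_A_inv_def using SLop_zero L2_zero by (intro conjI exI[of _ "\<lambda>t. 0"]) simp_all

lemma Kop_L2: "Kop f g \<Longrightarrow> f \<in> L2 T" "Kop f g \<Longrightarrow> g \<in> L2 T"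
  unfolding R1_A_inv_def SL_operator_def by blast+

context
  fixes l0 :: complex
  assumes l0: "l0 \<noteq> 0"
begin

abbreviation "G \<equiv> ker_power T Kop (- 1 / l0)"

lemma G_Suc_iff: "f \<in> G (Suc n) \<longleftrightarrow> (\<exists>g. Kop f g \<and> (\<lambda>t. g t + (1 / l0) *s f t) \<in> G n)"
proof -
  have "(\<lambda>t. g t - (- 1 / l0) *s f t) = (\<lambda>t. g t + (1 / l0) *s f t)" for g
    by (simp add: fun_eq_iff vec_eq_iff)
  then show ?thesis using Kop_L2(1) by auto
qed

text \<open>\<open>G_Suc_iff\<close> is used in place of the defining equation.\<close>

declare ker_power.simps(2) [simp del]

lemma G_L2: "f \<in> G n \<Longrightarrow> f \<in> L2 T"
proof (cases n)
  case (Suc m)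
  assume "f \<in> G n"
  then show ?thesis unfolding Suc G_Suc_iff using Kop_L2(1) by blast
qed simp

lemma G_lincomb: "f \<in> G n \<Longrightarrow> f2 \<in> G n \<Longrightarrow> (\<lambda>t. a *s f t + b *s f2 t) \<in> G n"
proof (induction n arbitrary: f f2)
  case 0
  then have "L2_eq T (\<lambda>t. a *s f t + b *s f2 t) (\<lambda>t. a *s 0 + b *s 0)"
    by (intro L2_eq_lincomb) auto
  then show ?case using 0 by (simp add: L2_lincomb)
next
  case (Suc n)
  obtain g where g: "Kop f g" "(\<lambda>t. g t + (1 / l0) *s f t) \<in> G n" using Suc(2) unfolding G_Suc_iff by blast
  obtain g2 where g2: "Kop f2 g2" "(\<lambda>t. g2 t + (1 / l0) *s f2 t) \<in> G n" using Suc(3) unfolding G_Suc_iff by blast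
  have "(\<lambda>t. a *s (g t + (1 / l0) *s f t) + b *s (g2 t + (1 / l0) *s f2 t)) \<in> G n"
    by (rule Suc.IH[OF g(2) g2(2)])
  also have "(\<lambda>t. a *s (g t + (1 / l0) *s f t) + b *s (g2 t + (1 / l0) *s f2 t)) =
      (\<lambda>t. (a *s g t + b *s g2 t) + (1 / l0) *s (a *s f t + b *s f2 t))"
    by (simp add: fun_eq_iff vec_eq_iff algebra_simps)
  finally show ?case
    using Kop_lincomb[OF g(1) g2(1), of a b] unfolding G_Suc_iff by blast
qed

lemma G_scale: "f \<in> G n \<Longrightarrow> (\<lambda>t. a *s f t) \<in> G n"
  using G_lincomb[of f n f a 0] by simp

lemma G_cong: "f \<in> G n \<Longrightarrow> L2_eq T f f' \<Longrightarrow> f' \<in> L2 T \<Longrightarrow> f' \<in> G n"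
proof (induction n arbitrary: f f')
  case 0
  then have "L2_eq T f' (\<lambda>t. 0)" using L2_eq_trans[OF L2_eq_sym[OF 0(2)], of "\<lambda>t. 0"] by simp
  then show ?case using 0 by simp
next
  case (Suc n)
  obtain g where g: "Kop f g" "(\<lambda>t. g t + (1 / l0) *s f t) \<in> G n" using Suc(2) unfolding G_Suc_iff by blast
  have "(\<lambda>t. g t + (1 / l0) *s f' t) \<in> G n"
  proof (rule Suc.IH[OF g(2)])
    show "L2_eq T (\<lambda>t. g t + (1 / l0) *s f t) (\<lambda>t. g t + (1 / l0) *s f' t)"
      using L2_eq_lincomb[OF L2_eq_refl[of T g] Suc(3), of 1 "1 / l0"] by simp
    show "(\<lambda>t. g t + (1 / l0) *s f' t) \<in> L2 T"
      using L2_lincomb[OF Kop_L2(2)[OF g(1)] Suc(4), of 1 "1 / l0"] by simp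
  qed
  then show ?case using Kop_cong[OF g(1) Suc(3,4)] unfolding G_Suc_iff by blast
qed

lemma G_zero: "(\<lambda>t. 0) \<in> G n"
proof (induction n)
  case (Suc n)
  then show ?case using Kop_zero unfolding G_Suc_iff by (intro exI[of _ "\<lambda>t. 0"]) simp
qed (simp add: L2_zero)

lemma G_Suc: "f \<in> G n \<Longrightarrow> f \<in> G (Suc n)"
proof (induction n arbitrary: f)
  case 0
  then have "L2_eq T (\<lambda>t. 0) f" "f \<in> L2 T" using L2_eq_sym by auto
  then show ?case using G_cong[OF G_zero[of "Suc 0"]] by blast
next
  case (Suc n)
  then show ?case unfolding G_Suc_iff[of _ "Suc n"] G_Suc_iff[of f n] by blast
qed

text \<open>
  On a function in the kernel of \<open>K\<close> the operator \<open>K - \<mu>\<close> is multiplication by \<open>- \<mu> \<noteq> 0\<close>, so it can be in a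
  generalized eigenspace only if it vanishes.
\<close>
lemma Kop_kernel_trivial: "f \<in> G n \<Longrightarrow> Kop f g \<Longrightarrow> L2_eq T g (\<lambda>t. 0) \<Longrightarrow> L2_eq T f (\<lambda>t. 0)"
proof (induction n arbitrary: f g)
  case (Suc n)
  obtain g' where g': "Kop f g'" "(\<lambda>t. g' t + (1 / l0) *s f t) \<in> G n" using Suc(2) unfolding G_Suc_iff by blast
  have "L2_eq T g' (\<lambda>t. 0)"
    using Kop_unique[OF g'(1) Suc(3)] Suc(4) L2_eq_trans by auto
  from L2_eq_lincomb[OF this L2_eq_refl[of T f], of 1 "1 / l0"]
  have "L2_eq T (\<lambda>t. g' t + (1 / l0) *s f t) (\<lambda>t. (1 / l0) *s f t)"
    by simp
  then have "(\<lambda>t. (1 / l0) *s f t) \<in> G n"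
    using G_cong[OF g'(2)] L2_scale G_L2[OF Suc(2)] by blast
  from G_scale[OF this, of l0] have "f \<in> G n" using l0 by simp
  then show ?case using Suc by blast
qed simp

text \<open>
  \<open>K\<close> maps the generalized eigenspace onto itself, by induction on the exponent: if \<open>(K - \<mu>) f = K h\<close>, then
  \<open>f = K (\<mu>\<inverse> (f - h))\<close>, and \<open>\<mu>\<inverse> = - l0\<close>.
\<close>
lemma Kop_surj: "f \<in> G n \<Longrightarrow> \<exists>h\<in>G n. Kop h f"
proof (induction n arbitrary: f)
  case 0
  then have "L2_eq T f (\<lambda>t. 0)" "f \<in> L2 T" by auto
  then have "Kop (\<lambda>t. 0) f"
    unfolding R1_A_inv_def using SLop_zero by (intro conjI exI[of _ "\<lambda>t. 0"]) simp_all
  then show ?case using G_zero[of 0] by blast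
next
  case (Suc n)
  obtain g where g: "Kop f g" "(\<lambda>t. g t + (1 / l0) *s f t) \<in> G n" using Suc(2) unfolding G_Suc_iff by blast
  obtain h where h: "h \<in> G n" "Kop h (\<lambda>t. g t + (1 / l0) *s f t)" using Suc.IH[OF g(2)] by blast
  have "Kop (\<lambda>t. (- l0) *s f t + l0 *s h t) (\<lambda>t. (- l0) *s g t + l0 *s (g t + (1 / l0) *s f t))"
    by (rule Kop_lincomb[OF g(1) h(2)])
  moreover have "(\<lambda>t. (- l0) *s g t + l0 *s (g t + (1 / l0) *s f t)) = f"
    using l0 by (simp add: fun_eq_iff vec_eq_iff algebra_simps)
  moreover have "(\<lambda>t. (- l0) *s f t + l0 *s h t) \<in> G (Suc n)"
    by (intro G_lincomb Suc(2) G_Suc h(1))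
  ultimately show ?case by metis
qed

section \<open>Chains of solutions\<close>

text \<open>
  A chain of length \<open>n\<close> consists of the solutions of the systems obtained by differentiating the boundary value problem
  in the spectral parameter at \<open>l0\<close>.  Members are counted from the coefficient of \<open>\<epsilon>\<^sup>-\<^sup>1\<close>: the member \<open>i\<close> is the
  coefficient of \<open>\<epsilon>\<^bsup>-1-i\<^esup>\<close>, and is driven by the member \<open>i + 1\<close>.  With this order chains of any length
  can be treated uniformly as sequences that are eventually zero.
\<close>
definition chain :: "(nat \<Rightarrow> real \<Rightarrow> complex^('n+'n)) \<Rightarrow> nat \<Rightarrow> bool" where
  "chain z n \<longleftrightarrow> (\<forall>i\<ge>n. \<forall>t\<in>{0..T}. z i t = 0) \<and>
    (\<forall>i. \<forall>t\<in>{0..T}. has_deriv (z i) (A l0 t *v z i t + H t *v z (Suc i) t) t) \<and>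
    (\<forall>i. z i 0 \<in> C0 \<and> z i T \<in> C1)"

text \<open>
  The functions \<open>\<phi>\<^sub>i = A y\<^sub>i\<close>, written without derivatives of \<open>y\<^sub>i\<close> by means of the equation of the chain.
\<close>
definition phi :: "(nat \<Rightarrow> real \<Rightarrow> complex^('n+'n)) \<Rightarrow> nat \<Rightarrow> real \<Rightarrow> complex^'n" where
  "phi z i t = - (l0 *s (cmat (R1 t) *v lower (z i t))) - cmat (R1 t) *v lower (z (Suc i) t)"

lemma chain_rhs:
  "A l0 t *v z i t + H t *v z (Suc i) t = A 0 t *v z i t + vjoin (- phi z i t) 0"
  using A_add[of 0 l0 t]
  by (simp add: matrix_vector_mult_add_rdistrib matrix_vector_mul_assoc[symmetric] H_mult mat_mult_vec
      phi_def vjoin_scale vjoin_add add.commute)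

lemma chain_deriv:
  assumes "chain z n" "t \<in> {0..T}"
  shows "has_deriv (z i) (A 0 t *v z i t + vjoin (- phi z i t) 0) t"
  using assms unfolding chain_def chain_rhs[symmetric] by blast

lemma continuous_on_lower:
  "continuous_on S f \<Longrightarrow> continuous_on S (\<lambda>t. lower (f t))" for f :: "real \<Rightarrow> complex^('n+'n)"
  by (rule bounded_linear.continuous_on[OF bounded_linear_upper_lower(2)])

lemma chain_continuous: "chain z n \<Longrightarrow> continuous_on {0..T} (z i)"
  unfolding continuous_on_eq_continuous_within
  using chain_deriv has_vector_derivative_continuous by blast

lemma phi_continuous: "chain z n \<Longrightarrow> continuous_on {0..T} (phi z i)"
  unfolding phi_def by (intro continuous_intros cont continuous_on_lower chain_continuous)

lemma chain_SLop: "chain z n \<Longrightarrow> SLop (\<lambda>t. lower (z i t)) (phi z i)"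
  by (rule solution_SLop[OF chain_deriv phi_continuous]) (auto simp: chain_def)

lemma chain_Kop: "chain z n \<Longrightarrow> Kop (phi z i) (\<lambda>t. cmat (R1 t) *v lower (z i t))"
  unfolding R1_A_inv_def
  by (intro conjI exI[of _ "\<lambda>t. lower (z i t)"] chain_SLop L2_eq_refl L2_continuous continuous_intros cont
      continuous_on_lower chain_continuous)

lemma chain_shift: "chain z (Suc n) \<Longrightarrow> chain (\<lambda>i. z (Suc i)) n"
  unfolding chain_def by auto

lemma phi_shift: "phi (\<lambda>i. z (Suc i)) i = phi z (Suc i)"
  by (simp add: phi_def fun_eq_iff)

text \<open>
  From \<open>K \<phi>\<^sub>i = R\<^sub>1 y\<^sub>i\<close> and \<open>\<phi>\<^sub>i = - l0 R\<^sub>1 y\<^sub>i - R\<^sub>1 y\<^bsub>i+1\<^esub>\<close> one gets \<open>(K - \<mu>) \<phi>\<^sub>0 = \<mu> R\<^sub>1 y\<^sub>1\<close> and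
  \<open>R\<^sub>1 y\<^sub>0 = \<mu> (\<phi>\<^sub>0 + R\<^sub>1 y\<^sub>1)\<close>, so both functions have to be carried through the induction.
\<close>
lemma chain_in_G: "chain z n \<Longrightarrow> phi z 0 \<in> G n \<and> (\<lambda>t. cmat (R1 t) *v lower (z 0 t)) \<in> G n"
proof (induction n arbitrary: z)
  case 0
  then have z: "z i t = 0" if "t \<in> {0..T}" for i t using that by (simp add: chain_def)
  have l0: "lower (0 :: complex^('n+'n)) = 0" by (simp add: lower_def vec_eq_iff)
  have "L2_eq T (phi z 0) (\<lambda>t. 0)" "L2_eq T (\<lambda>t. cmat (R1 t) *v lower (z 0 t)) (\<lambda>t. 0)"
    by (intro L2_eqI; simp add: phi_def z l0)+
  then show ?case
    using Kop_L2[OF chain_Kop[OF 0]] by simp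
next
  case (Suc n)
  let ?g = "\<lambda>t. cmat (R1 t) *v lower (z 0 t)" and ?g1 = "\<lambda>t. cmat (R1 t) *v lower (z (Suc 0) t)"
  have g1: "?g1 \<in> G n" using Suc.IH[OF chain_shift[OF Suc(2)]] by simp
  have "(\<lambda>t. ?g t + (1 / l0) *s phi z 0 t) = (\<lambda>t. (- 1 / l0) *s ?g1 t)"
    using l0 by (simp add: fun_eq_iff vec_eq_iff phi_def field_simps)
  then have "(\<lambda>t. ?g t + (1 / l0) *s phi z 0 t) \<in> G n" using G_scale[OF g1] by metis
  then have p: "phi z 0 \<in> G (Suc n)"
    using chain_Kop[OF Suc(2), of 0] unfolding G_Suc_iff by blast
  have "?g = (\<lambda>t. (- 1 / l0) *s phi z 0 t + (- 1 / l0) *s ?g1 t)"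
    using l0 by (simp add: fun_eq_iff vec_eq_iff phi_def field_simps)
  then show ?case using G_lincomb[OF p G_Suc[OF g1], of "- 1 / l0" "- 1 / l0"] p by metis
qed

lemma chain_zero: "chain (\<lambda>i t. 0) 0"
  unfolding chain_def by (simp add: compl_zero has_vector_derivative_const)

text \<open>
  The function \<open>- (1 + l0 K) f\<close> lies in the next smaller space, so it is
  \<open>K h\<close> for some \<open>h\<close> in that space by \<open>Kop_surj\<close>, and \<open>f\<close> can be put in front of a chain that starts with \<open>h\<close>.
\<close>
lemma G_chain: "f \<in> G n \<Longrightarrow> \<exists>z. chain z n \<and> L2_eq T f (phi z 0)"
proof (induction n arbitrary: f)
  case 0
  have "lower (0 :: complex^('n+'n)) = 0" by (simp add: lower_def vec_eq_iff)
  then have "phi (\<lambda>i t. 0) 0 = (\<lambda>t. 0)" by (simp add: phi_def fun_eq_iff)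
  then show ?case using 0 chain_zero by (intro exI[of _ "\<lambda>i t. 0"]) simp
next
  case (Suc n)
  obtain g where g: "Kop f g" "(\<lambda>t. g t + (1 / l0) *s f t) \<in> G n" using Suc(2) unfolding G_Suc_iff by blast
  \<comment> \<open>\<open>f'\<close> is \<open>- (1 + l0 K) f\<close>.\<close>
  define f' where "f' = (\<lambda>t. (- l0) *s (g t + (1 / l0) *s f t))"
  have "f' \<in> G n" unfolding f'_def by (rule G_scale[OF g(2)])
  then obtain h where h: "h \<in> G n" "Kop h f'" using Kop_surj by blast
  obtain z' where z': "chain z' n" "L2_eq T h (phi z' 0)" using Suc.IH[OF h(1)] by blast
  obtain y where y: "SLop y f" "L2_eq T g (\<lambda>t. cmat (R1 t) *v y t)"
    using g(1) unfolding R1_A_inv_def by blast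
  have f'_eq: "L2_eq T f' (\<lambda>t. cmat (R1 t) *v lower (z' 0 t))"
    by (rule Kop_unique[OF h(2) chain_Kop[OF z'(1)] z'(2)])
  let ?p = "\<lambda>t. - (l0 *s (cmat (R1 t) *v y t)) - cmat (R1 t) *v lower (z' 0 t)"
  have cp: "continuous_on {0..T} ?p"
    by (intro continuous_intros cont continuous_on_lower chain_continuous[OF z'(1)] SLop_continuous[OF y(1)])
  have "f = (\<lambda>t. (- l0) *s g t + (-1) *s f' t)"
    using l0 by (simp add: f'_def fun_eq_iff vec_eq_iff field_simps)
  then have fp: "L2_eq T f ?p"
    using L2_eq_lincomb[OF y(2) f'_eq, of "- l0" "-1"] by (simp add: vector_sneg_minus1[symmetric])
  obtain z0 where z0: "\<And>t. t \<in> {0..T} \<Longrightarrow> has_deriv z0 (A 0 t *v z0 t + vjoin (- ?p t) 0) t"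
    "\<And>t. lower (z0 t) = y t" "z0 0 \<in> C0" "z0 T \<in> C1"
    using SLop_solution[OF y(1) fp cp] by blast
  define z where "z = (\<lambda>i. case i of 0 \<Rightarrow> z0 | Suc i \<Rightarrow> z' i)"
  have phi0: "phi z 0 = ?p" by (simp add: phi_def z_def fun_eq_iff z0(2))
  have "chain z (Suc n)"
    unfolding chain_def
  proof (intro conjI allI impI ballI)
    fix i t assume "i \<ge> Suc n" "t \<in> {0..T}"
    then show "z i t = 0" using z'(1) by (auto simp: z_def chain_def split: nat.splits)
  next
    fix i t assume t: "t \<in> {0..T}"
    show "has_deriv (z i) (A l0 t *v z i t + H t *v z (Suc i) t) t"
    proof (cases i)
      case 0
      then show ?thesis unfolding chain_rhs using phi0 z0(1)[OF t] by (simp add: z_def)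
    next
      case (Suc j)
      then show ?thesis using z'(1) t by (simp add: z_def chain_def)
    qed
  next
    fix i show "z i 0 \<in> C0" "z i T \<in> C1"
      using z0(3,4) z'(1) by (auto simp: z_def chain_def split: nat.splits)
  qed
  then show ?case using fp phi0 by auto
qed

text \<open>
  If \<open>\<phi>\<^sub>0 = A y\<^sub>0\<close> vanishes, then \<open>z\<^sub>0 = 0\<close> by nondegeneracy, hence \<open>K \<phi>\<^sub>1 = R\<^sub>1 y\<^sub>1 = - \<phi>\<^sub>0 = 0\<close>, and \<open>\<phi>\<^sub>1\<close> vanishes by
  \<open>Kop_kernel_trivial\<close>; this continues along the chain.
\<close>
lemma chain_trivial:
  "chain z n \<Longrightarrow> L2_eq T (phi z 0) (\<lambda>t. 0) \<Longrightarrow> t \<in> {0..T} \<Longrightarrow> z i t = 0"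
proof (induction n arbitrary: z i t)
  case 0
  then show ?case by (simp add: chain_def)
next
  case (Suc n)
  have y0: "lower (z 0 t) = 0" if "t \<in> {0..T}" for t
    using SLop_injective[OF chain_SLop[OF Suc(2)] Suc(3)] that by blast
  then have z0: "z 0 t = 0" if "t \<in> {0..T}" for t
    using vanishing_lower[OF chain_deriv[OF Suc(2)]] that by blast
  have "L2_eq T (\<lambda>t. cmat (R1 t) *v lower (z (Suc 0) t)) (\<lambda>t. (-1) *s phi z 0 t)"
    by (rule L2_eqI) (simp add: phi_def y0 vector_sneg_minus1[symmetric])
  moreover have "L2_eq T (\<lambda>t. (-1) *s phi z 0 t) (\<lambda>t. 0)"
    using L2_eq_scale[OF Suc(3), of "-1"] by simp
  ultimately have "L2_eq T (\<lambda>t. cmat (R1 t) *v lower (z (Suc 0) t)) (\<lambda>t. 0)" by (rule L2_eq_trans)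
  then have "L2_eq T (phi z (Suc 0)) (\<lambda>t. 0)"
    using Kop_kernel_trivial[OF _ chain_Kop[OF Suc(2)]] chain_in_G[OF chain_shift[OF Suc(2)]]
    unfolding phi_shift by blast
  then have "z (Suc j) t = 0" if "t \<in> {0..T}" for j t
    using Suc.IH[OF chain_shift[OF Suc(2)], of t j] that unfolding phi_shift by blast
  then show ?case using z0 Suc(4) by (cases i) auto
qed

end

end

section \<open>Algebraic multiplicity as order of vanishing\<close>

lemma upper_lower_lin [simp]:
  "upper (0 :: complex^('n::finite+'n)) = 0" "lower (0 :: complex^('n::finite+'n)) = 0"
  "upper (a *s z) = a *s upper z" "lower (a *s z) = a *s lower z"
  "upper (z + w) = upper z + upper w" "lower (z + w) = lower z + lower w" for z w :: "complex^('n::finite+'n)"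
  by (simp_all add: upper_def lower_def vec_eq_iff)

lemma fps_act_const:
  assumes "fin_supp s"
  shows "fps_act (fps_const c) s j = c * s j"
proof -
  obtain k where k: "\<And>i. i \<ge> k \<Longrightarrow> s i = 0" using assms by (auto simp: fin_supp_def)
  have "fps_act (fps_const c) s j = (\<Sum>i<Suc k. fps_nth (fps_const c) i * s (j + i))"
    using k by (intro fps_act_eq_sum) auto
  also have "\<dots> = c * s j" by (subst sum.lessThan_Suc_shift) simp
  finally show ?thesis .
qed

context sturm_liouville_bvp begin

context
  fixes l0 :: complex
  assumes l0: "l0 \<noteq> 0"
begin

text \<open>
  The sequence \<open>q\<close> collects pairs \<open>(u, w)\<close>.  The vectors \<open>Z\<^sub>0 u\<close> are the initial values of the chain, whose members
  follow by multiplying the Taylor series of \<open>\<gamma>\<close> with the principal part; \<open>w\<close> enters only in the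
  condition at \<open>T\<close>.
\<close>
definition chain_of :: "(nat \<Rightarrow> complex^('n+'n)) \<Rightarrow> nat \<Rightarrow> real \<Rightarrow> complex^('n+'n)" where
  "chain_of q i t = (\<Sum>j | q (i + j) \<noteq> 0. gamma_coeff l0 j t *v (cmat Z0 *v upper (q (i + j))))"

lemma chain_of_eq_sum:
  assumes "\<And>i. i \<ge> k \<Longrightarrow> q i = 0"
  shows "chain_of q i t = (\<Sum>j<k. gamma_coeff l0 j t *v (cmat Z0 *v upper (q (i + j))))"
  unfolding chain_of_def
proof (rule sum.mono_neutral_left)
  show "{j. q (i + j) \<noteq> 0} \<subseteq> {..<k}"
    using assms by (metis (mono_tags, lifting) lessThan_iff mem_Collect_eq not_le subsetI trans_le_add2)
qed auto

lemma chain_of_0: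
  assumes "fin_supp q"
  shows "chain_of q i 0 = cmat Z0 *v upper (q i)"
proof -
  obtain k where k: "\<And>i. i \<ge> k \<Longrightarrow> q i = 0" using assms unfolding fin_supp_def by blast
  have "chain_of q i 0 = (\<Sum>j<Suc k. gamma_coeff l0 j 0 *v (cmat Z0 *v upper (q (i + j))))"
    using k by (intro chain_of_eq_sum) simp
  also have "\<dots> = cmat Z0 *v upper (q i)"
    by (subst sum.lessThan_Suc_shift) (simp add: gamma_coeff_initial del: gamma_coeff.simps)
  finally show ?thesis .
qed

lemma chain_of_zero: "(\<And>j. j \<ge> i \<Longrightarrow> q j = 0) \<Longrightarrow> chain_of q i t = 0"
  by (simp add: chain_of_def)

lemma chain_of_deriv:
  assumes q: "fin_supp q" and t: "t \<in> {0..T}"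
  shows "has_deriv (chain_of q i) (A l0 t *v chain_of q i t + H t *v chain_of q (Suc i) t) t"
proof -
  obtain k where k: "\<And>i. i \<ge> k \<Longrightarrow> q i = 0" using q unfolding fin_supp_def by blast
  let ?w = "\<lambda>j. cmat Z0 *v upper (q (i + j))"
  let ?D = "\<lambda>j. A l0 t ** gamma_coeff l0 j t + (case j of 0 \<Rightarrow> 0 | Suc i \<Rightarrow> H t ** gamma_coeff l0 i t)"
  have sum: "chain_of q i = (\<lambda>t. \<Sum>j<Suc k. gamma_coeff l0 j t *v ?w j)"
    using k by (intro ext chain_of_eq_sum) simp
  have "has_deriv (\<lambda>t. gamma_coeff l0 j t *v ?w j) (?D j *v ?w j) t" for j
    by (intro bounded_linear.has_vector_derivative[OF _ gamma_coeff_deriv[OF t]]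
        bounded_bilinear.bounded_linear_left[OF bounded_bilinear_matrix_vector])
  then have d: "has_deriv (chain_of q i) (\<Sum>j<Suc k. ?D j *v ?w j) t"
    unfolding sum by (intro has_vector_derivative_sum)
  have lin: "X *v (\<Sum>j\<in>J. v j) = (\<Sum>j\<in>J. X *v v j)" for X :: "complex ^ ('n+'n) ^ ('n+'n)" and J :: "nat set" and v
    using linear_sum[OF bounded_linear.linear[OF
        bounded_bilinear.bounded_linear_right[OF bounded_bilinear_matrix_vector]], of X v J] .
  have "(\<Sum>j<Suc k. ?D j *v ?w j) = A l0 t *v chain_of q i t
      + (\<Sum>j<Suc k. (case j of 0 \<Rightarrow> 0 | Suc i \<Rightarrow> H t ** gamma_coeff l0 i t) *v ?w j)"
    unfolding sum lin by (simp only: matrix_vector_mult_add_rdistrib sum.distrib matrix_vector_mul_assoc[symmetric])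
  also have "(\<Sum>j<Suc k. (case j of 0 \<Rightarrow> 0 | Suc i \<Rightarrow> H t ** gamma_coeff l0 i t) *v ?w j) =
      (\<Sum>j<k. H t *v (gamma_coeff l0 j t *v (cmat Z0 *v upper (q (Suc i + j)))))"
    by (subst sum.lessThan_Suc_shift) (simp add: matrix_vector_mul_assoc[symmetric])
  also have "\<dots> = H t *v chain_of q (Suc i) t"
    using chain_of_eq_sum[of k q "Suc i" t, OF k] by (simp only: lin)
  finally show ?thesis using d by simp
qed

text \<open>
  Membership in the kernel of the Taylor series of \<open>(\<gamma> Z\<^sub>0, Z\<^sub>1)\<close> is the boundary condition at \<open>T\<close>.
\<close>
lemma shift_kernel_iff_boundary:
  assumes q: "fin_supp q"
  shows "q \<in> shift_kernel (boundary_fps l0) \<longleftrightarrow> (\<forall>i. chain_of q i T + cmat Z1 *v lower (q i) = 0)"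
proof -
  obtain k where k: "\<And>i. i \<ge> k \<Longrightarrow> q i = 0" using q unfolding fin_supp_def by blast
  have "(\<Sum>c\<in>UNIV. fps_act (boundary_fps l0 $ r $ c) (\<lambda>n. q n $ c) j) = (chain_of q j T + cmat Z1 *v lower (q j)) $ r" for j r
  proof -
    have "fps_act (boundary_fps l0 $ r $ Inl m) (\<lambda>n. q n $ Inl m) j =
        (\<Sum>i<k. (gamma_coeff l0 i T ** cmat Z0) $ r $ m * q (j + i) $ Inl m)" for m
      using k by (subst fps_act_eq_sum[of k])
        (simp_all add: boundary_fps_def fps_sum_nth matrix_matrix_mult_def)
    then have "(\<Sum>m\<in>UNIV. fps_act (boundary_fps l0 $ r $ Inl m) (\<lambda>n. q n $ Inl m) j) =
        (\<Sum>i<k. \<Sum>m\<in>UNIV. (gamma_coeff l0 i T ** cmat Z0) $ r $ m * q (j + i) $ Inl m)"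
      by (subst sum.swap) simp
    also have "\<dots> = chain_of q j T $ r"
    proof -
      have "chain_of q j T = (\<Sum>i<k. (gamma_coeff l0 i T ** cmat Z0) *v upper (q (j + i)))"
        using chain_of_eq_sum[of k q j T, OF k] by (simp only: matrix_vector_mul_assoc)
      then show ?thesis by (simp add: matrix_vector_mult_def upper_def)
    qed
    finally have 1: "(\<Sum>m\<in>UNIV. fps_act (boundary_fps l0 $ r $ Inl m) (\<lambda>n. q n $ Inl m) j) = chain_of q j T $ r" .
    have "(\<Sum>m\<in>UNIV. fps_act (boundary_fps l0 $ r $ Inr m) (\<lambda>n. q n $ Inr m) j) = (cmat Z1 *v lower (q j)) $ r"
      by (simp add: boundary_fps_def fps_act_const fin_supp_component[OF q] matrix_vector_mult_def lower_def)
    then show ?thesis using 1 by (simp add: sum_UNIV_Plus)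
  qed
  then show ?thesis using q by (auto simp: shift_kernel_def vec_eq_iff)
qed

lemma kernel_chain:
  assumes "q \<in> shift_kernel (boundary_fps l0)"
  shows "\<exists>n. chain l0 (chain_of q) n"
proof -
  have q: "fin_supp q" using assms by (simp add: shift_kernel_def)
  then obtain k where k: "\<And>i. i \<ge> k \<Longrightarrow> q i = 0" unfolding fin_supp_def by blast
  have "chain_of q i T = cmat Z1 *v (- lower (q i))" for i
    using assms unfolding shift_kernel_iff_boundary[OF q] by (simp add: matrix_vector_mult_minus eq_neg_iff_add_eq_0)
  then have "chain l0 (chain_of q) k"
    unfolding chain_def[OF l0] compl0 compl1
    using k chain_of_deriv[OF q] by (auto simp: chain_of_0[OF q] intro!: chain_of_zero)
  then show ?thesis by blast
qed

text \<open>
  Backwards from the members that agree by assumption: once the member \<open>i + 1\<close> is known, the equation for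
  the member \<open>i\<close> has a given inhomogeneity.
\<close>
lemma chain_unique:
  assumes z: "\<And>i t. t \<in> {0..T} \<Longrightarrow> has_deriv (z i) (A l0 t *v z i t + H t *v z (Suc i) t) t"
    and w: "\<And>i t. t \<in> {0..T} \<Longrightarrow> has_deriv (w i) (A l0 t *v w i t + H t *v w (Suc i) t) t"
    and vanish: "\<And>i t. i \<ge> k \<Longrightarrow> t \<in> {0..T} \<Longrightarrow> z i t = w i t" and init: "\<And>i. z i 0 = w i 0"
    and t: "t \<in> {0..T}"
  shows "z i t = w i t"
proof -
  have "\<forall>i t. k \<le> i + n \<longrightarrow> t \<in> {0..T} \<longrightarrow> z i t = w i t" for n
  proof (induction n)
    case (Suc n)
    show ?case
    proof (intro allI impI)
      fix i t assume i: "k \<le> i + Suc n" and t: "t \<in> {0..T}"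
      have eq: "w (Suc i) s = z (Suc i) s" if "s \<in> {0..T}" for s using Suc i that by simp
      have "has_deriv (w i) (A l0 s *v w i s + H s *v z (Suc i) s) s" if "s \<in> {0..T}" for s
        using w[OF that, of i] unfolding eq[OF that] .
      then show "z i t = w i t"
        using solution_unique[of "z i" l0 "\<lambda>s. H s *v z (Suc i) s" "w i" t] z init t by blast
    qed
  qed (use vanish in auto)
  from this[of k] show ?thesis using t by simp
qed

lemma chain_kernel:
  assumes z: "chain l0 z n"
  shows "\<exists>q\<in>shift_kernel (boundary_fps l0). \<forall>i. \<forall>t\<in>{0..T}. z i t = chain_of q i t"
proof -
  have "\<forall>i. \<exists>u. z i 0 = cmat Z0 *v u" "\<forall>i. \<exists>w. z i T = cmat Z1 *v w"
    using z unfolding chain_def[OF l0] compl0 compl1 by blast+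
  then obtain u w where u: "\<And>i. z i 0 = cmat Z0 *v u i" and w: "\<And>i. z i T = cmat Z1 *v w i" by metis
  define q where "q = (\<lambda>i. vjoin (u i) (- w i))"
  have zero: "z i t = 0" if "i \<ge> n" "t \<in> {0..T}" for i t using z that by (simp add: chain_def[OF l0])
  have q0: "q i = 0" if "i \<ge> n" for i
  proof -
    have "u i = 0" using zero[OF that zero_T_in(1)] u[of i] by (intro frame0_inj) simp
    moreover have "w i = 0" using zero[OF that zero_T_in(2)] w[of i] by (intro frame1_inj) simp
    ultimately show ?thesis by (simp add: q_def vjoin_zero)
  qed
  then have q: "fin_supp q" unfolding fin_supp_def by blast
  have eq: "z i t = chain_of q i t" if "t \<in> {0..T}" for i t
  proof (rule chain_unique[of z "chain_of q" n])
    show "has_deriv (z i) (A l0 t *v z i t + H t *v z (Suc i) t) t"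
      if "t \<in> {0..T}" for i t using z that by (simp add: chain_def[OF l0])
    show "z i t = chain_of q i t" if "i \<ge> n" "t \<in> {0..T}" for i t
      using zero that q0 by (simp add: chain_of_zero)
    show "z i 0 = chain_of q i 0" for i unfolding chain_of_0[OF q] by (simp add: u q_def)
  qed (use chain_of_deriv[OF q] that in auto)
  have "q \<in> shift_kernel (boundary_fps l0)"
    unfolding shift_kernel_iff_boundary[OF q] using eq[OF zero_T_in(2)] w by (simp add: q_def matrix_vector_mult_minus)
  then show ?thesis using eq by blast
qed

lemma chain_of_lincomb:
  assumes q: "fin_supp q" and p: "fin_supp p"
  shows "fin_supp (\<lambda>n. a *s q n + b *s p n)"
    and "chain_of (\<lambda>n. a *s q n + b *s p n) i t = a *s chain_of q i t + b *s chain_of p i t"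
proof -
  obtain k where k: "\<And>i. i \<ge> k \<Longrightarrow> q i = 0" using q unfolding fin_supp_def by blast
  obtain k' where k': "\<And>i. i \<ge> k' \<Longrightarrow> p i = 0" using p unfolding fin_supp_def by blast
  let ?m = "max k k'"
  have z: "i \<ge> ?m \<Longrightarrow> q i = 0" "i \<ge> ?m \<Longrightarrow> p i = 0" "i \<ge> ?m \<Longrightarrow> a *s q i + b *s p i = 0" for i
    using k k' by auto
  then show "fin_supp (\<lambda>n. a *s q n + b *s p n)" unfolding fin_supp_def by blast
  have "X *v (Y *v (a *s u + b *s v)) = a *s (X *v (Y *v u)) + b *s (X *v (Y *v v))"
    for X :: "complex ^ ('n+'n) ^ ('n+'n)" and Y :: "complex^'n ^ ('n+'n)" and u v
    by (simp add: matrix_vector_right_distrib vector_scalar_commute)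
  then show "chain_of (\<lambda>n. a *s q n + b *s p n) i t = a *s chain_of q i t + b *s chain_of p i t"
    using chain_of_eq_sum[of ?m q, OF z(1)] chain_of_eq_sum[of ?m p, OF z(2)]
      chain_of_eq_sum[of ?m "\<lambda>n. a *s q n + b *s p n", OF z(3)]
    by (simp add: sum.distrib vec.scale_sum_right)
qed

lemma kernel_lincomb:
  assumes q: "q \<in> shift_kernel (boundary_fps l0)" and p: "p \<in> shift_kernel (boundary_fps l0)"
  shows "(\<lambda>n. a *s q n + b *s p n) \<in> shift_kernel (boundary_fps l0)"
proof -
  have f: "fin_supp q" "fin_supp p" using q p by (auto simp: shift_kernel_def)
  have "chain_of q i T = - (cmat Z1 *v lower (q i))" "chain_of p i T = - (cmat Z1 *v lower (p i))" for i
    using q p unfolding shift_kernel_iff_boundary[OF f(1)] shift_kernel_iff_boundary[OF f(2)] by (simp_all add: eq_neg_iff_add_eq_0)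
  then show ?thesis
    unfolding shift_kernel_iff_boundary[OF chain_of_lincomb(1)[OF f]] chain_of_lincomb(2)[OF f]
    by (simp add: matrix_vector_right_distrib vector_scalar_commute vec_eq_iff)
qed

text \<open>
  The function of the generalized eigenspace that belongs to a principal part in the kernel.
\<close>
definition Phi :: "(nat \<Rightarrow> complex^('n+'n)) \<Rightarrow> real \<Rightarrow> complex^'n" where
  "Phi q = phi l0 (chain_of q) 0"

lemma Phi_lincomb:
  assumes "fin_supp q" "fin_supp p"
  shows "Phi (\<lambda>n. a *s q n + b *s p n) t = a *s Phi q t + b *s Phi p t"
  unfolding Phi_def phi_def[OF l0] chain_of_lincomb(2)[OF assms]
  by (simp add: matrix_vector_right_distrib vector_scalar_commute vec_eq_iff algebra_simps)

lemma kernel_zero: "(\<lambda>n. 0) \<in> shift_kernel (boundary_fps l0)"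
  by (auto simp: shift_kernel_def fin_supp_def fps_act_def)

lemma Phi_sum:
  fixes m :: nat
  assumes "\<And>i. i < m \<Longrightarrow> b i \<in> shift_kernel (boundary_fps l0)"
  shows "(\<lambda>n. \<Sum>i<m. c i *s b i n) \<in> shift_kernel (boundary_fps l0) \<and>
    Phi (\<lambda>n. \<Sum>i<m. c i *s b i n) t = (\<Sum>i<m. c i *s Phi (b i) t)"
  using assms
proof (induction m)
  case 0
  show ?case using kernel_zero by (simp add: Phi_def phi_def[OF l0] chain_of_zero)
next
  case (Suc m)
  let ?s = "\<lambda>n. \<Sum>i<m. c i *s b i n"
  have s: "?s \<in> shift_kernel (boundary_fps l0)" "Phi ?s t = (\<Sum>i<m. c i *s Phi (b i) t)" and b: "b m \<in> shift_kernel (boundary_fps l0)"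
    using Suc by auto
  have eq: "(\<lambda>n. \<Sum>i<Suc m. c i *s b i n) = (\<lambda>n. 1 *s ?s n + c m *s b m n)" by simp
  show ?case
    unfolding eq using kernel_lincomb[OF s(1) b, of 1 "c m"] s b Phi_lincomb[of ?s "b m" 1 "c m" t]
    by (simp add: shift_kernel_def)
qed

lemma Phi_in_G:
  assumes "q \<in> shift_kernel (boundary_fps l0)"
  shows "\<exists>n. Phi q \<in> G l0 n"
  using kernel_chain[OF assms] chain_in_G[OF l0] unfolding Phi_def by blast

lemma Phi_inj:
  assumes q: "q \<in> shift_kernel (boundary_fps l0)" and "L2_eq T (Phi q) (\<lambda>t. 0)"
  shows "q = (\<lambda>n. 0)"
proof
  fix i
  have f: "fin_supp q" using q by (simp add: shift_kernel_def)
  obtain n where "chain l0 (chain_of q) n" using kernel_chain[OF q] by blast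
  then have z: "chain_of q i t = 0" if "t \<in> {0..T}" for t
    using chain_trivial[OF l0 _ assms(2)[unfolded Phi_def] that] by blast
  have "upper (q i) = 0" using z[OF zero_T_in(1)] by (intro frame0_inj) (simp add: chain_of_0[OF f])
  moreover have "lower (q i) = 0"
    using q z[OF zero_T_in(2)] unfolding shift_kernel_iff_boundary[OF f] by (intro frame1_inj) (metis add_0)
  ultimately have "vjoin (upper (q i)) (lower (q i)) = vjoin 0 0" by simp
  then show "q i = 0" by (simp add: vjoin_zero)
qed

text \<open>
  \<open>Phi\<close> is a linear bijection, modulo equality almost everywhere, from the kernel of the boundary series onto the generalized eigenspace.
  It carries the basis of \<open>shift_kernel_basis\<close> to a basis.
\<close>
theorem alg_multiplicity:
  "has_alg_multiplicity T Kop (- 1 / l0) (subdegree (det (boundary_fps l0)))"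
proof -
  let ?m = "subdegree (det (boundary_fps l0))" and ?S = "shift_kernel (boundary_fps l0)"
  obtain b where b: "seq_basis ?S ?m b" using shift_kernel_basis[OF zorder_D(1)] by blast
  have bS: "\<And>i. i < ?m \<Longrightarrow> b i \<in> ?S" using b by (simp add: seq_basis_def)
  have coord: "\<And>q. q \<in> ?S \<Longrightarrow> \<exists>!c. (\<forall>i\<ge>?m. c i = 0) \<and> q = (\<lambda>n. \<Sum>i<?m. c i *s b i n)"
    using b by (simp add: seq_basis_def)
  have unique0: "c i = 0" if "\<forall>i\<ge>?m. c i = 0" "L2_eq T (\<lambda>t. \<Sum>i<?m. c i *s Phi (b i) t) (\<lambda>t. 0)" for c i
  proof -
    let ?q = "\<lambda>n. \<Sum>i<?m. c i *s b i n"
    have "?q \<in> ?S" "Phi ?q = (\<lambda>t. \<Sum>i<?m. c i *s Phi (b i) t)"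
      using Phi_sum[of ?m b, OF bS] by auto
    then have "?q = (\<lambda>n. 0)" using Phi_inj[of ?q] that(2) by simp
    then have c0: "(\<lambda>n. 0) = (\<lambda>n. \<Sum>i<?m. c i *s b i n)" by simp
    obtain d where d: "\<And>c. \<forall>i\<ge>?m. c i = 0 \<Longrightarrow> (\<lambda>n. 0) = (\<lambda>n. \<Sum>i<?m. c i *s b i n) \<Longrightarrow> c = d"
      using coord[OF kernel_zero] by (elim ex1E) blast
    have "c = d" using that(1) c0 by (rule d)
    also have "d = (\<lambda>_. 0)" by (rule d[symmetric]) simp_all
    finally show ?thesis by simp
  qed
  show ?thesis
    unfolding has_alg_multiplicity_def L2_has_dim_def
  proof (intro exI[of _ "\<lambda>i. Phi (b i)"] conjI allI impI ballI)
    show "Phi (b i) \<in> (\<Union>k. G l0 k)" if "i < ?m" for i using Phi_in_G[OF bS[OF that]] by blast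
  next
    fix g assume "g \<in> (\<Union>k. G l0 k)"
    then obtain n where "g \<in> G l0 n" by blast
    then obtain z where z: "chain l0 z n" "L2_eq T g (phi l0 z 0)" using G_chain[OF l0] by blast
    obtain q where q: "q \<in> ?S" "\<And>i t. t \<in> {0..T} \<Longrightarrow> z i t = chain_of q i t" using chain_kernel[OF z(1)] by blast
    have "L2_eq T (phi l0 z 0) (Phi q)"
      unfolding Phi_def by (intro L2_eqI) (simp add: phi_def[OF l0] q(2))
    with z(2) have gq: "L2_eq T g (Phi q)" by (rule L2_eq_trans)
    obtain c where c: "\<forall>i\<ge>?m. c i = 0" "q = (\<lambda>n. \<Sum>i<?m. c i *s b i n)" using coord[OF q(1)] by blast
    have "Phi q = (\<lambda>t. \<Sum>i<?m. c i *s Phi (b i) t)"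
      unfolding c(2) using Phi_sum[of ?m b, OF bS] by auto
    then have gc: "L2_eq T g (\<lambda>t. \<Sum>i<?m. c i *s Phi (b i) t)" using gq by simp
    show "\<exists>!c. (\<forall>i\<ge>?m. c i = 0) \<and> L2_eq T g (\<lambda>t. \<Sum>i<?m. c i *s Phi (b i) t)"
    proof (rule ex1I[of _ c])
      fix d assume d: "(\<forall>i\<ge>?m. d i = 0) \<and> L2_eq T g (\<lambda>t. \<Sum>i<?m. d i *s Phi (b i) t)"
      have "L2_eq T (\<lambda>t. \<Sum>i<?m. d i *s Phi (b i) t) (\<lambda>t. \<Sum>i<?m. c i *s Phi (b i) t)"
        using d gc L2_eq_trans L2_eq_sym by blast
      from L2_eq_lincomb[OF this L2_eq_refl[of T "\<lambda>t. \<Sum>i<?m. c i *s Phi (b i) t"], of 1 "-1"]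
      have "L2_eq T (\<lambda>t. \<Sum>i<?m. (d i - c i) *s Phi (b i) t) (\<lambda>t. 0)"
        by (simp add: vector_sneg_minus1[symmetric] vector_sub_rdistrib sum_subtractf)
      then have "d i - c i = 0" for i using unique0[of "\<lambda>i. d i - c i" i] c(1) d by simp
      then show "d = c" by (simp add: fun_eq_iff)
    qed (use c gc in blast)
  qed
qed

end

end

section \<open>Eigenvalue lists and the product\<close>

lemma underdetermined_system:
  fixes a :: "'i \<Rightarrow> nat \<Rightarrow> 'a::field"
  assumes "finite I" "d < card I"
  shows "\<exists>c. (\<exists>i\<in>I. c i \<noteq> 0) \<and> (\<forall>i. i \<notin> I \<longrightarrow> c i = 0) \<and> (\<forall>j<d. (\<Sum>i\<in>I. c i * a i j) = 0)"
  using assms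
proof (induction d arbitrary: I a)
  case 0
  then obtain p where "p \<in> I" by (metis card_gt_0_iff ex_in_conv)
  then show ?case by (intro exI[of _ "\<lambda>i. if i = p then 1 else 0"]) auto
next
  case (Suc d)
  show ?case
  proof (cases "\<forall>i\<in>I. a i d = 0")
    case True
    obtain c where c: "\<exists>i\<in>I. c i \<noteq> 0" "\<forall>i. i \<notin> I \<longrightarrow> c i = 0" "\<forall>j<d. (\<Sum>i\<in>I. c i * a i j) = 0"
      using Suc.IH[of I a] Suc.prems by auto
    have "(\<Sum>i\<in>I. c i * a i j) = 0" if "j < Suc d" for j
      using c(3) True that by (cases "j = d") auto
    then show ?thesis using c(1,2) by blast
  next
    case False
    then obtain p where p: "p \<in> I" "a p d \<noteq> 0" by blast
    have "finite (I - {p})" "d < card (I - {p})" using Suc.prems p(1) by auto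
    from Suc.IH[OF this, of "\<lambda>i j. a i j - a i d / a p d * a p j"]
    obtain c where c: "\<exists>i\<in>I - {p}. c i \<noteq> 0" "\<forall>i. i \<notin> I - {p} \<longrightarrow> c i = 0"
        "\<forall>j<d. (\<Sum>i\<in>I - {p}. c i * (a i j - a i d / a p d * a p j)) = 0" by blast
    define c' where "c' = c(p := - (\<Sum>i\<in>I - {p}. c i * a i d) / a p d)"
    have split: "(\<Sum>i\<in>I. c' i * a i j) = (\<Sum>i\<in>I - {p}. c i * a i j) - (\<Sum>i\<in>I - {p}. c i * a i d) / a p d * a p j" for j
    proof -
      have "(\<Sum>i\<in>I - {p}. c' i * a i j) = (\<Sum>i\<in>I - {p}. c i * a i j)"
        by (intro sum.cong) (auto simp: c'_def)
      then show ?thesis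
        using p Suc.prems(1) by (subst sum.remove[of _ p]) (auto simp: c'_def)
    qed
    have "(\<Sum>i\<in>I. c' i * a i j) = 0" if j: "j < Suc d" for j
    proof (cases "j = d")
      case True
      then show ?thesis using p(2) by (simp add: split)
    next
      case False
      have "(\<Sum>i\<in>I - {p}. c i * (a i j - a i d / a p d * a p j)) =
          (\<Sum>i\<in>I - {p}. c i * a i j) - (\<Sum>i\<in>I - {p}. c i * a i d) / a p d * a p j"
        by (simp add: right_diff_distrib sum_subtractf sum_distrib_right sum_divide_distrib mult.assoc)
      then show ?thesis using c(3) False j by (simp add: split)
    qed
    moreover have "\<exists>i\<in>I. c' i \<noteq> 0" using c(1) by (auto simp: c'_def)
    moreover have "\<forall>i. i \<notin> I \<longrightarrow> c' i = 0" using c(2) p(1) by (auto simp: c'_def)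
    ultimately show ?thesis by blast
  qed
qed

lemma L2_eq_sum:
  assumes "finite I" "\<And>i. i \<in> I \<Longrightarrow> L2_eq T (f i) (g i)"
  shows "L2_eq T (\<lambda>t. \<Sum>i\<in>I. f i t) (\<lambda>t. \<Sum>i\<in>I. g i t)"
  using assms
proof (induction I rule: finite_induct)
  case (insert i I)
  then show ?case using L2_eq_lincomb[of T "f i" "g i" "\<lambda>t. \<Sum>i\<in>I. f i t" "\<lambda>t. \<Sum>i\<in>I. g i t" 1 1] by simp
qed simp

text \<open>
  If \<open>d < d'\<close>, the \<open>d'\<close> basis functions expressed in a basis of length \<open>d\<close> satisfy a nontrivial linear relation \<open>c\<close>; adding \<open>c\<close> to
  the coordinates \<open>e\<close> of the first basis function gives a second representation of it.
\<close>
lemma L2_has_dim_le: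
  assumes "L2_has_dim T G d" "L2_has_dim T G d'"
  shows "d' \<le> d"
proof (rule ccontr)
  assume "\<not> d' \<le> d"
  then have dd: "d < d'" by simp
  obtain b where b0: "(\<forall>i<d. b i \<in> G) \<and>
      (\<forall>g\<in>G. \<exists>!c :: nat \<Rightarrow> complex. (\<forall>i\<ge>d. c i = 0) \<and> L2_eq T g (\<lambda>t. \<Sum>i<d. c i *s b i t))"
    using assms(1) unfolding L2_has_dim_def by (elim exE)
  note b = b0[THEN conjunct2, rule_format]
  obtain b' where b0': "(\<forall>i<d'. b' i \<in> G) \<and>
      (\<forall>g\<in>G. \<exists>!c :: nat \<Rightarrow> complex. (\<forall>i\<ge>d'. c i = 0) \<and> L2_eq T g (\<lambda>t. \<Sum>i<d'. c i *s b' i t))"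
    using assms(2) unfolding L2_has_dim_def by (elim exE)
  note b' = b0'[THEN conjunct1, rule_format] b0'[THEN conjunct2, rule_format]
  have "\<exists>a. L2_eq T (b' i) (\<lambda>t. \<Sum>j<d. a j *s b j t)" if "i < d'" for i
    using b[OF b'(1)[OF that]] by (elim ex1E) blast
  then obtain a where a: "\<And>i. i < d' \<Longrightarrow> L2_eq T (b' i) (\<lambda>t. \<Sum>j<d. a i j *s b j t)" by metis
  obtain c where c: "\<exists>i\<in>{..<d'}. c i \<noteq> 0" "\<forall>i. i \<notin> {..<d'} \<longrightarrow> c i = 0"
      "\<forall>j<d. (\<Sum>i<d'. c i * a i j) = 0"
    using underdetermined_system[of "{..<d'}" d a] dd by auto
  have "L2_eq T (\<lambda>t. \<Sum>i<d'. c i *s b' i t) (\<lambda>t. \<Sum>i<d'. c i *s (\<Sum>j<d. a i j *s b j t))"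
    by (intro L2_eq_sum L2_eq_scale a) auto
  also have "(\<lambda>t. \<Sum>i<d'. c i *s (\<Sum>j<d. a i j *s b j t)) = (\<lambda>t. \<Sum>j<d. (\<Sum>i<d'. c i * a i j) *s b j t)"
    unfolding vec.scale_sum_left vec.scale_sum_right by (subst sum.swap) simp
  also have "\<dots> = (\<lambda>t. 0)" using c(3) by simp
  finally have zero: "L2_eq T (\<lambda>t. \<Sum>i<d'. c i *s b' i t) (\<lambda>t. 0)" .
  define e :: "nat \<Rightarrow> complex" where "e = (\<lambda>i. if i = 0 then 1 else 0)"
  have e_sum: "(\<Sum>i<d'. e i *s b' i t) = b' 0 t" for t
  proof -
    have "(\<Sum>i<d'. e i *s b' i t) = (\<Sum>i<d'. if i = 0 then b' 0 t else 0)"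
      by (intro sum.cong) (auto simp: e_def)
    then show ?thesis using dd by simp
  qed
  have e: "(\<forall>i\<ge>d'. e i = 0) \<and> L2_eq T (b' 0) (\<lambda>t. \<Sum>i<d'. e i *s b' i t)"
    using dd by (auto simp: e_def e_sum[unfolded e_def])
  have "L2_eq T (\<lambda>t. b' 0 t) (\<lambda>t. 1 *s b' 0 t + 1 *s (\<Sum>i<d'. c i *s b' i t))"
    using L2_eq_lincomb[OF L2_eq_refl[of T "b' 0"] L2_eq_sym[OF zero], of 1 1] by simp
  also have "(\<lambda>t. 1 *s b' 0 t + 1 *s (\<Sum>i<d'. c i *s b' i t)) = (\<lambda>t. \<Sum>i<d'. (e i + c i) *s b' i t)"
    by (simp add: vector_sadd_rdistrib sum.distrib e_sum)
  finally have ec: "(\<forall>i\<ge>d'. e i + c i = 0) \<and> L2_eq T (b' 0) (\<lambda>t. \<Sum>i<d'. (e i + c i) *s b' i t)"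
    using c(2) e by simp
  have "b' 0 \<in> G" using b'(1) dd by simp
  from b'(2)[OF this] obtain x where x: "\<And>k. (\<forall>i\<ge>d'. k i = 0) \<and> L2_eq T (b' 0) (\<lambda>t. \<Sum>i<d'. k i *s b' i t) \<Longrightarrow> k = x"
    by (elim ex1E) blast
  have "e = (\<lambda>i. e i + c i)" using x[OF e] x[OF ec] by simp
  then have "c i = 0" for i by (metis add_cancel_left_right)
  then show False using c(1) by blast
qed

lemma has_alg_multiplicity_unique:
  "has_alg_multiplicity T K \<mu> m \<Longrightarrow> has_alg_multiplicity T K \<mu> m' \<Longrightarrow> m = m'"
  unfolding has_alg_multiplicity_def by (meson L2_has_dim_le le_antisym)

context sturm_liouville_bvp begin

lemma eigenvalue_list_iff:
  "eigenvalue_list T P Q R R1 L0 L1 I l \<longleftrightarrow> (\<forall>j\<in>I. D (l j) = 0) \<and>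
    (\<forall>a. D a = 0 \<longrightarrow> finite {j\<in>I. l j = a} \<and> int (card {j\<in>I. l j = a}) = zorder D a)"
proof -
  have "has_alg_multiplicity T Kop (- 1 / a) m \<longleftrightarrow> int m = zorder D a" if "D a = 0" for a m
  proof -
    have "a \<noteq> 0" using that D_0 by auto
    then have *: "has_alg_multiplicity T Kop (- 1 / a) (subdegree (det (boundary_fps a)))"
      by (rule alg_multiplicity)
    show ?thesis
      unfolding zorder_D(2) using * has_alg_multiplicity_unique by (metis of_nat_eq_iff)
  qed
  then show ?thesis
    unfolding eigenvalue_list_def SL_eigenvalue_iff_D by blast
qed

text \<open>
  The pairs \<open>(a, i)\<close> of a zero \<open>a\<close> of \<open>D\<close> and a number \<open>i\<close> below its order form a countable set, and a numbering of this set lists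
  the eigenvalues.
\<close>
lemma eigenvalue_list_exists: "\<exists>I l. eigenvalue_list T P Q R R1 L0 L1 I l"
proof -
  have "countable {a. D a = 0}"
  proof (cases "D constant_on UNIV")
    case True
    then have "{a. D a = 0} = {}" using D_0 by (auto simp: constant_on_def)
    then show ?thesis by simp
  next
    case False
    then show ?thesis
      using holomorphic_countable_zeros[OF D_entire open_UNIV connected_UNIV fsigma_UNIV] by simp
  qed
  define W where "W = (SIGMA a:{a. D a = 0}. {..<nat (zorder D a)})"
  have W: "countable W" unfolding W_def by (intro countable_SIGMA \<open>countable {a. D a = 0}\<close>) simp
  define I where "I = to_nat_on W ` W"
  define l where "l = (\<lambda>j. fst (inv_into W (to_nat_on W) j))"
  have inj: "inj_on (to_nat_on W) W" using W by (rule inj_on_to_nat_on)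
  have l: "l (to_nat_on W w) = fst w" if "w \<in> W" for w
    using that inj by (simp add: l_def inv_into_f_f)
  have fiber: "{j\<in>I. l j = a} = to_nat_on W ` ({a} \<times> {..<nat (zorder D a)})" if "D a = 0" for a
  proof -
    have "{j\<in>I. l j = a} = to_nat_on W ` {w\<in>W. fst w = a}" by (auto simp: I_def l)
    also have "{w\<in>W. fst w = a} = {a} \<times> {..<nat (zorder D a)}" using that by (auto simp: W_def)
    finally show ?thesis .
  qed
  have "finite {j\<in>I. l j = a} \<and> int (card {j\<in>I. l j = a}) = zorder D a" if a: "D a = 0" for a
  proof -
    have "{a} \<times> {..<nat (zorder D a)} \<subseteq> W" using a by (auto simp: W_def)
    then have "card {j\<in>I. l j = a} = nat (zorder D a)"
      unfolding fiber[OF a] by (subst card_image) (auto intro: inj_on_subset[OF inj])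
    then show ?thesis by (simp add: fiber[OF a] zorder_D(2))
  qed
  moreover have "D (l j) = 0" if "j \<in> I" for j
  proof -
    obtain w where "w \<in> W" "j = to_nat_on W w" using \<open>j \<in> I\<close> by (auto simp: I_def)
    then show ?thesis by (simp add: l) (auto simp: W_def)
  qed
  ultimately have "eigenvalue_list T P Q R R1 L0 L1 I l"
    unfolding eigenvalue_list_iff by blast
  then show ?thesis by blast
qed

lemma eigenvalue_product:
  assumes "eigenvalue_list T P Q R R1 L0 L1 I l"
  shows "(\<lambda>j. if j \<in> I then 1 - inverse (l j) else 1) has_prod (D 1 * inverse (D 0))"
proof -
  obtain c C where g: "c \<ge> 0" "\<And>l. norm (D l) \<le> C * exp (c * sqrt (norm l))"
    using D_growth by metis
  note l = assms[unfolded eigenvalue_list_iff]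
  interpret zero_family D I l C c
  proof
    show "j \<in> I \<Longrightarrow> D (l j) = 0" for j using l by blast
    show "D a = 0 \<Longrightarrow> finite {j\<in>I. l j = a} \<and> int (card {j\<in>I. l j = a}) = zorder D a" for a
      using l by blast
  qed (fact D_entire D_0 g)+
  show ?thesis
    using has_prod_zeros[of 1] by (simp only: inverse_eq_divide times_divide_eq_right mult_1_right)
qed

end

theorem theorem1p1:
  fixes T :: real
    and P Q R R1 :: "real \<Rightarrow> real ^ 'n ^ 'n"
    and L0 L1 :: "(real ^ ('n + 'n)) set"
    and Z0 Z1 :: "real ^ 'n ^ ('n + 'n)"
    and \<gamma> :: "complex \<Rightarrow> real \<Rightarrow> complex ^ ('n + 'n) ^ ('n + 'n)"
  assumes "T > 0"
    and "continuous_on {0..T} P" "continuous_on {0..T} Q"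
    and "continuous_on {0..T} R" "continuous_on {0..T} R1"
    and "\<And>t. t \<in> {0..T} \<Longrightarrow> transpose (P t) = P t"
    and "\<And>t. t \<in> {0..T} \<Longrightarrow> transpose (R t) = R t"
    and "\<And>t. t \<in> {0..T} \<Longrightarrow> transpose (R1 t) = R1 t"
    and "\<And>t. t \<in> {0..T} \<Longrightarrow> invertible (P t)"
    and "lagrangian L0" "lagrangian L1"
    and "lagrangian_frame Z0 L0" "lagrangian_frame Z1 L1"
    and "\<not> SL_eigenvalue T P Q R R1 L0 L1 0"
    and "\<And>l. fundamental_solution T (\<lambda>t. sympl_J ** B_matrix P Q R R1 l t) (\<gamma> l)"
  shows "det (side_by_side (\<gamma> 0 T ** cmat Z0) (cmat Z1)) \<noteq> 0 \<and>
    (\<exists>I l. eigenvalue_list T P Q R R1 L0 L1 I l) \<and>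
    (\<forall>I l. eigenvalue_list T P Q R R1 L0 L1 I l \<longrightarrow>
       (\<lambda>j. if j \<in> I then 1 - inverse (l j) else 1) has_prod
         (det (side_by_side (\<gamma> 1 T ** cmat Z0) (cmat Z1)) *
          inverse (det (side_by_side (\<gamma> 0 T ** cmat Z0) (cmat Z1)))))"
proof -
  interpret sturm_liouville_bvp T P Q R R1 \<gamma> L0 L1 Z0 Z1
    by unfold_locales (fact assms)+
  show ?thesis
    using D_0 eigenvalue_list_exists eigenvalue_product unfolding D_def by blast
qed

end
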